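(* Let $\psi\in\mathcal{S}_0(\mathbb{R}^2)$ and $f\in\mathcal{S}_0'(\mathbb{R}^2)$. The function $S_\psi f$ on $\mathbb{S}$ defined by $$S_\psi f(b,s,a)=(f,\overline{\pi_{b,s,a}\psi}),\qquad (b,s,a)\in\mathbb{S},$$ with $(\cdot,\cdot)$ the dual pairing between $\mathcal{S}_0'(\mathbb{R}^2)$ and $\mathcal{S}_0(\mathbb{R}^2)$, is a smooth function of at most polynomial growth on $\mathbb{S}$. Furthermore, identifying $S_\psi f$ with an element of $\mathcal{S}'(\mathbb{S})$ by integration against the measure $|a|^{-3}\,db\,ds\,da$, one has $$(\mathscr{S}_\psi f,\Phi)=(S_\psi f,\Phi)\qquad\text{for every }\Phi\in\mathcal{S}(\mathbb{S}),$$ where $\mathscr{S}_\psi f\in\mathcal{S}'(\mathbb{S})$ is the distributional shearlet transform of $f$ and both pairings are between $\mathcal{S}'(\mathbb{S})$ and $\mathcal{S}(\mathbb{S})$.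
   Context: Notation: $\mathbb{N}=\{0,1,2,\dots\}$, $\mathbb{R}^\times=\mathbb{R}\setminus\{0\}$, $\langle x\rangle=(1+|x|^2)^{1/2}$. Shearlet group: $\mathbb{S}=\mathbb{R}^2\times\mathbb{R}\times\mathbb{R}^\times$; put $N_s=\begin{bmatrix}1&-s\\0&1\end{bmatrix}$, $A_a=a\begin{bmatrix}1&0\\0&|a|^{-1/2}\end{bmatrix}$. For a function $\psi$ on $\mathbb{R}^2$, $\pi_{b,s,a}\psi(x)=|a|^{-3/4}\psi(A_a^{-1}N_s^{-1}(x-b))$. Lizorkin space: $\mathcal{S}_0(\mathbb{R}^2)=\{\varphi\in\mathcal{S}(\mathbb{R}^2):\int_{\mathbb{R}^2}x^m\varphi(x)\,dx=0\ \text{for all } m\in\mathbb{N}^2\}$ with the relative topology from the Schwartz space $\mathcal{S}(\mathbb{R}^2)$. The space $\mathcal{S}(\mathbb{S})$ consists of all $\Phi\in C^\infty(\mathbb{S})$ such that for all $k_1,k_2,l,m,\alpha_1,\alpha_2,\beta,\gamma\in\mathbb{N}$ the norm $$\sup_{((b_1,b_2),s,a)\in\mathbb{S}}\langle b_1\rangle^{k_1}\langle b_2\rangle^{k_2}\langle s\rangle^l\Big(|a|^m+\frac1{|a|^m}\Big)\big|\partial_a^\gamma\partial_s^\beta\partial_{b_2}^{\alpha_2}\partial_{b_1}^{\alpha_1}\Phi((b_1,b_2),s,a)\big|$$ is finite; its topology is defined by these norms. $\mathcal{S}_0'(\mathbb{R}^2)$ and $\mathcal{S}'(\mathbb{S})$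 are the topological duals; $(\cdot,\cdot)$ denotes the (bilinear) dual pairings. A function $F$ on $\mathbb{S}$ is of at most polynomial growth if there are positive constants $\nu_1,\nu_2,\nu_3,C$ with $|F(b,s,a)|\le C\langle b\rangle^{\nu_1}\langle s\rangle^{\nu_2}(|a|^{\nu_3}+|a|^{-\nu_3})$ for all $(b,s,a)\in\mathbb{S}$. Such an $F$ is identified with the element of $\mathcal{S}'(\mathbb{S})$ given by $(F,\Phi)=\int_{\mathbb{R}^\times}\int_{\mathbb{R}}\int_{\mathbb{R}^2}F(b,s,a)\Phi(b,s,a)\,|a|^{-3}\,db\,ds\,da$. Shearlet synthesis operator: for $\psi\in L^1(\mathbb{R}^2)$ and $F\in\mathcal{S}(\mathbb{S})$, $\mathcal{S}^t_\psi F(x)=\int_{\mathbb{R}^\times}\int_{\mathbb{R}}\int_{\mathbb{R}^2}F(b,s,a)\,\pi_{b,s,a}\psi(x)\,|a|^{-3}\,db\,ds\,da$; for $\psi\in\mathcal{S}_0(\mathbb{R}^2)$ the paper uses that it maps $\mathcal{S}(\mathbb{S})$ continuously into $\mathcal{S}_0(\mathbb{R}^2)$. Distributional shearlet transform: for $f\in\mathcal{S}_0'(\mathbb{R}^2)$ and $\psi\in\mathcal{S}_0(\mathbb{R}^2)$, $\mathscr{S}_\psi f\in\mathcal{S}'(\mathbb{S})$ is defined by $(\mathscr{S}_\psi f,\Phi)=(f,\mathcal{S}^t_{\overline\psi}\Phi)$ for $\Phi\in\mathcal{S}(\mathbb{S})$. *)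

theory Defs
  imports "HOL-Analysis.Analysis"
begin

section \<open>Smooth functions\<close>

definition partial :: "'a::real_normed_vector \<Rightarrow> ('a \<Rightarrow> 'b::real_normed_vector) \<Rightarrow> 'a \<Rightarrow> 'b" where
  "partial v f x = vector_derivative (\<lambda>t. f (x + t *\<^sub>R v)) (at 0)"

definition smooth_on :: "'a::euclidean_space set \<Rightarrow> ('a \<Rightarrow> 'b::real_normed_vector) \<Rightarrow> bool" where
  "smooth_on U f \<longleftrightarrow> open U \<and>
     (\<forall>vs. set vs \<subseteq> Basis \<longrightarrow>
        continuous_on U (foldr partial vs f) \<and>
        (\<forall>v\<in>Basis. \<forall>x\<in>U. (\<lambda>t. foldr partial vs f (x + t *\<^sub>R v)) differentiable (at 0)))"

definition jbracket :: "'a::real_normed_vector \<Rightarrow> real" where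
  "jbracket x = sqrt (1 + (norm x)\<^sup>2)"


section \<open>Topologies given by families of norms, and their duals\<close>

text \<open>The norms take values in \<^typ>\<open>ennreal\<close>, so that membership in a space can be stated as
  finiteness of its norms. The norms are meant to be finite on the linear space \<open>X\<close>.\<close>

definition seminorm_topology ::
  "('a \<Rightarrow> complex) set \<Rightarrow> (('a \<Rightarrow> complex) \<Rightarrow> ennreal) set \<Rightarrow> ('a \<Rightarrow> complex) topology" where
  "seminorm_topology X P = topology_generated_by
     {{g \<in> X. p (\<lambda>z. g z - f z) < ennreal e} | p f e. p \<in> P \<and> f \<in> X \<and> e > 0}"

definition topological_dual ::
  "('a \<Rightarrow> complex) topology \<Rightarrow> (('a \<Rightarrow> complex) \<Rightarrow> complex) set" where
  "topological_dual T = {u.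
     (\<forall>f\<in>topspace T. \<forall>g\<in>topspace T. u (\<lambda>z. f z + g z) = u f + u g) \<and>
     (\<forall>c. \<forall>f\<in>topspace T. u (\<lambda>z. c * f z) = c * u f) \<and>
     continuous_map T euclidean u}"


section \<open>Schwartz and Lizorkin spaces on the plane\<close>

definition schwartz_norm :: "nat \<Rightarrow> nat \<Rightarrow> nat \<Rightarrow> (real^2 \<Rightarrow> complex) \<Rightarrow> ennreal" where
  "schwartz_norm k m1 m2 \<phi> =
     (SUP x. ennreal (jbracket x ^ k *
        norm ((partial (axis 2 1) ^^ m2) ((partial (axis 1 1) ^^ m1) \<phi>) x)))"

definition schwartz_space :: "(real^2 \<Rightarrow> complex) set" where
  "schwartz_space = {\<phi>. smooth_on UNIV \<phi> \<and> (\<forall>k m1 m2. schwartz_norm k m1 m2 \<phi> < \<infinity>)}"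

definition schwartz_topology :: "(real^2 \<Rightarrow> complex) topology" where
  "schwartz_topology =
     seminorm_topology schwartz_space {schwartz_norm k m1 m2 | k m1 m2. True}"

definition lizorkin_space :: "(real^2 \<Rightarrow> complex) set" where
  "lizorkin_space = {\<phi> \<in> schwartz_space.
     \<forall>m1 m2. (LINT x|lborel. of_real (x $ 1 ^ m1 * x $ 2 ^ m2) * \<phi> x) = 0}"

definition lizorkin_topology :: "(real^2 \<Rightarrow> complex) topology" where
  "lizorkin_topology = subtopology schwartz_topology lizorkin_space"


section \<open>The shearlet group and functions on it\<close>

text \<open>Functions on the shearlet group are represented by functions on the ambient vector space
  \<^typ>\<open>(real^2) \<times> real \<times> real\<close>; their values at points with \<open>a = 0\<close> play no role.\<close>

type_synonym shear_point = "(real^2) \<times> real \<times> real"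

definition shearlet_group :: "shear_point set" where
  "shearlet_group = {(b, s, a). a \<noteq> 0}"

definition group_norm ::
  "nat \<Rightarrow> nat \<Rightarrow> nat \<Rightarrow> nat \<Rightarrow> nat \<Rightarrow> nat \<Rightarrow> nat \<Rightarrow> nat \<Rightarrow> (shear_point \<Rightarrow> complex) \<Rightarrow> ennreal" where
  "group_norm k1 k2 l m \<alpha>1 \<alpha>2 \<beta> \<gamma> \<Phi> =
     (SUP (b, s, a)\<in>shearlet_group.
        ennreal (jbracket (b $ 1) ^ k1 * jbracket (b $ 2) ^ k2 * jbracket s ^ l *
          (\<bar>a\<bar> ^ m + 1 / \<bar>a\<bar> ^ m) *
          norm ((partial (0, 0, 1) ^^ \<gamma>) ((partial (0, 1, 0) ^^ \<beta>)
            ((partial (axis 2 1, 0, 0) ^^ \<alpha>2) ((partial (axis 1 1, 0, 0) ^^ \<alpha>1) \<Phi>))) (b, s, a))))"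

definition group_schwartz_space :: "(shear_point \<Rightarrow> complex) set" where
  "group_schwartz_space = {\<Phi>. smooth_on shearlet_group \<Phi> \<and>
     (\<forall>k1 k2 l m \<alpha>1 \<alpha>2 \<beta> \<gamma>. group_norm k1 k2 l m \<alpha>1 \<alpha>2 \<beta> \<gamma> \<Phi> < \<infinity>)}"

definition group_schwartz_topology :: "(shear_point \<Rightarrow> complex) topology" where
  "group_schwartz_topology = seminorm_topology group_schwartz_space
     {group_norm k1 k2 l m \<alpha>1 \<alpha>2 \<beta> \<gamma> | k1 k2 l m \<alpha>1 \<alpha>2 \<beta> \<gamma>. True}"

definition polynomial_growth :: "(shear_point \<Rightarrow> complex) \<Rightarrow> bool" where
  "polynomial_growth F \<longleftrightarrow>
     (\<exists>\<nu>1>0. \<exists>\<nu>2>0. \<exists>\<nu>3>0. \<exists>C>0. \<forall>(b, s, a)\<in>shearlet_group.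
        norm (F (b, s, a)) \<le>
          C * jbracket b powr \<nu>1 * jbracket s powr \<nu>2 * (\<bar>a\<bar> powr \<nu>3 + \<bar>a\<bar> powr (- \<nu>3)))"

definition regular_functional :: "(shear_point \<Rightarrow> complex) \<Rightarrow> (shear_point \<Rightarrow> complex) \<Rightarrow> complex" where
  "regular_functional F \<Phi> =
     (LINT a:-{0}|lborel. LINT s|lborel. LINT b|lborel.
        F (b, s, a) * \<Phi> (b, s, a) * of_real (\<bar>a\<bar> powi (-3)))"


section \<open>Shearlet transforms\<close>

definition shear_matrix :: "real \<Rightarrow> real^2^2" where
  "shear_matrix s = vector [vector [1, - s], vector [0, 1]]"

definition dilation_matrix :: "real \<Rightarrow> real^2^2" where
  "dilation_matrix a = a *\<^sub>R vector [vector [1, 0], vector [0, \<bar>a\<bar> powr (-1/2)]]"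

definition shearlet ::
  "real^2 \<Rightarrow> real \<Rightarrow> real \<Rightarrow> (real^2 \<Rightarrow> complex) \<Rightarrow> real^2 \<Rightarrow> complex" where
  "shearlet b s a \<psi> x = of_real (\<bar>a\<bar> powr (-3/4)) *
     \<psi> (matrix_inv (dilation_matrix a) *v (matrix_inv (shear_matrix s) *v (x - b)))"

definition shearlet_synthesis ::
  "(real^2 \<Rightarrow> complex) \<Rightarrow> (shear_point \<Rightarrow> complex) \<Rightarrow> real^2 \<Rightarrow> complex" where
  "shearlet_synthesis \<psi> F x =
     (LINT a:-{0}|lborel. LINT s|lborel. LINT b|lborel.
        F (b, s, a) * shearlet b s a \<psi> x * of_real (\<bar>a\<bar> powi (-3)))"

definition distributional_shearlet_transform ::
  "(real^2 \<Rightarrow> complex) \<Rightarrow> ((real^2 \<Rightarrow> complex) \<Rightarrow> complex) \<Rightarrow> (shear_point \<Rightarrow> complex) \<Rightarrow> complex" where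
  "distributional_shearlet_transform \<psi> f \<Phi> = f (shearlet_synthesis (\<lambda>x. cnj (\<psi> x)) \<Phi>)"

definition shearlet_transform_function ::
  "(real^2 \<Rightarrow> complex) \<Rightarrow> ((real^2 \<Rightarrow> complex) \<Rightarrow> complex) \<Rightarrow> shear_point \<Rightarrow> complex" where
  "shearlet_transform_function \<psi> f = (\<lambda>(b, s, a). f (\<lambda>x. cnj (shearlet b s a \<psi> x)))"


section \<open>The underlying sets of the topologies\<close>

lemma partial_zero [simp]: "partial v (\<lambda>z. 0) = (\<lambda>z. 0)"
  by (simp add: partial_def fun_eq_iff)

lemma partial_pow_zero [simp]: "(partial v ^^ n) (\<lambda>z. 0) = (\<lambda>z. 0)"
  by (induction n) auto

lemma topspace_seminorm_topology:
  assumes "p \<in> P" "p (\<lambda>z. 0) = 0"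
  shows "topspace (seminorm_topology X P) = X"
proof -
  let ?B = "{{g \<in> X. p (\<lambda>z. g z - f z) < ennreal e} | p f e. p \<in> P \<and> f \<in> X \<and> e > 0}"
  have "f \<in> \<Union>?B" if "f \<in> X" for f
  proof
    show "{g \<in> X. p (\<lambda>z. g z - f z) < ennreal 1} \<in> ?B"
      using that assms(1) zero_less_one by blast
    show "f \<in> {g \<in> X. p (\<lambda>z. g z - f z) < ennreal 1}"
      using that assms(2) by simp
  qed
  moreover have "\<Union>?B \<subseteq> X"
    by blast
  ultimately show ?thesis
    unfolding seminorm_topology_def topology_generated_by_topspace by blast
qed

lemma topspace_schwartz [simp]: "topspace schwartz_topology = schwartz_space"
  unfolding schwartz_topology_def
proof (rule topspace_seminorm_topology)
  show "schwartz_norm 0 0 0 \<in> {schwartz_norm k m1 m2 | k m1 m2. True}"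
    by blast
  show "schwartz_norm 0 0 0 (\<lambda>z. 0) = 0"
    by (simp add: schwartz_norm_def)
qed

lemma topspace_lizorkin [simp]: "topspace lizorkin_topology = lizorkin_space"
  by (auto simp: lizorkin_topology_def lizorkin_space_def)

lemma topspace_group_schwartz [simp]: "topspace group_schwartz_topology = group_schwartz_space"
proof -
  have "(0, 0, 1) \<in> shearlet_group"
    by (simp add: shearlet_group_def)
  then have ne: "shearlet_group \<noteq> {}"
    by blast
  have zero: "group_norm 0 0 0 0 0 0 0 0 (\<lambda>z. 0) = 0"
    by (simp add: group_norm_def case_prod_unfold ne)
  show ?thesis
    unfolding group_schwartz_topology_def
  proof (rule topspace_seminorm_topology)
    show "group_norm 0 0 0 0 0 0 0 0 \<in> {group_norm k1 k2 l m \<alpha>1 \<alpha>2 \<beta> \<gamma> | k1 k2 l m \<alpha>1 \<alpha>2 \<beta> \<gamma>. True}"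
      unfolding mem_Collect_eq by (intro exI conjI TrueI) (rule refl)
  qed (rule zero)
qed

end

theory Submission
  imports Defs "HOL-Probability.Sinc_Integral"
begin

text \<open>With \<open>\<eta> = cnj \<circ> \<psi>\<close>, both sides are governed by the kernel \<open>k (z, x) = |a|\<^bsup>-3/4\<^esup> \<eta> (y (z, x))\<close>, where
  \<open>z = (b, s, a)\<close> and \<open>y\<close> is affine in \<open>x\<close>. Differentiating \<open>k\<close> in any of the variables of \<open>z\<close> or \<open>x\<close> gives a
  combination, with coefficients polynomial in \<open>s\<close>, powers of \<open>|a|\<close> and the sign of \<open>a\<close>, of kernels of
  the same form for other Lizorkin functions. Each of them is bounded by a power of a weight in \<open>z\<close>, with arbitrarily fast
  decay in \<open>x\<close>. Taylor's formula with these bounds shows that \<open>z \<mapsto> k (z, \<cdot>)\<close> is differentiable into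
  the Lizorkin space, whence the smoothness and the growth of \<open>z \<mapsto> f (k (z, \<cdot>))\<close>.

  For the identity \<open>f (\<integral> G z k (z, \<cdot>) dz) = \<integral> G z f (k (z, \<cdot>)) dz\<close> consider the difference \<open>\<tau> Q\<close> of the two
  sides when \<open>G\<close> is cut off to \<open>Q\<close>. It is additive in \<open>Q\<close>, at most \<open>\<epsilon> \<integral>\<^sub>Q |G|\<close> on sets on which \<open>k (z, \<cdot>)\<close> is
  nearly constant in \<open>z\<close>, and at most a weighted integral of \<open>|G|\<close> over \<open>Q\<close> in general. Covering the group by countably
  many sets of the first kind and applying the general bound to what remains after finitely many of
  them gives \<open>\<tau> = 0\<close>.\<close>

section \<open>Smooth functions\<close>

text \<open>An element of the dual is known only through linearity and a bound by finitely many
  Schwartz seminorms. Hence every estimate must hold at once for all plane derivatives up to some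
  order N with the factor \<open>jbracket x ^ N\<close>, and every function handed to
  \<open>f\<close> must first be shown to have vanishing moments. Doing without vector-valued
  integrals into the Lizorkin space is what leads to the covering argument. A second obstacle is
  that \<open>smooth_on\<close> speaks of iterated partial derivatives in every order, each a vector
  derivative along a line. Explicit formulas for the iterates are avoided: a class of functions
  closed under first derivatives is exhibited, and smoothness and decay follow by coinduction.
  Closure dictates the form of the kernels: 1/a is split into a sign and a power of |a|, and the
  coordinates of \<open>shear_arg\<close> that the chain rule produces are absorbed by multiplying a
  Lizorkin function by a coordinate, which stays in the Lizorkin space.\<close>

abbreviation line_deriv :: "('a::real_normed_vector \<Rightarrow> 'b::real_normed_vector) \<Rightarrow> 'a \<Rightarrow> 'a \<Rightarrow> 'b \<Rightarrow> bool" where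
  "line_deriv g x v d \<equiv> ((\<lambda>t. g (x + t *\<^sub>R v)) has_vector_derivative d) (at 0)"

lemma has_vector_derivative_line:
  fixes g :: "'a::real_normed_vector \<Rightarrow> 'b::real_normed_vector"
  assumes "((\<lambda>t. g ((x + t0 *\<^sub>R v) + t *\<^sub>R v)) has_vector_derivative g') (at 0)"
  shows "((\<lambda>t. g (x + t *\<^sub>R v)) has_vector_derivative g') (at t0)"
proof -
  have "((\<lambda>t. g (x + t0 *\<^sub>R v + t *\<^sub>R v)) \<circ> (\<lambda>t. t - t0) has_vector_derivative 1 *\<^sub>R g') (at t0)"
    using assms by (intro vector_diff_chain_at) (auto intro!: derivative_eq_intros)
  moreover have "(\<lambda>t. g (x + t0 *\<^sub>R v + t *\<^sub>R v)) \<circ> (\<lambda>t. t - t0) = (\<lambda>t. g (x + t *\<^sub>R v))"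
    by (auto simp: fun_eq_iff algebra_simps)
  ultimately show ?thesis by simp
qed

lemma eventually_line_in_open:
  fixes x :: "'a::real_normed_vector"
  assumes "open U" "x \<in> U"
  shows "eventually (\<lambda>t. x + t *\<^sub>R v \<in> U) (nhds (0::real))"
proof -
  have "((\<lambda>t. x + t *\<^sub>R v) \<longlongrightarrow> x + 0 *\<^sub>R v) (nhds (0::real))"
    by (intro tendsto_intros) (simp add: filterlim_ident)
  then show ?thesis
    using assms by (intro topological_tendstoD) auto
qed

lemma has_vector_derivative_line_cong:
  fixes g :: "'a::real_normed_vector \<Rightarrow> 'b::real_normed_vector"
  assumes "open U" "x \<in> U" "\<And>y. y \<in> U \<Longrightarrow> h y = g y"
    and "line_deriv g x v d"
  shows "line_deriv h x v d"
proof -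
  have "eventually (\<lambda>t. h (x + t *\<^sub>R v) = g (x + t *\<^sub>R v)) (nhds 0)"
    using eventually_line_in_open[OF assms(1,2)] by eventually_elim (rule assms(3))
  then obtain S where S: "open S" "0 \<in> S" "\<And>t. t \<in> S \<Longrightarrow> h (x + t *\<^sub>R v) = g (x + t *\<^sub>R v)"
    unfolding eventually_nhds by auto
  show ?thesis
    by (rule has_vector_derivative_transform_within_open[OF assms(4) S(1,2)]) (simp add: S(3))
qed

text \<open>\<open>partial\<close> also sees \<open>h\<close> outside U, but since U is open, a
  derivative along a line at a point of U depends only on values in U. Agreement on U therefore
  survives each differentiation.\<close>

lemma foldr_partial_class:
  fixes h :: "'a::euclidean_space \<Rightarrow> 'b::real_normed_vector"
  assumes U: "open U"
    and D: "\<And>g v. P g \<Longrightarrow> v \<in> Basis \<Longrightarrow>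
      \<exists>g'. P g' \<and> (\<forall>x\<in>U. line_deriv g x v (g' x))"
    and g: "P g" "\<And>x. x \<in> U \<Longrightarrow> h x = g x" and vs: "set vs \<subseteq> Basis"
  shows "\<exists>g'. P g' \<and> (\<forall>x\<in>U. foldr partial vs h x = g' x)"
  using vs
proof (induction vs)
  case Nil
  then show ?case using g by auto
next
  case (Cons v vs)
  then obtain g1 where g1: "P g1" "\<And>x. x \<in> U \<Longrightarrow> foldr partial vs h x = g1 x" by auto
  obtain g2 where g2: "P g2" "\<forall>x\<in>U. line_deriv g1 x v (g2 x)"
    using D[OF g1(1), of v] Cons.prems by auto
  have "foldr partial (v # vs) h x = g2 x" if "x \<in> U" for x
    using has_vector_derivative_line_cong[OF U that g1(2) g2(2)[rule_format, OF that]]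
    by (simp add: partial_def vector_derivative_at)
  then show ?case using g2(1) by auto
qed

text \<open>Coinduction for smoothness: closure of P under first derivatives and continuity of its
  members replace any computation with iterated derivatives.\<close>

lemma smooth_on_coinduct:
  fixes h :: "'a::euclidean_space \<Rightarrow> 'b::real_normed_vector"
  assumes U: "open U"
    and C: "\<And>g. P g \<Longrightarrow> continuous_on U g"
    and D: "\<And>g v. P g \<Longrightarrow> v \<in> Basis \<Longrightarrow>
      \<exists>g'. P g' \<and> (\<forall>x\<in>U. line_deriv g x v (g' x))"
    and g: "P g" "\<And>x. x \<in> U \<Longrightarrow> h x = g x"
  shows "smooth_on U h"
  unfolding smooth_on_def
proof (intro conjI allI impI ballI)
  fix vs :: "'a list" assume vs: "set vs \<subseteq> Basis"
  obtain g1 where g1: "P g1" "\<And>x. x \<in> U \<Longrightarrow> foldr partial vs h x = g1 x"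
    using foldr_partial_class[OF U D g vs] by auto
  show "continuous_on U (foldr partial vs h)"
    using C[OF g1(1)] g1(2) by (simp cong: continuous_on_cong)
  fix v x assume v: "v \<in> (Basis :: 'a set)" and x: "x \<in> U"
  obtain g2 where "\<forall>x\<in>U. line_deriv g1 x v (g2 x)"
    using D[OF g1(1) v] by auto
  from has_vector_derivative_line_cong[OF U x g1(2) this[rule_format, OF x]]
  show "(\<lambda>t. foldr partial vs h (x + t *\<^sub>R v)) differentiable at 0"
    by (metis differentiableI_vector)
qed (rule U)

lemma smooth_on_has_vector_derivative:
  assumes "smooth_on U f" "v \<in> Basis" "x \<in> U"
  shows "line_deriv f x v (partial v f x)"
proof -
  have "(\<lambda>t. foldr partial [] f (x + t *\<^sub>R v)) differentiable at 0"
    using assms unfolding smooth_on_def by (metis empty_subsetI list.set(1))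
  then show ?thesis
    by (simp add: partial_def vector_derivative_works)
qed

lemma smooth_on_continuous: "smooth_on U f \<Longrightarrow> continuous_on U f"
  unfolding smooth_on_def by (metis empty_subsetI foldr.simps(1) id_apply list.set(1))

lemma smooth_on_partial:
  assumes "smooth_on U f" "v \<in> Basis"
  shows "smooth_on U (partial v f)"
proof -
  have "foldr partial vs (partial v f) = foldr partial (vs @ [v]) f" for vs
    by simp
  moreover have "set (vs @ [v]) \<subseteq> Basis" if "set vs \<subseteq> Basis" for vs
    using that assms(2) by auto
  ultimately show ?thesis
    using assms(1) unfolding smooth_on_def by metis
qed

lemma smooth_on_partial_pow:
  "smooth_on U f \<Longrightarrow> v \<in> Basis \<Longrightarrow> smooth_on U ((partial v ^^ n) f)"
  by (induction n) (auto intro: smooth_on_partial)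

lemma partial_comb:
  fixes g h :: "'a::real_normed_vector \<Rightarrow> complex"
  assumes "line_deriv g x v g'"
    and "line_deriv h x v h'"
  shows "((\<lambda>t. c * g (x + t *\<^sub>R v) + d * h (x + t *\<^sub>R v)) has_vector_derivative c * g' + d * h') (at 0)"
  by (intro has_vector_derivative_add has_vector_derivative_mult_right assms)

text \<open>A Schwarz theorem that assumes only one of the two mixed derivatives. Write
  \<open>\<phi>\<close> along \<open>e\<close> as an integral of \<open>\<phi>e\<close>,
  differentiate under the integral in direction \<open>d\<close>, and apply the fundamental theorem.
  Invariance of the domain is asked for along \<open>e\<close> only, which covers both the plane and
  the product of group and plane.\<close>

lemma symmetric_partial:
  fixes \<phi> :: "'a::real_normed_vector \<Rightarrow> 'b::banach"
  assumes U: "open U" "x \<in> U" "\<And>x t. x \<in> U \<Longrightarrow> x + t *\<^sub>R e \<in> U"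
    and e: "\<And>x. x \<in> U \<Longrightarrow> line_deriv \<phi> x e (\<phi>e x)"
    and d: "\<And>x. x \<in> U \<Longrightarrow> line_deriv \<phi> x d (\<phi>d x)"
    and ed: "\<And>x. x \<in> U \<Longrightarrow> line_deriv \<phi>e x d (\<phi>ed x)"
    and ce: "continuous_on U \<phi>e" and ced: "continuous_on U \<phi>ed"
  shows "line_deriv \<phi>d x e (\<phi>ed x)"
proof -
  \<comment> \<open>Starting the integration along \<open>e\<close> at \<open>x - e\<close> makes \<open>x\<close> an interior point, so that the
    fundamental theorem of calculus gives a two-sided derivative there.\<close>
  define y where "y = x - e"
  have y: "y \<in> U" using U(2) U(3)[of x "-1"] by (simp add: y_def)
  obtain r where r: "r > 0" "\<And>v. \<bar>v\<bar> < r \<Longrightarrow> y + v *\<^sub>R d \<in> U"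
    using eventually_line_in_open[OF U(1) y, of d] unfolding eventually_nhds_metric
    by (auto simp: dist_real_def)
  have yU: "y + v *\<^sub>R d + w *\<^sub>R e \<in> U" if "v \<in> ball 0 r" for v w
    using r(2)[of v] that U(3) by simp
  have r0: "(0::real) \<in> ball 0 r" using r by simp
  have int: "\<phi>d (y + u *\<^sub>R e) = \<phi>d y + integral {0..u} (\<lambda>w. \<phi>ed (y + w *\<^sub>R e))" if u: "0 \<le> u" for u
  proof -
    have ftc: "\<phi> (y + v *\<^sub>R d + u *\<^sub>R e) =
        \<phi> (y + v *\<^sub>R d) + integral {0..u} (\<lambda>w. \<phi>e (y + v *\<^sub>R d + w *\<^sub>R e))" if v: "v \<in> ball 0 r" for v
    proof -
      have "((\<lambda>w. \<phi>e (y + v *\<^sub>R d + w *\<^sub>R e)) has_integral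
          \<phi> (y + v *\<^sub>R d + u *\<^sub>R e) - \<phi> (y + v *\<^sub>R d + 0 *\<^sub>R e)) {0..u}"
        by (rule fundamental_theorem_of_calculus[OF u])
          (rule has_vector_derivative_at_within, rule has_vector_derivative_line, rule e, rule yU, rule v)
      then show ?thesis by (simp add: integral_unique)
    qed
    have "((\<lambda>v. integral (cbox 0 u) (\<lambda>w. \<phi>e (y + v *\<^sub>R d + w *\<^sub>R e))) has_vector_derivative
        integral (cbox 0 u) (\<lambda>w. \<phi>ed (y + 0 *\<^sub>R d + w *\<^sub>R e))) (at 0 within ball 0 r)"
    proof (rule leibniz_rule_vector_derivative)
      fix v w :: real
      assume v: "v \<in> ball 0 r"
      have "((\<lambda>v. \<phi>e (y + w *\<^sub>R e + v *\<^sub>R d)) has_vector_derivative \<phi>ed (y + w *\<^sub>R e + v *\<^sub>R d)) (at v)"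
        using yU[OF v, of w] by (intro has_vector_derivative_line[OF ed]) (simp add: add_ac)
      then have "((\<lambda>v. \<phi>e (y + v *\<^sub>R d + w *\<^sub>R e)) has_vector_derivative
          \<phi>ed (y + v *\<^sub>R d + w *\<^sub>R e)) (at v)"
        by (simp add: add_ac)
      then show "((\<lambda>v. \<phi>e (y + v *\<^sub>R d + w *\<^sub>R e)) has_vector_derivative
          \<phi>ed (y + v *\<^sub>R d + w *\<^sub>R e)) (at v within ball 0 r)"
        by (rule has_vector_derivative_at_within)
    next
      fix v :: real
      assume v: "v \<in> ball 0 r"
      show "(\<lambda>w. \<phi>e (y + v *\<^sub>R d + w *\<^sub>R e)) integrable_on cbox 0 u"
        using yU[OF v] by (intro integrable_continuous continuous_on_compose2[OF ce] continuous_intros) auto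
    next
      show "continuous_on (ball 0 r \<times> cbox 0 u) (\<lambda>(v, w). \<phi>ed (y + v *\<^sub>R d + w *\<^sub>R e))"
        unfolding case_prod_unfold
      proof (intro continuous_on_compose2[OF ced] continuous_intros)
        show "(\<lambda>p. y + fst p *\<^sub>R d + snd p *\<^sub>R e) ` (ball 0 r \<times> cbox 0 u) \<subseteq> U"
          by (rule image_subsetI) (auto intro: yU)
      qed
    qed (use r0 in auto)
    then have I: "((\<lambda>v. integral {0..u} (\<lambda>w. \<phi>e (y + v *\<^sub>R d + w *\<^sub>R e))) has_vector_derivative
        integral {0..u} (\<lambda>w. \<phi>ed (y + w *\<^sub>R e))) (at 0)"
      using at_within_open[OF r0 open_ball] by simp
    have "((\<lambda>v. \<phi> (y + v *\<^sub>R d + u *\<^sub>R e)) has_vector_derivative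
        \<phi>d y + integral {0..u} (\<lambda>w. \<phi>ed (y + w *\<^sub>R e))) (at 0)"
      by (rule has_vector_derivative_transform_within_open[OF has_vector_derivative_add[OF d[OF y] I] open_ball r0])
        (simp only: ftc)
    moreover have "((\<lambda>v. \<phi> (y + v *\<^sub>R d + u *\<^sub>R e)) has_vector_derivative \<phi>d (y + u *\<^sub>R e)) (at 0)"
      using d[OF U(3)[OF y, of u]] by (simp add: add_ac)
    ultimately show ?thesis
      by (rule vector_derivative_unique_at[symmetric])
  qed
  have "((\<lambda>u. integral {0..u} (\<lambda>w. \<phi>ed (y + w *\<^sub>R e))) has_vector_derivative \<phi>ed (y + 1 *\<^sub>R e)) (at 1 within {0..2})"
    using U(3)[OF y] by (intro integral_has_vector_derivative continuous_on_compose2[OF ced] continuous_intros) auto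
  then have "((\<lambda>u. \<phi>d y + integral {0..u} (\<lambda>w. \<phi>ed (y + w *\<^sub>R e))) has_vector_derivative \<phi>ed x) (at 1 within {0..2})"
    by (auto intro!: derivative_eq_intros simp: y_def)
  then have "((\<lambda>u. \<phi>d (y + u *\<^sub>R e)) has_vector_derivative \<phi>ed x) (at 1 within {0..2})"
    by (rule has_vector_derivative_transform[rotated 2]) (auto simp: int)
  then have "((\<lambda>u. \<phi>d (y + u *\<^sub>R e)) has_vector_derivative \<phi>ed x) (at 1)"
    by (simp add: has_vector_derivative_def at_within_Icc_at)
  then have "((\<lambda>u. \<phi>d (y + u *\<^sub>R e)) \<circ> (\<lambda>t. 1 + t) has_vector_derivative 1 *\<^sub>R \<phi>ed x) (at 0)"
    by (intro vector_diff_chain_at) (auto intro!: derivative_eq_intros)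
  moreover have "(\<lambda>u. \<phi>d (y + u *\<^sub>R e)) \<circ> (\<lambda>t. 1 + t) = (\<lambda>t. \<phi>d (x + t *\<^sub>R e))"
    by (auto simp: fun_eq_iff y_def algebra_simps)
  ultimately show ?thesis by simp
qed

lemma smooth_on_partial_commute:
  fixes f :: "'a::euclidean_space \<Rightarrow> 'b::banach"
  assumes f: "smooth_on UNIV f" and v: "v \<in> Basis" and w: "w \<in> Basis"
  shows "partial v (partial w f) = partial w (partial v f)"
proof
  fix x
  have "line_deriv (partial w f) x v (partial w (partial v f) x)"
    by (rule symmetric_partial[where U = UNIV and \<phi> = f and \<phi>e = "partial v f" and d = w])
      (use f v w in \<open>auto intro: smooth_on_has_vector_derivative smooth_on_partial smooth_on_continuous\<close>)
  then show "partial v (partial w f) x = partial w (partial v f) x"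
    by (simp add: partial_def vector_derivative_at)
qed

lemma smooth_on_partial_pow_commute:
  fixes f :: "'a::euclidean_space \<Rightarrow> 'b::banach"
  assumes "smooth_on UNIV f" "v \<in> Basis" "w \<in> Basis"
  shows "partial v ((partial w ^^ n) f) = (partial w ^^ n) (partial v f)"
proof (induction n)
  case (Suc n)
  have "partial v (partial w ((partial w ^^ n) f)) = partial w (partial v ((partial w ^^ n) f))"
    using assms by (intro smooth_on_partial_commute smooth_on_partial_pow)
  then show ?case
    using Suc by simp
qed simp

section \<open>Schwartz functions on the plane\<close>

abbreviation e1 :: "real^2" where "e1 \<equiv> axis 1 1"
abbreviation e2 :: "real^2" where "e2 \<equiv> axis 2 1"

definition pd :: "nat \<Rightarrow> nat \<Rightarrow> (real^2 \<Rightarrow> complex) \<Rightarrow> real^2 \<Rightarrow> complex" where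
  "pd m1 m2 \<phi> = (partial e2 ^^ m2) ((partial e1 ^^ m1) \<phi>)"

lemma Basis_plane: "(Basis :: (real^2) set) = {e1, e2}"
  by (auto simp: Basis_vec_def UNIV_2)

lemma e1_neq_e2: "e1 \<noteq> e2"
  by (simp add: axis_eq_axis)

lemma jbracket_ge_1: "1 \<le> jbracket x"
  by (simp add: jbracket_def)

lemma jbracket_pos: "0 < jbracket x"
  using jbracket_ge_1[of x] by linarith

lemma norm_le_jbracket: "norm x \<le> jbracket x"
  unfolding jbracket_def by (rule real_le_rsqrt) simp

lemma component_le_jbracket: "\<bar>x $ i\<bar> \<le> jbracket (x :: real^2)"
  using component_le_norm_cart[of x i] norm_le_jbracket[of x] by linarith

lemma norm_plane_sq: "(norm (x :: real^2))\<^sup>2 = (x $ 1)\<^sup>2 + (x $ 2)\<^sup>2"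
  by (simp add: norm_vec_def L2_set_def UNIV_2)

text \<open>Bridges two formats: smoothness quantifies over arbitrary lists of directions, the
  Schwartz norms over derivatives along \<open>e1\<close> followed by derivatives along
  \<open>e2\<close>. Commuting a new \<open>e1\<close> past the block of \<open>e2\<close> restores
  the normal form.\<close>

lemma foldr_partial_eq_pd:
  assumes "smooth_on UNIV \<phi>" "set vs \<subseteq> Basis"
  shows "\<exists>m1 m2. foldr partial vs \<phi> = pd m1 m2 \<phi>"
  using assms(2)
proof (induction vs)
  case Nil
  then show ?case by (intro exI[of _ 0]) (simp add: pd_def)
next
  case (Cons v vs)
  then obtain m1 m2 where m: "foldr partial vs \<phi> = pd m1 m2 \<phi>" by auto
  consider "v = e1" | "v = e2" using Cons.prems by (auto simp: Basis_plane)
  then show ?case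
  proof cases
    case 1
    have "partial e1 ((partial e2 ^^ m2) ((partial e1 ^^ m1) \<phi>)) = (partial e2 ^^ m2) (partial e1 ((partial e1 ^^ m1) \<phi>))"
      by (intro smooth_on_partial_pow_commute smooth_on_partial_pow assms) (auto simp: Basis_plane)
    then have "foldr partial (v # vs) \<phi> = pd (Suc m1) m2 \<phi>"
      by (simp add: m 1 pd_def)
    then show ?thesis by blast
  next
    case 2
    then have "foldr partial (v # vs) \<phi> = pd m1 (Suc m2) \<phi>"
      by (simp add: m pd_def)
    then show ?thesis by blast
  qed
qed

lemma pd_eq_foldr_partial: "\<exists>vs. set vs \<subseteq> Basis \<and> (\<forall>\<phi>. pd m1 m2 \<phi> = foldr partial vs \<phi>)"
proof -
  have "pd m1 m2 \<phi> = foldr partial (replicate m2 e2 @ replicate m1 e1) \<phi>" for \<phi>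
    by (simp add: pd_def foldr_replicate)
  then show ?thesis
    by (intro exI[of _ "replicate m2 e2 @ replicate m1 e1"]) (auto simp: Basis_plane)
qed

lemma schwartz_norm_eq: "schwartz_norm k m1 m2 \<phi> = (SUP x. ennreal (jbracket x ^ k * norm (pd m1 m2 \<phi> x)))"
  by (simp add: schwartz_norm_def pd_def)

lemma schwartz_smooth: "\<phi> \<in> schwartz_space \<Longrightarrow> smooth_on UNIV \<phi>"
  by (simp add: schwartz_space_def)

lemma schwartz_bound_foldr:
  assumes "\<phi> \<in> schwartz_space" "set vs \<subseteq> Basis"
  shows "\<exists>C>0. \<forall>x. jbracket x ^ N * norm (foldr partial vs \<phi> x) \<le> C"
proof -
  obtain m1 m2 where m: "foldr partial vs \<phi> = pd m1 m2 \<phi>"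
    using foldr_partial_eq_pd[OF schwartz_smooth[OF assms(1)] assms(2)] by blast
  have fin: "schwartz_norm N m1 m2 \<phi> < \<infinity>"
    using assms(1) by (simp add: schwartz_space_def)
  define C where "C = enn2real (schwartz_norm N m1 m2 \<phi>)"
  have C: "schwartz_norm N m1 m2 \<phi> = ennreal C" "C \<ge> 0"
    using fin unfolding C_def by (auto simp: less_top)
  have "jbracket x ^ N * norm (foldr partial vs \<phi> x) \<le> C" for x
  proof -
    have "ennreal (jbracket x ^ N * norm (pd m1 m2 \<phi> x)) \<le> schwartz_norm N m1 m2 \<phi>"
      unfolding schwartz_norm_eq by (rule SUP_upper) simp
    then show ?thesis
      using C by (simp add: m)
  qed
  \<comment> \<open>The added 1 makes the constant strictly positive.\<close>
  then have "jbracket x ^ N * norm (foldr partial vs \<phi> x) \<le> C + 1" for x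
    by (meson add_increasing2 order_trans zero_le_one order_refl)
  then show ?thesis
    using C(2) by (intro exI[of _ "C + 1"]) auto
qed

lemma schwartz_bound:
  assumes "\<phi> \<in> schwartz_space"
  shows "\<exists>C>0. \<forall>x. jbracket x ^ N * norm (\<phi> x) \<le> C"
  using schwartz_bound_foldr[OF assms, of "[]"] by simp

lemma schwartz_norm_le:
  assumes "\<And>x. jbracket x ^ k * norm (pd m1 m2 \<phi> x) \<le> C"
  shows "schwartz_norm k m1 m2 \<phi> \<le> ennreal C"
  unfolding schwartz_norm_eq by (rule SUP_least) (simp add: assms ennreal_leI)

lemma schwartz_spaceI:
  assumes "smooth_on UNIV \<phi>"
    and "\<And>vs N. set vs \<subseteq> Basis \<Longrightarrow> \<exists>C. \<forall>x. jbracket x ^ N * norm (foldr partial vs \<phi> x) \<le> C"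
  shows "\<phi> \<in> schwartz_space"
  unfolding schwartz_space_def
proof (intro CollectI conjI allI assms(1))
  fix k m1 m2
  obtain vs where "set vs \<subseteq> Basis" "pd m1 m2 \<phi> = foldr partial vs \<phi>"
    using pd_eq_foldr_partial[of m1 m2] by metis
  then obtain C where "\<forall>x. jbracket x ^ k * norm (pd m1 m2 \<phi> x) \<le> C"
    using assms(2) by metis
  then have "schwartz_norm k m1 m2 \<phi> \<le> ennreal C"
    by (intro schwartz_norm_le) auto
  then show "schwartz_norm k m1 m2 \<phi> < \<infinity>"
    by (rule le_less_trans) simp
qed

text \<open>Pointwise decay of the members of P is enough: each derivative of \<open>g\<close> is
  again a member and so has a bound of its own.\<close>

lemma schwartz_coinduct:
  assumes C: "\<And>g. P g \<Longrightarrow> continuous_on UNIV g"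
    and D: "\<And>g v. P g \<Longrightarrow> v \<in> Basis \<Longrightarrow>
      \<exists>g'. P g' \<and> (\<forall>x. line_deriv g x v (g' x))"
    and B: "\<And>g N. P g \<Longrightarrow> \<exists>C. \<forall>x. jbracket x ^ N * norm (g x) \<le> C"
    and g: "P g"
  shows "g \<in> schwartz_space"
proof (rule schwartz_spaceI)
  show "smooth_on UNIV g"
    by (rule smooth_on_coinduct[of UNIV P g]) (use C D g in auto)
  fix vs :: "(real^2) list" and N assume vs: "set vs \<subseteq> Basis"
  obtain g' where "P g'" "foldr partial vs g = g'"
    using foldr_partial_class[of UNIV P g g vs] D g vs by (auto simp: fun_eq_iff)
  then show "\<exists>C. \<forall>x. jbracket x ^ N * norm (foldr partial vs g x) \<le> C"
    using B by blast
qed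

lemma schwartz_has_vector_derivative:
  assumes "\<phi> \<in> schwartz_space" "v \<in> Basis"
  shows "line_deriv \<phi> x v (partial v \<phi> x)"
  using assms by (intro smooth_on_has_vector_derivative[of UNIV]) (auto simp: schwartz_smooth)

lemma schwartz_continuous: "\<phi> \<in> schwartz_space \<Longrightarrow> continuous_on UNIV \<phi>"
  by (simp add: schwartz_smooth smooth_on_continuous)

lemma schwartz_partial:
  assumes "\<phi> \<in> schwartz_space" "v \<in> Basis"
  shows "partial v \<phi> \<in> schwartz_space"
proof (rule schwartz_spaceI)
  show "smooth_on UNIV (partial v \<phi>)"
    using assms by (intro smooth_on_partial schwartz_smooth)
  fix vs :: "(real^2) list" and N assume "set vs \<subseteq> Basis"
  then show "\<exists>C. \<forall>x. jbracket x ^ N * norm (foldr partial vs (partial v \<phi>) x) \<le> C"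
    using schwartz_bound_foldr[OF assms(1), of "vs @ [v]" N] assms(2) by auto
qed

lemma schwartz_lincomb:
  assumes "\<phi> \<in> schwartz_space" "\<psi> \<in> schwartz_space"
  shows "(\<lambda>x. c * \<phi> x + d * \<psi> x) \<in> schwartz_space"
proof (rule schwartz_coinduct[where P = "\<lambda>g. \<exists>\<phi>\<in>schwartz_space. \<exists>\<psi>\<in>schwartz_space. g = (\<lambda>x. c * \<phi> x + d * \<psi> x)"])
  fix g assume "\<exists>\<phi>\<in>schwartz_space. \<exists>\<psi>\<in>schwartz_space. g = (\<lambda>x. c * \<phi> x + d * \<psi> x)"
  then obtain \<phi> \<psi> where *: "\<phi> \<in> schwartz_space" "\<psi> \<in> schwartz_space" "g = (\<lambda>x. c * \<phi> x + d * \<psi> x)"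
    by auto
  show "continuous_on UNIV g"
    unfolding * by (intro continuous_intros schwartz_continuous *)
  show "\<exists>g'. (\<exists>\<phi>\<in>schwartz_space. \<exists>\<psi>\<in>schwartz_space. g' = (\<lambda>x. c * \<phi> x + d * \<psi> x)) \<and>
      (\<forall>x. line_deriv g x v (g' x))"
    if "v \<in> Basis" for v
    unfolding *(3) using * that
    by (intro exI[of _ "\<lambda>x. c * partial v \<phi> x + d * partial v \<psi> x"] conjI bexI[of _ "partial v \<phi>"]
        bexI[of _ "partial v \<psi>"] allI partial_comb schwartz_has_vector_derivative schwartz_partial refl)
  fix N
  obtain A B where AB: "\<And>x. jbracket x ^ N * norm (\<phi> x) \<le> A" "\<And>x. jbracket x ^ N * norm (\<psi> x) \<le> B"
    using schwartz_bound * by metis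
  have "jbracket x ^ N * norm (g x) \<le> norm c * A + norm d * B" for x
  proof -
    have "jbracket x ^ N * norm (g x) \<le> jbracket x ^ N * (norm (c * \<phi> x) + norm (d * \<psi> x))"
      unfolding * by (intro mult_left_mono norm_triangle_ineq) (simp add: jbracket_pos less_imp_le)
    also have "\<dots> = norm c * (jbracket x ^ N * norm (\<phi> x)) + norm d * (jbracket x ^ N * norm (\<psi> x))"
      by (simp add: norm_mult algebra_simps)
    also have "\<dots> \<le> norm c * A + norm d * B"
      by (intro add_mono mult_left_mono AB) auto
    finally show ?thesis .
  qed
  then show "\<exists>C. \<forall>x. jbracket x ^ N * norm (g x) \<le> C" by blast
qed (use assms in auto)

lemma zero_schwartz: "(\<lambda>x. 0) \<in> schwartz_space"
  by (rule schwartz_coinduct[where P = "\<lambda>g. g = (\<lambda>x. 0)"]) auto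

lemma schwartz_cmult: "\<phi> \<in> schwartz_space \<Longrightarrow> (\<lambda>x. c * \<phi> x) \<in> schwartz_space"
  using schwartz_lincomb[of \<phi> \<phi> c 0] by simp

lemma schwartz_add: "\<phi> \<in> schwartz_space \<Longrightarrow> \<psi> \<in> schwartz_space \<Longrightarrow> (\<lambda>x. \<phi> x + \<psi> x) \<in> schwartz_space"
  using schwartz_lincomb[of \<phi> \<psi> 1 1] by simp

lemma schwartz_diff: "\<phi> \<in> schwartz_space \<Longrightarrow> \<psi> \<in> schwartz_space \<Longrightarrow> (\<lambda>x. \<phi> x - \<psi> x) \<in> schwartz_space"
  using schwartz_lincomb[of \<phi> \<psi> 1 "-1"] by simp

lemma has_vector_derivative_coord:
  fixes \<phi> :: "real^2 \<Rightarrow> complex"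
  assumes "line_deriv \<phi> x v \<phi>'"
  shows "((\<lambda>t. of_real ((x + t *\<^sub>R v) $ i) * \<phi> (x + t *\<^sub>R v)) has_vector_derivative
    of_real (v $ i) * \<phi> x + of_real (x $ i) * \<phi>') (at 0)"
proof -
  have "((\<lambda>t. (x + t *\<^sub>R v) $ i) has_vector_derivative v $ i) (at 0)"
    unfolding has_real_derivative_iff_has_vector_derivative[symmetric]
    by (auto intro!: derivative_eq_intros)
  then have "((\<lambda>t. of_real ((x + t *\<^sub>R v) $ i) :: complex) has_vector_derivative of_real (v $ i)) (at 0)"
    by (rule bounded_linear.has_vector_derivative[OF bounded_linear_of_real])
  from has_vector_derivative_mult[OF this assms] show ?thesis
    by (simp add: add.commute)
qed

lemma schwartz_coord:
  assumes "\<phi> \<in> schwartz_space"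
  shows "(\<lambda>x. of_real (x $ i) * \<phi> x) \<in> schwartz_space"
\<comment> \<open>The class has to contain the summand \<open>\<psi>\<close>: differentiating the
  coordinate leaves the undifferentiated function behind.\<close>
proof (rule schwartz_coinduct[where P = "\<lambda>g. \<exists>\<phi>\<in>schwartz_space. \<exists>\<psi>\<in>schwartz_space. g = (\<lambda>x. \<psi> x + of_real (x $ i) * \<phi> x)"])
  fix g :: "real^2 \<Rightarrow> complex"
  assume "\<exists>\<phi>\<in>schwartz_space. \<exists>\<psi>\<in>schwartz_space. g = (\<lambda>x. \<psi> x + of_real (x $ i) * \<phi> x)"
  then obtain \<phi> \<psi> where *: "\<phi> \<in> schwartz_space" "\<psi> \<in> schwartz_space" "g = (\<lambda>x. \<psi> x + of_real (x $ i) * \<phi> x)"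
    by auto
  show "continuous_on UNIV g"
    unfolding * by (intro continuous_intros schwartz_continuous *)
  show "\<exists>g'. (\<exists>\<phi>\<in>schwartz_space. \<exists>\<psi>\<in>schwartz_space. g' = (\<lambda>x. \<psi> x + of_real (x $ i) * \<phi> x)) \<and>
      (\<forall>x. line_deriv g x v (g' x))"
    if v: "v \<in> Basis" for v
  proof (intro exI conjI allI)
    show "\<exists>\<phi>'\<in>schwartz_space. \<exists>\<psi>'\<in>schwartz_space. (\<lambda>x. partial v \<psi> x + (of_real (v $ i) * \<phi> x + of_real (x $ i) * partial v \<phi> x)) =
        (\<lambda>x. \<psi>' x + of_real (x $ i) * \<phi>' x)"
      using * v by (intro bexI[of _ "partial v \<phi>"] bexI[of _ "\<lambda>x. partial v \<psi> x + of_real (v $ i) * \<phi> x"])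
        (auto intro: schwartz_add schwartz_cmult schwartz_partial)
    show "line_deriv g x v (partial v \<psi> x + (of_real (v $ i) * \<phi> x + of_real (x $ i) * partial v \<phi> x))" for x
      unfolding *(3)
      by (intro has_vector_derivative_add has_vector_derivative_coord schwartz_has_vector_derivative * v)
  qed
  fix N
  obtain A B where AB: "\<And>x. jbracket x ^ Suc N * norm (\<phi> x) \<le> A" "\<And>x. jbracket x ^ N * norm (\<psi> x) \<le> B"
    using schwartz_bound * by metis
  have "jbracket x ^ N * norm (g x) \<le> B + A" for x
  proof -
    have j: "0 \<le> jbracket x" by (simp add: jbracket_pos less_imp_le)
    have "jbracket x ^ N * norm (g x) \<le> jbracket x ^ N * (norm (\<psi> x) + norm (of_real (x $ i) * \<phi> x))"
      unfolding * by (intro mult_left_mono norm_triangle_ineq) (simp add: j)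
    also have "\<dots> \<le> jbracket x ^ N * (norm (\<psi> x) + jbracket x * norm (\<phi> x))"
      unfolding norm_mult norm_of_real
      by (intro mult_left_mono add_mono order_refl mult_right_mono component_le_jbracket) (simp_all add: j)
    also have "\<dots> = jbracket x ^ N * norm (\<psi> x) + jbracket x ^ Suc N * norm (\<phi> x)"
      by (simp add: algebra_simps)
    also have "\<dots> \<le> B + A" by (intro add_mono AB)
    finally show ?thesis .
  qed
  then show "\<exists>C. \<forall>x. jbracket x ^ N * norm (g x) \<le> C" by blast
next
  show "\<exists>\<phi>'\<in>schwartz_space. \<exists>\<psi>\<in>schwartz_space. (\<lambda>x. of_real (x $ i) * \<phi> x) = (\<lambda>x. \<psi> x + of_real (x $ i) * \<phi>' x)"
    using assms zero_schwartz by (intro bexI[of _ \<phi>] bexI[of _ "\<lambda>x. 0"]) auto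
qed

lemma schwartz_cnj:
  assumes "\<phi> \<in> schwartz_space"
  shows "(\<lambda>x. cnj (\<phi> x)) \<in> schwartz_space"
proof (rule schwartz_coinduct[where P = "\<lambda>g. \<exists>\<phi>\<in>schwartz_space. g = (\<lambda>x. cnj (\<phi> x))"])
  fix g assume "\<exists>\<phi>\<in>schwartz_space. g = (\<lambda>x. cnj (\<phi> x))"
  then obtain \<phi> where *: "\<phi> \<in> schwartz_space" "g = (\<lambda>x. cnj (\<phi> x))" by auto
  show "continuous_on UNIV g"
    unfolding * by (intro continuous_intros schwartz_continuous *)
  show "\<exists>g'. (\<exists>\<phi>\<in>schwartz_space. g' = (\<lambda>x. cnj (\<phi> x))) \<and>
      (\<forall>x. line_deriv g x v (g' x))"
    if v: "v \<in> Basis" for v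
    unfolding *(2)
    by (intro exI[of _ "\<lambda>x. cnj (partial v \<phi> x)"] conjI bexI[of _ "partial v \<phi>"] allI refl
        has_vector_derivative_cnj schwartz_has_vector_derivative schwartz_partial * v)
  show "\<exists>C. \<forall>x. jbracket x ^ N * norm (g x) \<le> C" for N
    using schwartz_bound[OF *(1), of N] by (auto simp: *(2))
qed (use assms in auto)

text \<open>Smoothness provides derivatives along coordinate lines only, whereas the chain rule with
  \<open>shear_arg\<close> needs the total derivative. It follows from existence of one partial
  derivative and continuity of the other.\<close>

lemma schwartz_has_derivative:
  assumes \<phi>: "\<phi> \<in> schwartz_space"
  shows "(\<phi> has_derivative (\<lambda>h. (h $ 1) *\<^sub>R partial e1 \<phi> x + (h $ 2) *\<^sub>R partial e2 \<phi> x)) (at x)"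
proof -
  have B: "e1 \<in> Basis" "e2 \<in> Basis" by (auto simp: Basis_plane)
  have dec: "y = (y $ 1) *\<^sub>R e1 + (y $ 2) *\<^sub>R e2" for y :: "real^2"
    by (auto simp: vec_eq_iff axis_def forall_2)
  have "((\<lambda>(u, v). \<phi> (u *\<^sub>R e1 + v *\<^sub>R e2)) has_derivative
      (\<lambda>(tu, tv). tu *\<^sub>R partial e1 \<phi> x + blinfun_scaleR_left (partial e2 \<phi> ((x $ 1) *\<^sub>R e1 + (x $ 2) *\<^sub>R e2)) tv))
      (at (x $ 1, x $ 2) within UNIV \<times> UNIV)"
  proof (rule has_derivative_partialsI[where fy = "\<lambda>u v. blinfun_scaleR_left (partial e2 \<phi> (u *\<^sub>R e1 + v *\<^sub>R e2))"])
    have "((\<lambda>u. \<phi> ((x $ 2) *\<^sub>R e2 + u *\<^sub>R e1)) has_vector_derivative partial e1 \<phi> x) (at (x $ 1))"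
      by (rule has_vector_derivative_line, subst dec[of x], subst add.commute,
          rule schwartz_has_vector_derivative[OF \<phi> B(1)])
    then show "((\<lambda>u. \<phi> (u *\<^sub>R e1 + (x $ 2) *\<^sub>R e2)) has_derivative (\<lambda>tu. tu *\<^sub>R partial e1 \<phi> x)) (at (x $ 1) within UNIV)"
      by (simp add: has_vector_derivative_def add.commute)
    show "((\<lambda>v. \<phi> (u *\<^sub>R e1 + v *\<^sub>R e2)) has_derivative
        blinfun_apply (blinfun_scaleR_left (partial e2 \<phi> (u *\<^sub>R e1 + v *\<^sub>R e2)))) (at v within UNIV)" for u v
    proof -
      have "((\<lambda>v. \<phi> (u *\<^sub>R e1 + v *\<^sub>R e2)) has_vector_derivative partial e2 \<phi> (u *\<^sub>R e1 + v *\<^sub>R e2)) (at v)"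
        by (rule has_vector_derivative_line, rule schwartz_has_vector_derivative[OF \<phi> B(2)])
      then show ?thesis
        by (simp add: has_vector_derivative_def blinfun_scaleR_left.rep_eq)
    qed
    have "continuous_on UNIV (\<lambda>p :: real \<times> real. blinfun_scaleR_left (partial e2 \<phi> (fst p *\<^sub>R e1 + snd p *\<^sub>R e2)))"
      by (intro bounded_linear.continuous_on[OF bounded_linear_blinfun_scaleR_left]
          continuous_on_compose2[OF schwartz_continuous[OF schwartz_partial[OF \<phi> B(2)]]] continuous_intros) auto
    then show "continuous (at (x $ 1, x $ 2) within UNIV \<times> UNIV)
        (\<lambda>(u, v). blinfun_scaleR_left (partial e2 \<phi> (u *\<^sub>R e1 + v *\<^sub>R e2)))"
      by (simp add: case_prod_unfold continuous_on_eq_continuous_at)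
  qed auto
  then have d: "((\<lambda>p. \<phi> (fst p *\<^sub>R e1 + snd p *\<^sub>R e2)) has_derivative
      (\<lambda>p. fst p *\<^sub>R partial e1 \<phi> x + snd p *\<^sub>R partial e2 \<phi> x)) (at (x $ 1, x $ 2))"
    by (simp add: case_prod_unfold dec[symmetric] blinfun_scaleR_left.rep_eq)
  have "((\<lambda>y :: real^2. (y $ 1, y $ 2)) has_derivative (\<lambda>h. (h $ 1, h $ 2))) (at x)"
    by (intro has_derivative_Pair bounded_linear_imp_has_derivative bounded_linear_vec_nth)
  from has_derivative_compose[OF this d] show ?thesis
    by (simp add: dec[symmetric])
qed

section \<open>Integration and Lizorkin functions\<close>

text \<open>The common integrable majorant for the plane and for the four-dimensional ambient space
  of the group; factorization of Lebesgue measure reduces it to the line.\<close>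

lemma integrable_prod_inverse_square:
  "integrable lborel (\<lambda>x :: 'a::euclidean_space. \<Prod>b\<in>Basis. inverse (1 + (x \<bullet> b)\<^sup>2))"
proof (rule integrableI_nonneg)
  have fin: "(\<integral>\<^sup>+x. ennreal (inverse (1 + x\<^sup>2)) \<partial>lborel) < \<infinity>"
  proof -
    have "integrable lborel (\<lambda>x :: real. inverse (1 + x\<^sup>2))"
      using integrable_inverse_1_plus_square by (simp add: set_integrable_def)
    then show ?thesis
      by (simp add: integrable_iff_bounded)
  qed
  have "(\<integral>\<^sup>+x. ennreal (\<Prod>b\<in>Basis. inverse (1 + (x \<bullet> b)\<^sup>2)) \<partial>(lborel :: 'a measure)) =
      (\<integral>\<^sup>+x. (\<Prod>b\<in>Basis. ennreal (inverse (1 + (x \<bullet> b)\<^sup>2))) \<partial>(lborel :: 'a measure))"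
    by (simp add: prod_ennreal)
  also have "\<dots> = (\<Prod>b\<in>(Basis :: 'a set). (\<integral>\<^sup>+x. ennreal (inverse (1 + x\<^sup>2)) \<partial>lborel))"
    by (rule nn_integral_lborel_prod) auto
  also have "\<dots> < \<infinity>"
    using fin by (simp add: ennreal_prod_eq_top less_top[symmetric] power_eq_top_ennreal)
  finally show "(\<integral>\<^sup>+x. ennreal (\<Prod>b\<in>Basis. inverse (1 + (x \<bullet> b)\<^sup>2)) \<partial>(lborel :: 'a measure)) < \<infinity>" .
qed (auto intro!: prod_nonneg AE_I2)

text \<open>Both factors 1 + t^2 are at most \<open>jbracket x ^ 2\<close>; this is the origin of
  the exponent 4 in the decay estimates on the plane.\<close>

lemma plane_decay:
  "inverse (jbracket x ^ 4) \<le> (\<Prod>b\<in>Basis. inverse (1 + (x \<bullet> b)\<^sup>2))" for x :: "real^2"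
proof -
  have "(1 + (x $ 1)\<^sup>2) * (1 + (x $ 2)\<^sup>2) \<le> (1 + ((x $ 1)\<^sup>2 + (x $ 2)\<^sup>2)) * (1 + ((x $ 1)\<^sup>2 + (x $ 2)\<^sup>2))"
    by (intro mult_mono) auto
  also have "\<dots> = jbracket x ^ 4"
    by (simp add: jbracket_def norm_plane_sq power4_eq_xxxx)
  finally have le: "(1 + (x $ 1)\<^sup>2) * (1 + (x $ 2)\<^sup>2) \<le> jbracket x ^ 4" .
  have "0 < (1 + (x $ 1)\<^sup>2) * (1 + (x $ 2)\<^sup>2)"
    by (intro mult_pos_pos) (auto simp: add_pos_nonneg)
  then have "inverse (jbracket x ^ 4) \<le> inverse ((1 + (x $ 1)\<^sup>2) * (1 + (x $ 2)\<^sup>2))"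
    using le by (intro le_imp_inverse_le)
  also have "\<dots> = (\<Prod>b\<in>Basis. inverse (1 + (x \<bullet> b)\<^sup>2))"
    by (simp add: Basis_plane e1_neq_e2 inner_axis)
  finally show ?thesis .
qed

lemma integrable_jbracket: "integrable lborel (\<lambda>x :: real^2. inverse (jbracket x ^ 4))"
proof (rule Bochner_Integration.integrable_bound[OF integrable_prod_inverse_square])
  show "AE x :: real^2 in lborel. norm (inverse (jbracket x ^ 4)) \<le> norm (\<Prod>b\<in>Basis. inverse (1 + (x \<bullet> b)\<^sup>2))"
  proof (rule AE_I2)
    fix x :: "real^2"
    have "norm (inverse (jbracket x ^ 4)) = inverse (jbracket x ^ 4)"
      by (simp add: jbracket_pos less_imp_le)
    also have "\<dots> \<le> norm (\<Prod>b\<in>Basis. inverse (1 + (x \<bullet> b)\<^sup>2))"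
      using plane_decay[of x] by simp
    finally show "norm (inverse (jbracket x ^ 4)) \<le> norm (\<Prod>b\<in>Basis. inverse (1 + (x \<bullet> b)\<^sup>2))" .
  qed
qed (simp add: jbracket_def)

lemma le_inverse_jbracketI:
  fixes r :: real
  assumes "jbracket x ^ N * r \<le> C"
  shows "r \<le> C * inverse (jbracket x ^ N)"
  using assms jbracket_pos[of x] by (simp add: field_simps)

lemma schwartz_integrable:
  assumes "\<phi> \<in> schwartz_space"
  shows "integrable lborel \<phi>"
proof -
  obtain C where C: "\<And>x. jbracket x ^ 4 * norm (\<phi> x) \<le> C"
    using schwartz_bound[OF assms] by metis
  show ?thesis
  proof (rule Bochner_Integration.integrable_bound)
    show "integrable lborel (\<lambda>x :: real^2. C * inverse (jbracket x ^ 4))"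
      by (intro integrable_mult_right integrable_jbracket)
    show "AE x in lborel. norm (\<phi> x) \<le> norm (C * inverse (jbracket x ^ 4))"
      using le_inverse_jbracketI[OF C] by (intro AE_I2) (smt (verit) real_norm_def)
    show "\<phi> \<in> borel_measurable lborel"
      using schwartz_continuous[OF assms] by (simp add: borel_measurable_continuous_onI)
  qed
qed

lemma axis_plane [simp]: "e1 $ 1 = 1" "e1 $ 2 = 0" "e2 $ 1 = 0" "e2 $ 2 = 1"
  by (simp_all add: axis_def)

text \<open>\<open>real^2\<close> is not a product type, so Fubini is imported through this
  identity, which is checked on boxes.\<close>

lemma lborel_plane:
  "(lborel :: (real^2) measure) = distr (lborel \<Otimes>\<^sub>M lborel) borel (\<lambda>p. fst p *\<^sub>R e1 + snd p *\<^sub>R e2)"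
proof (rule lborel_eqI)
  fix l u :: "real^2" assume "\<And>b. b \<in> Basis \<Longrightarrow> l \<bullet> b \<le> u \<bullet> b"
  from this[of e1] this[of e2] have le: "l $ 1 \<le> u $ 1" "l $ 2 \<le> u $ 2"
    by (auto simp: Basis_plane inner_axis)
  have "(\<lambda>p. fst p *\<^sub>R e1 + snd p *\<^sub>R e2) -` box l u = {l $ 1 <..< u $ 1} \<times> {l $ 2 <..< u $ 2}"
    by (auto simp: box_def Basis_plane inner_axis)
  then show "emeasure (distr (lborel \<Otimes>\<^sub>M lborel) borel (\<lambda>p. fst p *\<^sub>R e1 + snd p *\<^sub>R e2)) (box l u) =
      (\<Prod>b\<in>Basis. (u - l) \<bullet> b)"
    using le
    by (simp add: emeasure_distr borel_prod space_pair_measure lborel.emeasure_pair_measure_Times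
        Basis_plane e1_neq_e2 inner_axis ennreal_mult)
qed simp

text \<open>Both orders are provided because integrating a partial derivative to zero wants the
  differentiated variable innermost.\<close>

lemma
  fixes g :: "real^2 \<Rightarrow> complex"
  assumes g: "integrable lborel g"
  shows integral_plane: "integral\<^sup>L lborel g = (LINT v|lborel. LINT u|lborel. g (u *\<^sub>R e1 + v *\<^sub>R e2))"
    and integral_plane': "integral\<^sup>L lborel g = (LINT u|lborel. LINT v|lborel. g (u *\<^sub>R e1 + v *\<^sub>R e2))"
proof -
  have m: "g \<in> borel_measurable borel" using g by simp
  have m2: "(\<lambda>p. fst p *\<^sub>R e1 + snd p *\<^sub>R e2) \<in> lborel \<Otimes>\<^sub>M lborel \<rightarrow>\<^sub>M borel" by measurable
  have int: "integrable (lborel \<Otimes>\<^sub>M lborel) (\<lambda>(u, v). g (u *\<^sub>R e1 + v *\<^sub>R e2))"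
    using g m m2 by (subst (asm) lborel_plane) (simp add: integrable_distr_eq case_prod_unfold)
  have eq: "integral\<^sup>L lborel g = integral\<^sup>L (lborel \<Otimes>\<^sub>M lborel) (\<lambda>(u, v). g (u *\<^sub>R e1 + v *\<^sub>R e2))"
    using m m2 by (subst lborel_plane) (simp add: integral_distr case_prod_unfold)
  show "integral\<^sup>L lborel g = (LINT v|lborel. LINT u|lborel. g (u *\<^sub>R e1 + v *\<^sub>R e2))"
    using lborel_pair.integral_snd[OF int] eq by simp
  show "integral\<^sup>L lborel g = (LINT u|lborel. LINT v|lborel. g (u *\<^sub>R e1 + v *\<^sub>R e2))"
    using lborel_pair.integral_fst[OF int] eq by simp
qed

text \<open>The fundamental theorem on the whole line: decay of \<open>h\<close> removes both
  boundary terms, decay of \<open>h'\<close> gives integrability.\<close>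

lemma integral_derivative_eq_0:
  fixes h h' :: "real \<Rightarrow> complex"
  assumes d: "\<And>u. (h has_vector_derivative h' u) (at u)" and c: "continuous_on UNIV h'"
    and h: "\<And>u. norm (h u) \<le> C * inverse (1 + u\<^sup>2)" and h': "\<And>u. norm (h' u) \<le> D * inverse (1 + u\<^sup>2)"
  shows "integral\<^sup>L lborel h' = 0"
proof -
  have "integrable lborel (\<lambda>x :: real. inverse (1 + x\<^sup>2))"
    using integrable_inverse_1_plus_square by (simp add: set_integrable_def)
  then have "integrable lborel (\<lambda>x :: real. D * inverse (1 + x\<^sup>2))" by simp
  then have int: "integrable lborel h'"
  proof (rule Bochner_Integration.integrable_bound)
    show "h' \<in> borel_measurable lborel"
      using c by (simp add: borel_measurable_continuous_onI)
    show "AE x in lborel. norm (h' x) \<le> norm (D * inverse (1 + x\<^sup>2))"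
      using h' by (intro AE_I2) (metis abs_ge_self order_trans real_norm_def)
  qed
  have "(h \<longlongrightarrow> 0) at_top"
  proof (rule Lim_null_comparison)
    show "((\<lambda>u::real. C * inverse (1 + u\<^sup>2)) \<longlongrightarrow> 0) at_top"
      by real_asymp
  qed (simp add: h)
  moreover have "(h \<longlongrightarrow> 0) at_bot"
  proof (rule Lim_null_comparison)
    show "((\<lambda>u::real. C * inverse (1 + u\<^sup>2)) \<longlongrightarrow> 0) at_bot"
      by real_asymp
  qed (simp add: h)
  ultimately have "(LBINT x=-\<infinity>..\<infinity>. h' x) = 0 - 0"
    using int d c
    by (intro interval_integral_FTC_integrable[where F = h])
      (auto simp: ereal_tendsto_simps set_integrable_def continuous_on_eq_continuous_at)
  then show ?thesis
    by (simp add: interval_lebesgue_integral_def set_lebesgue_integral_def)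
qed

text \<open>A bound in a single coordinate restricts to all lines parallel to that axis, with a
  constant independent of the line.\<close>

lemma schwartz_plane_decay:
  assumes "\<phi> \<in> schwartz_space"
  shows "\<exists>C. \<forall>x. norm (\<phi> x) \<le> C * inverse (1 + (x $ i)\<^sup>2)"
proof -
  obtain C where C: "C > 0" "\<And>x. jbracket x ^ 2 * norm (\<phi> x) \<le> C"
    using schwartz_bound[OF assms] by metis
  have "norm (\<phi> x) \<le> C * inverse (1 + (x $ i)\<^sup>2)" for x
  proof -
    have "(1 + (x $ i)\<^sup>2) * norm (\<phi> x) \<le> jbracket x ^ 2 * norm (\<phi> x)"
      using exhaust_2[of i] by (intro mult_right_mono) (auto simp: jbracket_def norm_plane_sq)
    also have "\<dots> \<le> C" by (rule C)
    finally show ?thesis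
      by (simp add: field_simps add_pos_nonneg)
  qed
  then show ?thesis by blast
qed

lemma schwartz_integral_partial:
  assumes \<phi>: "\<phi> \<in> schwartz_space" and v: "v \<in> Basis"
  shows "(LINT x|lborel. partial v \<phi> x) = 0"
proof -
  note P = schwartz_partial[OF \<phi> v]
  obtain C where C: "\<And>i x. norm (\<phi> x) \<le> C i * inverse (1 + (x $ i)\<^sup>2)"
    using schwartz_plane_decay[OF \<phi>] by metis
  obtain D where D: "\<And>i x. norm (partial v \<phi> x) \<le> D i * inverse (1 + (x $ i)\<^sup>2)"
    using schwartz_plane_decay[OF P] by metis
  note cont = continuous_on_compose2[OF schwartz_continuous[OF P]]
  consider "v = e1" | "v = e2" using v by (auto simp: Basis_plane)
  then show ?thesis
  proof cases
    case 1
    have "(LINT u|lborel. partial v \<phi> (u *\<^sub>R e1 + w *\<^sub>R e2)) = 0" for w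
    proof (rule integral_derivative_eq_0)
      show "((\<lambda>u. \<phi> (u *\<^sub>R e1 + w *\<^sub>R e2)) has_vector_derivative partial v \<phi> (u *\<^sub>R e1 + w *\<^sub>R e2)) (at u)" for u
        using has_vector_derivative_line[of \<phi> "w *\<^sub>R e2" u e1, OF schwartz_has_vector_derivative[OF \<phi>]]
        by (simp add: 1 Basis_plane add.commute)
      show "norm (\<phi> (u *\<^sub>R e1 + w *\<^sub>R e2)) \<le> C 1 * inverse (1 + u\<^sup>2)" for u
        using C[of "u *\<^sub>R e1 + w *\<^sub>R e2" 1] by (simp add: axis_def)
      show "norm (partial v \<phi> (u *\<^sub>R e1 + w *\<^sub>R e2)) \<le> D 1 * inverse (1 + u\<^sup>2)" for u
        using D[of "u *\<^sub>R e1 + w *\<^sub>R e2" 1] by (simp add: axis_def)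
      show "continuous_on UNIV (\<lambda>u. partial v \<phi> (u *\<^sub>R e1 + w *\<^sub>R e2))"
        by (intro cont continuous_intros) auto
    qed
    then show ?thesis
      by (simp add: integral_plane[OF schwartz_integrable[OF P]])
  next
    case 2
    have "(LINT u|lborel. partial v \<phi> (w *\<^sub>R e1 + u *\<^sub>R e2)) = 0" for w
    proof (rule integral_derivative_eq_0)
      show "((\<lambda>u. \<phi> (w *\<^sub>R e1 + u *\<^sub>R e2)) has_vector_derivative partial v \<phi> (w *\<^sub>R e1 + u *\<^sub>R e2)) (at u)" for u
        using has_vector_derivative_line[of \<phi> "w *\<^sub>R e1" u e2, OF schwartz_has_vector_derivative[OF \<phi>]]
        by (simp add: 2 Basis_plane)
      show "norm (\<phi> (w *\<^sub>R e1 + u *\<^sub>R e2)) \<le> C 2 * inverse (1 + u\<^sup>2)" for u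
        using C[of "w *\<^sub>R e1 + u *\<^sub>R e2" 2] by (simp add: axis_def)
      show "norm (partial v \<phi> (w *\<^sub>R e1 + u *\<^sub>R e2)) \<le> D 2 * inverse (1 + u\<^sup>2)" for u
        using D[of "w *\<^sub>R e1 + u *\<^sub>R e2" 2] by (simp add: axis_def)
      show "continuous_on UNIV (\<lambda>u. partial v \<phi> (w *\<^sub>R e1 + u *\<^sub>R e2))"
        by (intro cont continuous_intros) auto
    qed
    then show ?thesis
      by (simp add: integral_plane'[OF schwartz_integrable[OF P]])
  qed
qed

lemma schwartz_monomial:
  assumes "\<phi> \<in> schwartz_space"
  shows "(\<lambda>x. of_real (x $ 1 ^ m1 * x $ 2 ^ m2) * \<phi> x) \<in> schwartz_space"
proof (induction m1)
  case 0
  show ?case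
  proof (induction m2)
    case 0
    then show ?case using assms by simp
  next
    case (Suc m2)
    from schwartz_coord[OF this, of 2] show ?case by (simp add: mult_ac)
  qed
next
  case (Suc m1)
  from schwartz_coord[OF this, of 1] show ?case by (simp add: mult_ac)
qed

section \<open>The Lizorkin space and its closure properties\<close>

lemma lizorkin_schwartz: "\<phi> \<in> lizorkin_space \<Longrightarrow> \<phi> \<in> schwartz_space"
  by (simp add: lizorkin_space_def)

lemma lizorkin_moment:
  "\<phi> \<in> lizorkin_space \<Longrightarrow> (LINT x|lborel. of_real (x $ 1 ^ m1 * x $ 2 ^ m2) * \<phi> x) = 0"
  by (simp add: lizorkin_space_def)

lemma lizorkin_spaceI:
  assumes "\<phi> \<in> schwartz_space"
    and "\<And>m1 m2. (LINT x|lborel. of_real (x $ 1 ^ m1 * x $ 2 ^ m2) * \<phi> x) = 0"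
  shows "\<phi> \<in> lizorkin_space"
  using assms by (simp add: lizorkin_space_def)

lemma lizorkin_lincomb:
  assumes "\<phi> \<in> lizorkin_space" "\<psi> \<in> lizorkin_space"
  shows "(\<lambda>x. c * \<phi> x + d * \<psi> x) \<in> lizorkin_space"
proof (rule lizorkin_spaceI)
  show "(\<lambda>x. c * \<phi> x + d * \<psi> x) \<in> schwartz_space"
    using assms by (intro schwartz_lincomb lizorkin_schwartz)
  fix m1 m2
  have i: "integrable lborel (\<lambda>x. of_real (x $ 1 ^ m1 * x $ 2 ^ m2) * \<omega> x)" if "\<omega> \<in> lizorkin_space" for \<omega>
    using that by (intro schwartz_integrable schwartz_monomial lizorkin_schwartz)
  have "(LINT x|lborel. of_real (x $ 1 ^ m1 * x $ 2 ^ m2) * (c * \<phi> x + d * \<psi> x)) =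
      (LINT x|lborel. c * (of_real (x $ 1 ^ m1 * x $ 2 ^ m2) * \<phi> x) + d * (of_real (x $ 1 ^ m1 * x $ 2 ^ m2) * \<psi> x))"
    by (simp add: algebra_simps)
  also have "\<dots> = c * (LINT x|lborel. of_real (x $ 1 ^ m1 * x $ 2 ^ m2) * \<phi> x) +
      d * (LINT x|lborel. of_real (x $ 1 ^ m1 * x $ 2 ^ m2) * \<psi> x)"
    using i[OF assms(1)] i[OF assms(2)] by (subst Bochner_Integration.integral_add) auto
  finally show "(LINT x|lborel. of_real (x $ 1 ^ m1 * x $ 2 ^ m2) * (c * \<phi> x + d * \<psi> x)) = 0"
    using assms[THEN lizorkin_moment] by simp
qed

lemma lizorkin_cmult: "\<phi> \<in> lizorkin_space \<Longrightarrow> (\<lambda>x. c * \<phi> x) \<in> lizorkin_space"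
  using lizorkin_lincomb[of \<phi> \<phi> c 0] by simp

lemma lizorkin_add: "\<phi> \<in> lizorkin_space \<Longrightarrow> \<psi> \<in> lizorkin_space \<Longrightarrow> (\<lambda>x. \<phi> x + \<psi> x) \<in> lizorkin_space"
  using lizorkin_lincomb[of \<phi> \<psi> 1 1] by simp

lemma lizorkin_diff: "\<phi> \<in> lizorkin_space \<Longrightarrow> \<psi> \<in> lizorkin_space \<Longrightarrow> (\<lambda>x. \<phi> x - \<psi> x) \<in> lizorkin_space"
  using lizorkin_lincomb[of \<phi> \<psi> 1 "-1"] by simp

lemma lizorkin_coord:
  assumes "\<phi> \<in> lizorkin_space"
  shows "(\<lambda>x. of_real (x $ i) * \<phi> x) \<in> lizorkin_space"
proof (rule lizorkin_spaceI)
  show "(\<lambda>x. of_real (x $ i) * \<phi> x) \<in> schwartz_space"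
    using assms by (intro schwartz_coord lizorkin_schwartz)
  fix m1 m2
  show "(LINT x|lborel. of_real (x $ 1 ^ m1 * x $ 2 ^ m2) * (of_real (x $ i) * \<phi> x)) = 0"
    using exhaust_2[of i] lizorkin_moment[OF assms, of "Suc m1" m2] lizorkin_moment[OF assms, of m1 "Suc m2"]
    by (auto simp: mult_ac)
qed

text \<open>An affine substitution turns monomials into products of powers of affine functions, and
  these have to be absorbed into the Lizorkin function.\<close>

lemma lizorkin_affine_pow:
  assumes "\<phi> \<in> lizorkin_space"
  shows "(\<lambda>x. of_real ((p + q * x $ 1 + r * x $ 2) ^ m) * \<phi> x) \<in> lizorkin_space"
proof (induction m)
  case 0
  then show ?case using assms by simp
next
  case (Suc m)
  let ?\<omega> = "\<lambda>x :: real^2. of_real ((p + q * x $ 1 + r * x $ 2) ^ m) * \<phi> x"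
  have "(\<lambda>x. 1 * (of_real p * ?\<omega> x + of_real q * (of_real (x $ 1) * ?\<omega> x)) + of_real r * (of_real (x $ 2) * ?\<omega> x)) \<in> lizorkin_space"
    by (intro lizorkin_lincomb lizorkin_coord Suc)
  then show ?case
    by (simp add: algebra_simps)
qed

lemma lizorkin_integral: "\<phi> \<in> lizorkin_space \<Longrightarrow> integral\<^sup>L lborel \<phi> = 0"
  using lizorkin_moment[of \<phi> 0 0] by simp

text \<open>The partial derivative of a monomial times \<open>\<phi>\<close> has integral zero. By
  the Leibniz rule this integral consists of moments of \<open>\<phi>\<close>, which vanish, and of
  the wanted moment of the derivative.\<close>

lemma lizorkin_partial:
  assumes \<phi>: "\<phi> \<in> lizorkin_space" and v: "v \<in> Basis"
  shows "partial v \<phi> \<in> lizorkin_space"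
proof (rule lizorkin_spaceI)
  note S = lizorkin_schwartz[OF \<phi>]
  show "partial v \<phi> \<in> schwartz_space"
    using S v by (rule schwartz_partial)
  let ?M = "\<lambda>m1 m2 (x :: real^2). of_real (x $ 1 ^ m1 * x $ 2 ^ m2) :: complex"
  fix m1 m2
  \<comment> \<open>Truncated subtraction is harmless: for exponent 0 the \<open>of_nat\<close>
    factor in front is 0.\<close>
  let ?\<psi> = "\<lambda>x :: real^2. of_nat m1 * of_real (v $ 1) * (?M (m1 - 1) m2 x * \<phi> x) + of_nat m2 * of_real (v $ 2) * (?M m1 (m2 - 1) x * \<phi> x)"
  have S\<psi>: "integrable lborel ?\<psi>"
    by (intro schwartz_integrable schwartz_lincomb schwartz_monomial S)
  have "((\<lambda>t. ?M m1 m2 (x + t *\<^sub>R v) * \<phi> (x + t *\<^sub>R v)) has_vector_derivative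
      ?\<psi> x + ?M m1 m2 x * partial v \<phi> x) (at 0)" for x
  proof -
    have "((\<lambda>t. (x + t *\<^sub>R v) $ 1 ^ m1 * (x + t *\<^sub>R v) $ 2 ^ m2) has_real_derivative
        (real m1 * v $ 1 * (x $ 1 ^ (m1 - 1) * x $ 2 ^ m2) + real m2 * v $ 2 * (x $ 1 ^ m1 * x $ 2 ^ (m2 - 1)))) (at 0)"
      by (auto intro!: derivative_eq_intros)
    then have "((\<lambda>t. ?M m1 m2 (x + t *\<^sub>R v)) has_vector_derivative
        of_real (real m1 * v $ 1 * (x $ 1 ^ (m1 - 1) * x $ 2 ^ m2) + real m2 * v $ 2 * (x $ 1 ^ m1 * x $ 2 ^ (m2 - 1)))) (at 0)"
      unfolding has_real_derivative_iff_has_vector_derivative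
      by (rule bounded_linear.has_vector_derivative[OF bounded_linear_of_real])
    from has_vector_derivative_mult[OF this schwartz_has_vector_derivative[OF S v]]
    show ?thesis by (simp add: algebra_simps)
  qed
  then have "partial v (\<lambda>x. ?M m1 m2 x * \<phi> x) = (\<lambda>x. ?\<psi> x + ?M m1 m2 x * partial v \<phi> x)"
    by (simp add: partial_def vector_derivative_at fun_eq_iff)
  then have "(LINT x|lborel. ?\<psi> x + ?M m1 m2 x * partial v \<phi> x) = 0"
    using schwartz_integral_partial[OF schwartz_monomial[OF S, of m1 m2] v] by simp
  moreover have "integrable lborel (\<lambda>x. ?M m1 m2 x * partial v \<phi> x)"
    using S v by (intro schwartz_integrable schwartz_monomial schwartz_partial)
  ultimately have "integral\<^sup>L lborel ?\<psi> + (LINT x|lborel. ?M m1 m2 x * partial v \<phi> x) = 0"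
    using S\<psi> by (subst (asm) Bochner_Integration.integral_add) auto
  moreover have "integral\<^sup>L lborel ?\<psi> = 0"
    using schwartz_integrable[OF schwartz_monomial[OF S]] lizorkin_moment[OF \<phi>]
    by (subst Bochner_Integration.integral_add) auto
  ultimately show "(LINT x|lborel. ?M m1 m2 x * partial v \<phi> x) = 0" by simp
qed

lemma lizorkin_cnj:
  assumes "\<phi> \<in> lizorkin_space"
  shows "(\<lambda>x. cnj (\<phi> x)) \<in> lizorkin_space"
proof (rule lizorkin_spaceI)
  show "(\<lambda>x. cnj (\<phi> x)) \<in> schwartz_space"
    using assms by (intro schwartz_cnj lizorkin_schwartz)
  fix m1 m2
  have "(LINT x|lborel. of_real (x $ 1 ^ m1 * x $ 2 ^ m2) * cnj (\<phi> x)) =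
      (LINT x|lborel. cnj (of_real (x $ 1 ^ m1 * x $ 2 ^ m2) * \<phi> x))"
    by simp
  also have "\<dots> = cnj (LINT x|lborel. of_real (x $ 1 ^ m1 * x $ 2 ^ m2) * \<phi> x)"
    by (intro integral_bounded_linear[OF bounded_linear_cnj] schwartz_integrable schwartz_monomial lizorkin_schwartz assms)
  finally show "(LINT x|lborel. of_real (x $ 1 ^ m1 * x $ 2 ^ m2) * cnj (\<phi> x)) = 0"
    using lizorkin_moment[OF assms] by simp
qed

text \<open>The affine map is triangular, so the substitution is done one variable at a time, in the
  inner and then in the outer integral. In the new variables the integrand is, up to a constant,
  again a Lizorkin function, whose integral vanishes.\<close>

lemma lizorkin_affine_moment:
  assumes \<phi>: "\<phi> \<in> lizorkin_space" and ac: "a \<noteq> 0" "c \<noteq> 0"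
    and int: "integrable lborel (\<lambda>x :: real^2. of_real (x $ 1 ^ m1 * x $ 2 ^ m2) *
      \<phi> (((x $ 1 - b1 + s * (x $ 2 - b2)) / a) *\<^sub>R e1 + (c * (x $ 2 - b2)) *\<^sub>R e2))"
  shows "(LINT x :: real^2|lborel. of_real (x $ 1 ^ m1 * x $ 2 ^ m2) *
      \<phi> (((x $ 1 - b1 + s * (x $ 2 - b2)) / a) *\<^sub>R e1 + (c * (x $ 2 - b2)) *\<^sub>R e2)) = 0" (is "integral\<^sup>L _ ?g = 0")
proof -
  \<comment> \<open>Solving for the old coordinates gives x2 = b2 + v/c and x1 = b1 + a u - (s/c) v;
    these are the two affine factors.\<close>
  define \<omega> where "\<omega> x = of_real ((b1 + a * x $ 1 + (- s / c) * x $ 2) ^ m1) *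
    (of_real ((b2 + 0 * x $ 1 + (1 / c) * x $ 2) ^ m2) * \<phi> x)" for x
  have \<omega>: "\<omega> \<in> lizorkin_space"
    unfolding \<omega>_def by (intro lizorkin_affine_pow \<phi>)
  have inner: "(LINT u|lborel. ?g (u *\<^sub>R e1 + v *\<^sub>R e2)) =
      \<bar>a\<bar> *\<^sub>R (LINT u|lborel. ?g ((b1 - s * (v - b2) + a * u) *\<^sub>R e1 + v *\<^sub>R e2))" for v
    by (rule lborel_integral_real_affine[OF ac(1)])
  have "integral\<^sup>L lborel ?g = (LINT v|lborel. LINT u|lborel. ?g (u *\<^sub>R e1 + v *\<^sub>R e2))"
    by (rule integral_plane[OF int])
  also have "\<dots> = (LINT v|lborel. \<bar>a\<bar> *\<^sub>R (LINT u|lborel. ?g ((b1 - s * (v - b2) + a * u) *\<^sub>R e1 + v *\<^sub>R e2)))"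
    by (simp only: inner)
  also have "\<dots> = \<bar>1 / c\<bar> *\<^sub>R (LINT v|lborel. \<bar>a\<bar> *\<^sub>R (LINT u|lborel.
      ?g ((b1 - s * ((b2 + (1 / c) * v) - b2) + a * u) *\<^sub>R e1 + (b2 + (1 / c) * v) *\<^sub>R e2)))"
    using ac(2) by (intro lborel_integral_real_affine) auto
  also have "(\<lambda>u v. ?g ((b1 - s * ((b2 + (1 / c) * v) - b2) + a * u) *\<^sub>R e1 + (b2 + (1 / c) * v) *\<^sub>R e2)) =
      (\<lambda>u v. \<omega> (u *\<^sub>R e1 + v *\<^sub>R e2))"
    using ac by (auto simp: fun_eq_iff \<omega>_def axis_def field_simps)
  then have "(LINT v|lborel. \<bar>a\<bar> *\<^sub>R (LINT u|lborel.
      ?g ((b1 - s * ((b2 + (1 / c) * v) - b2) + a * u) *\<^sub>R e1 + (b2 + (1 / c) * v) *\<^sub>R e2))) =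
      (LINT v|lborel. \<bar>a\<bar> *\<^sub>R (LINT u|lborel. \<omega> (u *\<^sub>R e1 + v *\<^sub>R e2)))"
    unfolding fun_eq_iff by (intro Bochner_Integration.integral_cong refl arg_cong[of _ _ "\<lambda>z. \<bar>a\<bar> *\<^sub>R z"]) auto
  also have "\<dots> = \<bar>a\<bar> *\<^sub>R (LINT v|lborel. LINT u|lborel. \<omega> (u *\<^sub>R e1 + v *\<^sub>R e2))"
    by simp
  also have "(LINT v|lborel. LINT u|lborel. \<omega> (u *\<^sub>R e1 + v *\<^sub>R e2)) = integral\<^sup>L lborel \<omega>"
    using \<omega> by (intro integral_plane[symmetric] schwartz_integrable lizorkin_schwartz)
  finally show ?thesis
    by (simp add: lizorkin_integral[OF \<omega>])
qed

section \<open>Kernels generated by shearlets\<close>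

abbreviation pr_s :: "shear_point \<times> (real^2) \<Rightarrow> real" where "pr_s p \<equiv> fst (snd (fst p))"
abbreviation pr_a :: "shear_point \<times> (real^2) \<Rightarrow> real" where "pr_a p \<equiv> snd (snd (fst p))"

abbreviation arg1 :: "shear_point \<times> (real^2) \<Rightarrow> real" where
  "arg1 p \<equiv> (snd p $ 1 - fst (fst p) $ 1 + pr_s p * (snd p $ 2 - fst (fst p) $ 2)) / pr_a p"

abbreviation arg2 :: "shear_point \<times> (real^2) \<Rightarrow> real" where
  "arg2 p \<equiv> sgn (pr_a p) * \<bar>pr_a p\<bar> powr (-1/2) * (snd p $ 2 - fst (fst p) $ 2)"

text \<open>For p = ((b, s, a), x) this is the point \<open>A_a^{-1} N_s^{-1} (x - b)\<close>, as
  \<open>shearlet_eq_kernel\<close> confirms. Writing the second coordinate with a sign and a power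
  of |a| keeps derivatives in the same class of expressions.\<close>

definition shear_arg :: "shear_point \<times> (real^2) \<Rightarrow> real^2" where
  "shear_arg p = arg1 p *\<^sub>R e1 + arg2 p *\<^sub>R e2"

text \<open>The class is closed under all partial derivatives in both the group and the plane variable, so that
  growth bounds for its members are automatically bounds for all derivatives.\<close>

inductive_set kernels :: "(shear_point \<times> (real^2) \<Rightarrow> complex) set" where
  base: "\<eta> \<in> lizorkin_space \<Longrightarrow> (\<lambda>p. \<eta> (shear_arg p)) \<in> kernels"
| add: "k \<in> kernels \<Longrightarrow> l \<in> kernels \<Longrightarrow> (\<lambda>p. k p + l p) \<in> kernels"
| scale: "k \<in> kernels \<Longrightarrow> (\<lambda>p. c * k p) \<in> kernels"
| shear: "k \<in> kernels \<Longrightarrow> (\<lambda>p. of_real (pr_s p) * k p) \<in> kernels"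
| power: "k \<in> kernels \<Longrightarrow> (\<lambda>p. of_real (\<bar>pr_a p\<bar> powr r) * k p) \<in> kernels"
| sign: "k \<in> kernels \<Longrightarrow> (\<lambda>p. of_real (sgn (pr_a p)) * k p) \<in> kernels"

lemma has_derivative_sgn_pr_a:
  assumes "pr_a p \<noteq> 0"
  shows "((\<lambda>p. sgn (pr_a p)) has_derivative (\<lambda>h. 0)) (at p)"
proof -
  have "((\<lambda>p. sgn (pr_a p)) \<longlongrightarrow> sgn (pr_a p)) (nhds p)"
    using assms by (intro tendsto_intros filterlim_ident)
  then have ev: "eventually (\<lambda>q. dist (sgn (pr_a q)) (sgn (pr_a p)) < 1) (nhds p)"
    by (rule tendstoD) simp
  \<comment> \<open>Distinct values of the sign function differ by at least 1.\<close>
  have "eventually (\<lambda>q. sgn (pr_a q) = sgn (pr_a p)) (nhds p)"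
    using ev by eventually_elim (use assms in \<open>auto simp: sgn_real_def dist_real_def split: if_splits\<close>)
  then obtain S where S: "open S" "p \<in> S" "\<And>q. q \<in> S \<Longrightarrow> sgn (pr_a q) = sgn (pr_a p)"
    unfolding eventually_nhds by auto
  show ?thesis
    by (rule has_derivative_transform_within_open[OF has_derivative_const S(1,2)]) (rule S(3)[symmetric])
qed

lemma DERIV_abs_powr:
  assumes "a \<noteq> 0"
  shows "((\<lambda>a::real. \<bar>a\<bar> powr r) has_real_derivative r * \<bar>a\<bar> powr (r - 1) * sgn a) (at a)"
proof -
  have "((\<lambda>a::real. \<bar>a\<bar>) has_real_derivative sgn a) (at a)"
  proof (cases "a > 0")
    case True
    have "((\<lambda>a::real. a) has_real_derivative sgn a) (at a)"
      using True by (auto intro!: derivative_eq_intros)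
    then show ?thesis
      by (rule has_field_derivative_transform_within_open[where S = "{0<..}"]) (use True in auto)
  next
    case False
    have "((\<lambda>a::real. - a) has_real_derivative sgn a) (at a)"
      using False assms by (auto intro!: derivative_eq_intros)
    then show ?thesis
      by (rule has_field_derivative_transform_within_open[where S = "{..<0}"]) (use False assms in auto)
  qed
  from DERIV_chain2[OF has_real_derivative_powr this, of r] assms show ?thesis by simp
qed

lemma has_derivative_powr_pr_a:
  assumes "pr_a p \<noteq> 0"
  shows "((\<lambda>p. \<bar>pr_a p\<bar> powr r) has_derivative
    (\<lambda>h. pr_a h * (r * \<bar>pr_a p\<bar> powr (r - 1) * sgn (pr_a p)))) (at p)"
proof -
  have "(pr_a has_derivative pr_a) (at p)"
    by (intro bounded_linear_imp_has_derivative bounded_linear_compose[OF bounded_linear_snd]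
        bounded_linear_fst bounded_linear_snd)
  from has_derivative_compose[OF this DERIV_abs_powr[OF assms, unfolded has_field_derivative_def, of r]]
  show ?thesis by (simp add: mult_ac)
qed

lemma has_derivative_of_real_mult:
  fixes k :: "'a::real_normed_vector \<Rightarrow> complex"
  assumes "(c has_derivative c') (at p)" "(k has_derivative k') (at p)"
  shows "((\<lambda>p. of_real (c p) * k p) has_derivative (\<lambda>h. of_real (c p) * k' h + of_real (c' h) * k p)) (at p)"
  by (intro has_derivative_mult assms bounded_linear.has_derivative[OF bounded_linear_of_real])

lemma has_derivative_coords:
  "((\<lambda>p :: shear_point \<times> (real^2). snd p $ i) has_derivative (\<lambda>h. snd h $ i)) (at p)"
  "((\<lambda>p :: shear_point \<times> (real^2). fst (fst p) $ i) has_derivative (\<lambda>h. fst (fst h) $ i)) (at p)"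
  "(pr_s has_derivative pr_s) (at p)"
  "(pr_a has_derivative pr_a) (at p)"
proof -
  have "bounded_linear (\<lambda>p :: shear_point \<times> (real^2). snd p $ i)"
    by (intro bounded_linear_compose[OF bounded_linear_vec_nth] bounded_linear_snd)
  then show "((\<lambda>p :: shear_point \<times> (real^2). snd p $ i) has_derivative (\<lambda>h. snd h $ i)) (at p)"
    by (rule bounded_linear_imp_has_derivative)
  have "bounded_linear (\<lambda>p :: shear_point \<times> (real^2). fst (fst p) $ i)"
    by (intro bounded_linear_compose[OF bounded_linear_vec_nth] bounded_linear_compose[OF bounded_linear_fst]
        bounded_linear_fst)
  then show "((\<lambda>p :: shear_point \<times> (real^2). fst (fst p) $ i) has_derivative (\<lambda>h. fst (fst h) $ i)) (at p)"
    by (rule bounded_linear_imp_has_derivative)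
  have "bounded_linear pr_s"
    by (intro bounded_linear_compose[OF bounded_linear_fst] bounded_linear_compose[OF bounded_linear_snd]
        bounded_linear_fst)
  then show "(pr_s has_derivative pr_s) (at p)"
    by (rule bounded_linear_imp_has_derivative)
  have "bounded_linear pr_a"
    by (intro bounded_linear_compose[OF bounded_linear_snd] bounded_linear_compose[OF bounded_linear_fst]
        bounded_linear_fst bounded_linear_snd)
  then show "(pr_a has_derivative pr_a) (at p)"
    by (rule bounded_linear_imp_has_derivative)
qed

text \<open>The coefficients are expressed by s, the sign, powers of |a| and the two arguments
  themselves: 1/a is the sign times |a|^(-1), the s-derivative (x2 - b2)/a of \<open>arg1\<close> is
  |a|^(-1/2) times \<open>arg2\<close>, and the a-derivatives are multiples of the arguments. The
  only factors unbounded in x are then \<open>arg1\<close> and \<open>arg2\<close>, which become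
  coordinate multiples of derivatives of \<open>\<eta>\<close>.\<close>

lemma has_derivative_shearlet_base:
  assumes \<eta>: "\<eta> \<in> schwartz_space" and a: "pr_a p \<noteq> 0"
  defines "\<sigma> \<equiv> sgn (pr_a p)" and "d1 \<equiv> \<lambda>h. snd h $ 1 - fst (fst h) $ 1" and "d2 \<equiv> \<lambda>h. snd h $ 2 - fst (fst h) $ 2"
  shows "((\<lambda>p. \<eta> (shear_arg p)) has_derivative (\<lambda>h.
      (d1 h * (\<sigma> * \<bar>pr_a p\<bar> powr (-1)) + d2 h * (pr_s p * (\<sigma> * \<bar>pr_a p\<bar> powr (-1))) +
        pr_s h * (\<bar>pr_a p\<bar> powr (-1/2) * arg2 p) - pr_a h * (\<sigma> * \<bar>pr_a p\<bar> powr (-1) * arg1 p)) *\<^sub>R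
          partial e1 \<eta> (shear_arg p) +
      (d2 h * (\<sigma> * \<bar>pr_a p\<bar> powr (-1/2)) - pr_a h / 2 * (\<sigma> * \<bar>pr_a p\<bar> powr (-1) * arg2 p)) *\<^sub>R
          partial e2 \<eta> (shear_arg p))) (at p)"
proof -
  have inv: "\<sigma> * \<bar>pr_a p\<bar> powr (-1) = 1 / pr_a p"
    using a by (auto simp: \<sigma>_def sgn_real_def powr_minus field_simps)
  have half: "\<bar>pr_a p\<bar> powr (-1/2) * (\<sigma> * \<bar>pr_a p\<bar> powr (-1/2)) = 1 / pr_a p"
  proof -
    have "\<bar>pr_a p\<bar> powr (-1/2) * (\<sigma> * \<bar>pr_a p\<bar> powr (-1/2)) = \<sigma> * (\<bar>pr_a p\<bar> powr (-1/2) * \<bar>pr_a p\<bar> powr (-1/2))"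
      by simp
    also have "\<dots> = \<sigma> * \<bar>pr_a p\<bar> powr (-1)"
      by (simp add: powr_add[symmetric])
    finally show ?thesis using inv by simp
  qed
  have Y1: "(arg1 has_derivative (\<lambda>h. d1 h * (\<sigma> * \<bar>pr_a p\<bar> powr (-1)) + d2 h * (pr_s p * (\<sigma> * \<bar>pr_a p\<bar> powr (-1))) +
        pr_s h * (\<bar>pr_a p\<bar> powr (-1/2) * arg2 p) - pr_a h * (\<sigma> * \<bar>pr_a p\<bar> powr (-1) * arg1 p))) (at p)"
  proof -
    have d: "(arg1 has_derivative (\<lambda>h. - (snd p $ 1 - fst (fst p) $ 1 + pr_s p * (snd p $ 2 - fst (fst p) $ 2)) *
        (inverse (pr_a p) * pr_a h * inverse (pr_a p)) +
        (snd h $ 1 - fst (fst h) $ 1 + (pr_s p * (snd h $ 2 - fst (fst h) $ 2) + pr_s h * (snd p $ 2 - fst (fst p) $ 2))) / pr_a p)) (at p)"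
      by (intro has_derivative_divide has_derivative_add has_derivative_diff has_derivative_mult
          has_derivative_coords a)
    have y2: "\<bar>pr_a p\<bar> powr (-1/2) * arg2 p = 1 / pr_a p * (snd p $ 2 - fst (fst p) $ 2)"
      unfolding half[symmetric] by (simp add: \<sigma>_def)
    show ?thesis
      unfolding inv y2 by (rule has_derivative_eq_rhs[OF d]) (simp add: fun_eq_iff d1_def d2_def field_simps a)
  qed
  have Y2: "(arg2 has_derivative (\<lambda>h. d2 h * (\<sigma> * \<bar>pr_a p\<bar> powr (-1/2)) -
      pr_a h / 2 * (\<sigma> * \<bar>pr_a p\<bar> powr (-1) * arg2 p))) (at p)"
  proof -
    have "(arg2 has_derivative (\<lambda>h. sgn (pr_a p) * \<bar>pr_a p\<bar> powr (-1/2) * (snd h $ 2 - fst (fst h) $ 2) +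
        (sgn (pr_a p) * (pr_a h * ((-1/2) * \<bar>pr_a p\<bar> powr (-1/2 - 1) * sgn (pr_a p))) + 0 * \<bar>pr_a p\<bar> powr (-1/2)) *
          (snd p $ 2 - fst (fst p) $ 2))) (at p)"
      by (intro has_derivative_diff has_derivative_mult has_derivative_coords has_derivative_sgn_pr_a
          has_derivative_powr_pr_a a)
    moreover have "\<bar>pr_a p\<bar> powr (-1/2 - 1) = \<bar>pr_a p\<bar> powr (-1/2) * \<bar>pr_a p\<bar> powr (-1)"
      by (subst powr_add[symmetric]) simp
    ultimately show ?thesis
      by (elim has_derivative_eq_rhs) (simp add: fun_eq_iff d2_def \<sigma>_def algebra_simps diff_divide_distrib)
  qed
  have "(shear_arg has_derivative (\<lambda>h. (d1 h * (\<sigma> * \<bar>pr_a p\<bar> powr (-1)) + d2 h * (pr_s p * (\<sigma> * \<bar>pr_a p\<bar> powr (-1))) +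
        pr_s h * (\<bar>pr_a p\<bar> powr (-1/2) * arg2 p) - pr_a h * (\<sigma> * \<bar>pr_a p\<bar> powr (-1) * arg1 p)) *\<^sub>R e1 +
        (d2 h * (\<sigma> * \<bar>pr_a p\<bar> powr (-1/2)) - pr_a h / 2 * (\<sigma> * \<bar>pr_a p\<bar> powr (-1) * arg2 p)) *\<^sub>R e2)) (at p)"
    unfolding shear_arg_def [abs_def]
    by (intro has_derivative_add has_derivative_scaleR_left Y1 Y2)
  from has_derivative_compose[OF this schwartz_has_derivative[OF \<eta>]]
  show ?thesis by simp
qed

lemma shear_arg_nth: "shear_arg p $ 1 = arg1 p" "shear_arg p $ 2 = arg2 p"
  by (simp_all add: shear_arg_def)

text \<open>Bookkeeping: brings the total derivative into a sum of terms that match the closure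
  rules of \<open>kernels\<close>, the increments being constant scalars.\<close>

lemma scaleR_regroup:
  fixes X Y :: complex
  shows "(d1 * (\<sigma> * R1) + d2 * (s * (\<sigma> * R1)) + s' * (R2 * A2) - a' * (\<sigma> * R1 * A1)) *\<^sub>R X +
      (d2 * (\<sigma> * R2) - a' / 2 * (\<sigma> * R1 * A2)) *\<^sub>R Y =
    of_real d1 * (of_real \<sigma> * (of_real R1 * X)) +
      of_real d2 * (of_real s * (of_real \<sigma> * (of_real R1 * X))) +
      of_real s' * (of_real R2 * (of_real A2 * X)) +
      of_real (- a') * (of_real \<sigma> * (of_real R1 * (of_real A1 * X))) +
      of_real d2 * (of_real \<sigma> * (of_real R2 * Y)) +
      of_real (- a' / 2) * (of_real \<sigma> * (of_real R1 * (of_real A2 * Y)))"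
  by (simp add: scaleR_conv_of_real algebra_simps)

text \<open>D is chosen before the point p, so each directional derivative is a single kernel over
  the whole group. In the base case each of the six terms of the chain rule comes from a derivative
  of \<open>\<eta>\<close>, possibly multiplied by a coordinate.\<close>

lemma kernel_has_derivative_ex:
  assumes "k \<in> kernels"
  shows "\<exists>D. (\<forall>h. D h \<in> kernels) \<and> (\<forall>p. pr_a p \<noteq> 0 \<longrightarrow> (k has_derivative (\<lambda>h. D h p)) (at p))"
  using assms
proof induction
  case (base \<eta>)
  let ?d1 = "\<lambda>h :: shear_point \<times> (real^2). snd h $ 1 - fst (fst h) $ 1"
  let ?d2 = "\<lambda>h :: shear_point \<times> (real^2). snd h $ 2 - fst (fst h) $ 2"
  let ?\<sigma> = "\<lambda>p. complex_of_real (sgn (pr_a p))" and ?r = "\<lambda>r p. complex_of_real (\<bar>pr_a p\<bar> powr r)"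
  let ?\<eta>1 = "\<lambda>p. partial e1 \<eta> (shear_arg p)" and ?\<eta>2 = "\<lambda>p. partial e2 \<eta> (shear_arg p)"
  let ?y\<eta> = "\<lambda>i v p. of_real (shear_arg p $ i) * partial v \<eta> (shear_arg p)"
  define D where "D h p = of_real (?d1 h) * (?\<sigma> p * (?r (-1) p * ?\<eta>1 p)) +
      of_real (?d2 h) * (of_real (pr_s p) * (?\<sigma> p * (?r (-1) p * ?\<eta>1 p))) +
      of_real (pr_s h) * (?r (-1/2) p * ?y\<eta> 2 e1 p) +
      of_real (- pr_a h) * (?\<sigma> p * (?r (-1) p * ?y\<eta> 1 e1 p)) +
      of_real (?d2 h) * (?\<sigma> p * (?r (-1/2) p * ?\<eta>2 p)) +
      of_real (- pr_a h / 2) * (?\<sigma> p * (?r (-1) p * ?y\<eta> 2 e2 p))" for h p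
  have B: "e1 \<in> Basis" "e2 \<in> Basis" by (auto simp: Basis_plane)
  have y: "?y\<eta> i v \<in> kernels" if "v \<in> Basis" for i v
    using kernels.base[OF lizorkin_coord[OF lizorkin_partial[OF base that]]] by simp
  have "D h \<in> kernels" for h
    unfolding D_def [abs_def]
    by (intro kernels.add kernels.scale kernels.shear kernels.power kernels.sign y B
        kernels.base[OF lizorkin_partial[OF base]])
  moreover have "((\<lambda>p. \<eta> (shear_arg p)) has_derivative (\<lambda>h. D h p)) (at p)" if "pr_a p \<noteq> 0" for p
    by (rule has_derivative_eq_rhs[OF has_derivative_shearlet_base[OF lizorkin_schwartz[OF base] that]])
      (rule ext, simp only: D_def shear_arg_nth, rule scaleR_regroup)
  ultimately show ?case by blast
next
  case (add k l)
  then obtain D E where *: "\<forall>h. D h \<in> kernels" "\<forall>p. pr_a p \<noteq> 0 \<longrightarrow> (k has_derivative (\<lambda>h. D h p)) (at p)"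
    "\<forall>h. E h \<in> kernels" "\<forall>p. pr_a p \<noteq> 0 \<longrightarrow> (l has_derivative (\<lambda>h. E h p)) (at p)" by blast
  then show ?case
    by (intro exI[of _ "\<lambda>h p. D h p + E h p"]) (auto intro: kernels.add has_derivative_add)
next
  case (scale k c)
  then obtain D where *: "\<forall>h. D h \<in> kernels" "\<forall>p. pr_a p \<noteq> 0 \<longrightarrow> (k has_derivative (\<lambda>h. D h p)) (at p)" by blast
  then show ?case
    by (intro exI[of _ "\<lambda>h p. c * D h p"]) (auto intro: kernels.scale has_derivative_mult_right)
next
  case (shear k)
  then obtain D where *: "\<forall>h. D h \<in> kernels" "\<forall>p. pr_a p \<noteq> 0 \<longrightarrow> (k has_derivative (\<lambda>h. D h p)) (at p)" by blast
  then show ?case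
    using kernels.add[OF kernels.shear kernels.scale[OF shear.hyps]]
      has_derivative_of_real_mult[OF has_derivative_coords(3)]
    by (intro exI[of _ "\<lambda>h p. of_real (pr_s p) * D h p + of_real (pr_s h) * k p"]) blast
next
  case (power k r)
  then obtain D where *: "\<forall>h. D h \<in> kernels" "\<forall>p. pr_a p \<noteq> 0 \<longrightarrow> (k has_derivative (\<lambda>h. D h p)) (at p)" by blast
  let ?D = "\<lambda>h p. of_real (\<bar>pr_a p\<bar> powr r) * D h p +
    of_real (pr_a h * r) * (of_real (\<bar>pr_a p\<bar> powr (r - 1)) * (of_real (sgn (pr_a p)) * k p))"
  have "((\<lambda>p. of_real (\<bar>pr_a p\<bar> powr r) * k p) has_derivative (\<lambda>h. ?D h p)) (at p)" if "pr_a p \<noteq> 0" for p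
    by (rule has_derivative_eq_rhs[OF has_derivative_of_real_mult[OF has_derivative_powr_pr_a[OF that]
          *(2)[rule_format, OF that]]]) (simp add: fun_eq_iff)
  moreover have "?D h \<in> kernels" for h
    by (intro kernels.add kernels.power kernels.scale kernels.sign power.hyps *(1)[rule_format])
  ultimately show ?case
    by (intro exI[of _ ?D]) blast
next
  case (sign k)
  then obtain D where *: "\<forall>h. D h \<in> kernels" "\<forall>p. pr_a p \<noteq> 0 \<longrightarrow> (k has_derivative (\<lambda>h. D h p)) (at p)" by blast
  have "((\<lambda>p. of_real (sgn (pr_a p)) * k p) has_derivative (\<lambda>h. of_real (sgn (pr_a p)) * D h p)) (at p)"
    if "pr_a p \<noteq> 0" for p
    by (rule has_derivative_eq_rhs[OF has_derivative_of_real_mult[OF has_derivative_sgn_pr_a[OF that]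
          *(2)[rule_format, OF that]]]) simp
  moreover have "(\<lambda>p. of_real (sgn (pr_a p)) * D h p) \<in> kernels" for h
    by (intro kernels.sign *(1)[rule_format])
  ultimately show ?case
    by (intro exI[of _ "\<lambda>h p. of_real (sgn (pr_a p)) * D h p"]) blast
qed

text \<open>Obtained by choice and therefore unspecified at a = 0; identities between such
  derivatives, linearity in the direction included, are available only over the group.\<close>

definition kd :: "(shear_point \<times> (real^2) \<Rightarrow> complex) \<Rightarrow> shear_point \<times> (real^2) \<Rightarrow> shear_point \<times> (real^2) \<Rightarrow> complex" where
  "kd k = (SOME D. (\<forall>h. D h \<in> kernels) \<and> (\<forall>p. pr_a p \<noteq> 0 \<longrightarrow> (k has_derivative (\<lambda>h. D h p)) (at p)))"

lemma
  assumes "k \<in> kernels"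
  shows kd_kernel: "kd k h \<in> kernels"
    and kernel_has_derivative: "pr_a p \<noteq> 0 \<Longrightarrow> (k has_derivative (\<lambda>h. kd k h p)) (at p)"
  using someI_ex[OF kernel_has_derivative_ex[OF assms], folded kd_def] by blast+

section \<open>Growth of kernels\<close>

text \<open>One scalar that majorizes all four factors of the group norms, so that polynomial growth
  in all variables becomes a single exponent.\<close>

definition weight :: "shear_point \<Rightarrow> real" where
  "weight z = jbracket (fst z $ 1) * jbracket (fst z $ 2) * jbracket (fst (snd z)) *
    (\<bar>snd (snd z)\<bar> + 1 / \<bar>snd (snd z)\<bar>)"

lemma mem_shearlet_group: "z \<in> shearlet_group \<longleftrightarrow> snd (snd z) \<noteq> 0"
  by (cases z) (auto simp: shearlet_group_def)

lemma open_shearlet_group: "open shearlet_group"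
proof -
  have "shearlet_group = (\<lambda>z. snd (snd z)) -` (- {0})"
    by (auto simp: mem_shearlet_group)
  moreover have "open ((\<lambda>z :: shear_point. snd (snd z)) -` (- {0}))"
    by (intro open_vimage continuous_intros open_Compl closed_singleton)
  ultimately show ?thesis by metis
qed

lemma abs_plus_inverse_ge_1:
  fixes a :: real
  assumes "a \<noteq> 0"
  shows "1 \<le> \<bar>a\<bar> + 1 / \<bar>a\<bar>"
proof (cases "\<bar>a\<bar> \<ge> 1")
  case True
  then show ?thesis by (simp add: add_increasing2)
next
  case False
  then have "1 \<le> 1 / \<bar>a\<bar>" using assms by simp
  then show ?thesis by (simp add: add_increasing)
qed

lemma weight_nonneg: "0 \<le> weight z"
  unfolding weight_def by (intro mult_nonneg_nonneg add_nonneg_nonneg) (auto simp: jbracket_pos less_imp_le)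

lemma
  assumes "z \<in> shearlet_group"
  shows weight_ge_1: "1 \<le> weight z"
    and jbracket_b1_le_weight: "jbracket (fst z $ 1) \<le> weight z"
    and jbracket_b2_le_weight: "jbracket (fst z $ 2) \<le> weight z"
    and jbracket_s_le_weight: "jbracket (fst (snd z)) \<le> weight z"
    and abs_a_le_weight: "\<bar>snd (snd z)\<bar> + 1 / \<bar>snd (snd z)\<bar> \<le> weight z"
proof -
  have prod4: "1 \<le> p * q * r * t \<and> p \<le> p * q * r * t \<and> q \<le> p * q * r * t \<and> r \<le> p * q * r * t \<and> t \<le> p * q * r * t"
    if "1 \<le> p" "1 \<le> q" "1 \<le> r" "1 \<le> t" for p q r t :: real
  proof -
    have ge: "1 \<le> x * y \<and> x \<le> x * y \<and> y \<le> x * y" if "1 \<le> x" "1 \<le> y" for x y :: real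
    proof -
      have "x * 1 \<le> x * y" "1 * y \<le> x * y" using that by (auto intro!: mult_left_mono mult_right_mono)
      then show ?thesis using that by linarith
    qed
    have pq: "1 \<le> p * q" "p \<le> p * q" "q \<le> p * q" using ge[OF that(1,2)] by blast+
    have pqr: "1 \<le> p * q * r" "p * q \<le> p * q * r" "r \<le> p * q * r" using ge[OF pq(1) that(3)] by blast+
    have "p * q * r \<le> p * q * r * t" "t \<le> p * q * r * t" using ge[OF pqr(1) that(4)] by blast+
    then show ?thesis using pq pqr by linarith
  qed
  note * = prod4[OF jbracket_ge_1 jbracket_ge_1 jbracket_ge_1 abs_plus_inverse_ge_1,
      of "snd (snd z)" "fst z $ 1" "fst z $ 2" "fst (snd z)", folded weight_def]
  have "snd (snd z) \<noteq> 0" using assms by (simp add: mem_shearlet_group)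
  from *[OF this] show "1 \<le> weight z" "jbracket (fst z $ 1) \<le> weight z" "jbracket (fst z $ 2) \<le> weight z"
    "jbracket (fst (snd z)) \<le> weight z" "\<bar>snd (snd z)\<bar> + 1 / \<bar>snd (snd z)\<bar> \<le> weight z" by auto
qed

lemma abs_le_jbracket: "\<bar>t\<bar> \<le> jbracket t" for t :: real
  using norm_le_jbracket[of t] by simp

text \<open>|r| is rounded up to a natural number; |a| + 1/|a| dominates both |a| and 1/|a|, so both
  signs of r are covered.\<close>

lemma abs_powr_le_weight:
  assumes "z \<in> shearlet_group"
  shows "\<bar>snd (snd z)\<bar> powr r \<le> weight z ^ nat \<lceil>\<bar>r\<bar>\<rceil>"
proof -
  let ?a = "\<bar>snd (snd z)\<bar>" and ?n = "nat \<lceil>\<bar>r\<bar>\<rceil>"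
  have a: "?a > 0" using assms by (simp add: mem_shearlet_group)
  have "\<bar>r\<bar> \<le> real ?n" by (rule real_nat_ceiling_ge)
  then have n: "r \<le> real ?n" "- r \<le> real ?n" by linarith+
  have "?a powr r \<le> (?a + 1 / ?a) ^ ?n"
  proof (cases "?a \<ge> 1")
    case True
    have "?a powr r \<le> ?a powr real ?n"
      by (rule powr_mono[OF n(1) True])
    also have "\<dots> = ?a ^ ?n" using a by (rule powr_realpow)
    also have "\<dots> \<le> (?a + 1 / ?a) ^ ?n" using a by (intro power_mono) auto
    finally show ?thesis .
  next
    case False
    have "?a powr r = (1 / ?a) powr (- r)"
      using a by (simp add: powr_minus powr_divide)
    also have "\<dots> \<le> (1 / ?a) powr real ?n"
      using False a by (intro powr_mono[OF n(2)]) auto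
    also have "\<dots> = (1 / ?a) ^ ?n" using a by (intro powr_realpow) simp
    also have "\<dots> \<le> (?a + 1 / ?a) ^ ?n" using a by (intro power_mono) auto
    finally show ?thesis .
  qed
  also have "\<dots> \<le> weight z ^ ?n"
    using abs_a_le_weight[OF assms] a by (intro power_mono) auto
  finally show ?thesis .
qed

text \<open>Inverts the affine map: up to sign x2 - b2 is |a|^(1/2) times \<open>arg2\<close>, and
  x1 - b1 is a times \<open>arg1\<close> minus s (x2 - b2). The product of s and |a|^(1/2) costs the
  square of the weight. In this way decay of \<open>\<eta>\<close> in its argument becomes decay in
  x.\<close>

lemma jbracket_le_shear_arg:
  assumes z: "fst p \<in> shearlet_group"
  shows "jbracket (snd p) \<le> 6 * weight (fst p) ^ 2 * jbracket (shear_arg p)"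
proof -
  let ?w = "weight (fst p)" and ?J = "jbracket (shear_arg p)"
  let ?d1 = "snd p $ 1 - fst (fst p) $ 1" and ?d2 = "snd p $ 2 - fst (fst p) $ 2"
  note w = weight_ge_1[OF z]
  have a: "pr_a p \<noteq> 0" using z by (simp add: mem_shearlet_group)
  have J: "1 \<le> ?J" "\<bar>arg1 p\<bar> \<le> ?J" "\<bar>arg2 p\<bar> \<le> ?J"
    using jbracket_ge_1[of "shear_arg p"] component_le_jbracket[of "shear_arg p" 1] component_le_jbracket[of "shear_arg p" 2]
    by (simp_all add: shear_arg_nth)
  have ws: "\<bar>pr_s p\<bar> \<le> ?w" using jbracket_s_le_weight[OF z] abs_le_jbracket[of "pr_s p"] by linarith
  have wb: "\<bar>fst (fst p) $ 1\<bar> \<le> ?w" "\<bar>fst (fst p) $ 2\<bar> \<le> ?w"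
    using jbracket_b1_le_weight[OF z] jbracket_b2_le_weight[OF z] abs_le_jbracket[of "fst (fst p) $ 1"]
      abs_le_jbracket[of "fst (fst p) $ 2"] by linarith+
  have wa: "\<bar>pr_a p\<bar> \<le> ?w"
    using abs_a_le_weight[OF z] by (smt (verit) divide_nonneg_nonneg abs_ge_zero)
  have war: "\<bar>pr_a p\<bar> powr (1/2) \<le> ?w"
  proof -
    have "\<lceil>\<bar>1/2\<bar> :: real\<rceil> = 1" by (rule ceiling_unique) auto
    then show ?thesis using abs_powr_le_weight[OF z, of "1/2"] by simp
  qed
  have "\<bar>pr_a p\<bar> powr (1/2) * \<bar>arg2 p\<bar> = \<bar>?d2\<bar> * (\<bar>pr_a p\<bar> powr (1/2) * \<bar>pr_a p\<bar> powr (-1/2))"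
    using a by (simp add: abs_mult abs_sgn_eq mult_ac)
  also have "\<bar>pr_a p\<bar> powr (1/2) * \<bar>pr_a p\<bar> powr (-1/2) = 1"
    using a by (subst powr_add[symmetric]) simp
  finally have "\<bar>?d2\<bar> = \<bar>pr_a p\<bar> powr (1/2) * \<bar>arg2 p\<bar>" by simp
  also have "\<dots> \<le> ?w * ?J" using war J(3) w by (intro mult_mono) auto
  finally have d2: "\<bar>?d2\<bar> \<le> ?w * ?J" .
  have "?d1 = pr_a p * arg1 p - pr_s p * ?d2" using a by (simp add: field_simps)
  then have "\<bar>?d1\<bar> \<le> \<bar>pr_a p * arg1 p\<bar> + \<bar>pr_s p * ?d2\<bar>"
    by (rule ord_eq_le_trans[OF arg_cong[of _ _ abs] abs_triangle_ineq4])
  then have "\<bar>?d1\<bar> \<le> \<bar>pr_a p\<bar> * \<bar>arg1 p\<bar> + \<bar>pr_s p\<bar> * \<bar>?d2\<bar>"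
    by (simp only: abs_mult)
  also have "\<dots> \<le> ?w * ?J + ?w * (?w * ?J)"
    using wa ws J d2 w by (intro add_mono mult_mono) auto
  finally have d1: "\<bar>?d1\<bar> \<le> ?w * ?J + ?w * (?w * ?J)" .
  have le: "1 \<le> ?w^2 * ?J" "?w \<le> ?w^2 * ?J" "?w * ?J \<le> ?w^2 * ?J"
  proof -
    have "?w * 1 \<le> ?w * ?w" using w by (intro mult_left_mono) auto
    then have w2: "?w \<le> ?w^2" by (simp add: power2_eq_square)
    have "?w^2 * 1 \<le> ?w^2 * ?J" using J by (intro mult_left_mono) auto
    then show "1 \<le> ?w^2 * ?J" "?w \<le> ?w^2 * ?J" using w2 w by linarith+
    show "?w * ?J \<le> ?w^2 * ?J" using w2 J by (intro mult_right_mono) auto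
  qed
  have "jbracket (snd p) \<le> 1 + norm (snd p)"
    unfolding jbracket_def by (intro real_le_lsqrt) (auto simp: power2_sum)
  also have "norm (snd p) \<le> \<bar>snd p $ 1\<bar> + \<bar>snd p $ 2\<bar>"
    using norm_le_l1_cart[of "snd p"] by (simp add: UNIV_2)
  finally have "jbracket (snd p) \<le> 1 + \<bar>snd p $ 1\<bar> + \<bar>snd p $ 2\<bar>" by simp
  also have "\<dots> \<le> 1 + (\<bar>fst (fst p) $ 1\<bar> + \<bar>?d1\<bar>) + (\<bar>fst (fst p) $ 2\<bar> + \<bar>?d2\<bar>)" by linarith
  \<comment> \<open>Six summands, each at most \<open>?w^2 * ?J\<close>, the bound for
    \<open>?d1\<close> contributing two of them; hence the constant 6.\<close>
  also have "\<dots> \<le> ?w^2 * ?J + (?w^2 * ?J + (?w^2 * ?J + ?w^2 * ?J)) + (?w^2 * ?J + ?w^2 * ?J)"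
    using le wb d1 d2 by (intro add_mono) (auto simp: power2_eq_square mult_ac)
  finally show ?thesis by linarith
qed

text \<open>The order N of decay in x is arbitrary and is paid for by an N-dependent power of the
  weight, a form that survives integration against rapidly decreasing functions of z.\<close>

definition growth :: "(shear_point \<times> (real^2) \<Rightarrow> complex) \<Rightarrow> bool" where
  "growth k \<longleftrightarrow> (\<forall>N. \<exists>C n. 0 \<le> C \<and> (\<forall>p. fst p \<in> shearlet_group \<longrightarrow> jbracket (snd p) ^ N * norm (k p) \<le> C * weight (fst p) ^ n))"

lemma growth_mult:
  assumes k: "growth k" and c: "\<And>p. fst p \<in> shearlet_group \<Longrightarrow> norm (c p) \<le> K * weight (fst p) ^ m"
    and K: "0 \<le> K"
  shows "growth (\<lambda>p. c p * k p)"
  unfolding growth_def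
proof
  fix N
  obtain C n where C: "0 \<le> C" "\<And>p. fst p \<in> shearlet_group \<Longrightarrow> jbracket (snd p) ^ N * norm (k p) \<le> C * weight (fst p) ^ n"
    using k unfolding growth_def by metis
  have "jbracket (snd p) ^ N * norm (c p * k p) \<le> K * C * weight (fst p) ^ (m + n)" if p: "fst p \<in> shearlet_group" for p
  proof -
    have "jbracket (snd p) ^ N * norm (c p * k p) = norm (c p) * (jbracket (snd p) ^ N * norm (k p))"
      by (simp add: norm_mult)
    also have "\<dots> \<le> (K * weight (fst p) ^ m) * (C * weight (fst p) ^ n)"
      by (rule mult_mono[OF c[OF p] C(2)[OF p]]) (simp_all add: K weight_nonneg jbracket_pos less_imp_le)
    finally show ?thesis by (simp add: power_add mult_ac)
  qed
  then show "\<exists>C n. 0 \<le> C \<and> (\<forall>p. fst p \<in> shearlet_group \<longrightarrow> jbracket (snd p) ^ N * norm (c p * k p) \<le> C * weight (fst p) ^ n)"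
    using mult_nonneg_nonneg[OF K C(1)] by blast
qed

text \<open>Decay enters in the base case only: N brackets of x are exchanged for N brackets of the
  argument at the price \<open>6 ^ N\<close> times the power 2 N of the weight. The multiplication
  rules contribute factors bounded by powers of the weight.\<close>

lemma kernel_growth: "k \<in> kernels \<Longrightarrow> growth k"
proof (induction rule: kernels.induct)
  case (base \<eta>)
  show ?case unfolding growth_def
  proof
    fix N
    obtain C where C: "C > 0" "\<And>x. jbracket x ^ N * norm (\<eta> x) \<le> C"
      using schwartz_bound[OF lizorkin_schwartz[OF base]] by metis
    have "jbracket (snd p) ^ N * norm (\<eta> (shear_arg p)) \<le> 6 ^ N * C * weight (fst p) ^ (2 * N)"
      if p: "fst p \<in> shearlet_group" for p
    proof -
      have "jbracket (snd p) ^ N * norm (\<eta> (shear_arg p)) \<le>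
          (6 * weight (fst p) ^ 2 * jbracket (shear_arg p)) ^ N * norm (\<eta> (shear_arg p))"
        using jbracket_le_shear_arg[OF p] by (intro mult_right_mono power_mono) (auto simp: jbracket_pos less_imp_le)
      also have "\<dots> = 6 ^ N * weight (fst p) ^ (2 * N) * (jbracket (shear_arg p) ^ N * norm (\<eta> (shear_arg p)))"
        by (simp add: power_mult_distrib power_mult)
      also have "\<dots> \<le> 6 ^ N * weight (fst p) ^ (2 * N) * C"
        by (intro mult_left_mono C) (simp add: weight_nonneg)
      finally show ?thesis by (simp add: mult_ac)
    qed
    then show "\<exists>C n. 0 \<le> C \<and> (\<forall>p. fst p \<in> shearlet_group \<longrightarrow>
        jbracket (snd p) ^ N * norm (\<eta> (shear_arg p)) \<le> C * weight (fst p) ^ n)"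
      using C(1) by (intro exI[of _ "6 ^ N * C"] exI[of _ "2 * N"]) auto
  qed
next
  case (add k l)
  show ?case unfolding growth_def
  proof
    fix N
    obtain A m B n where A: "0 \<le> A" "\<And>p. fst p \<in> shearlet_group \<Longrightarrow> jbracket (snd p) ^ N * norm (k p) \<le> A * weight (fst p) ^ m"
      and B: "0 \<le> B" "\<And>p. fst p \<in> shearlet_group \<Longrightarrow> jbracket (snd p) ^ N * norm (l p) \<le> B * weight (fst p) ^ n"
      using add.IH unfolding growth_def by metis
    have "jbracket (snd p) ^ N * norm (k p + l p) \<le> (A + B) * weight (fst p) ^ (m + n)" if p: "fst p \<in> shearlet_group" for p
    proof -
      have "jbracket (snd p) ^ N * norm (k p + l p) \<le> jbracket (snd p) ^ N * norm (k p) + jbracket (snd p) ^ N * norm (l p)"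
        unfolding distrib_left[symmetric]
        by (intro mult_left_mono norm_triangle_ineq) (simp add: jbracket_pos less_imp_le)
      also have "\<dots> \<le> A * weight (fst p) ^ m + B * weight (fst p) ^ n"
        using A(2)[OF p] B(2)[OF p] by linarith
      also have "\<dots> \<le> A * weight (fst p) ^ (m + n) + B * weight (fst p) ^ (m + n)"
        using A(1) B(1) weight_ge_1[OF p] by (intro add_mono mult_left_mono power_increasing) auto
      finally show ?thesis by (simp add: algebra_simps)
    qed
    then show "\<exists>C n. 0 \<le> C \<and> (\<forall>p. fst p \<in> shearlet_group \<longrightarrow> jbracket (snd p) ^ N * norm (k p + l p) \<le> C * weight (fst p) ^ n)"
      using A(1) B(1) by (intro exI[of _ "A + B"] exI[of _ "m + n"]) auto
  qed
next
  case (scale k c)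
  show ?case by (rule growth_mult[OF scale.IH, of "\<lambda>_. c" "norm c" 0]) auto
next
  case (shear k)
  have "norm (complex_of_real (pr_s p)) \<le> 1 * weight (fst p) ^ 1" if "fst p \<in> shearlet_group" for p
    using jbracket_s_le_weight[OF that] abs_le_jbracket[of "pr_s p"] by simp
  then show ?case by (rule growth_mult[OF shear.IH _ zero_le_one])
next
  case (power k r)
  have "norm (complex_of_real (\<bar>pr_a p\<bar> powr r)) \<le> 1 * weight (fst p) ^ nat \<lceil>\<bar>r\<bar>\<rceil>" if "fst p \<in> shearlet_group" for p
    using abs_powr_le_weight[OF that, of r] by simp
  then show ?case by (rule growth_mult[OF power.IH _ zero_le_one])
next
  case (sign k)
  have "norm (complex_of_real (sgn (pr_a p))) \<le> 1 * weight (fst p) ^ 0" if "fst p \<in> shearlet_group" for p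
    by (simp add: abs_sgn_eq)
  then show ?case by (rule growth_mult[OF sign.IH _ zero_le_one])
qed

lemma kernel_bound:
  assumes "k \<in> kernels"
  obtains C n where "0 \<le> C" "\<And>z x. z \<in> shearlet_group \<Longrightarrow> jbracket x ^ N * norm (k (z, x)) \<le> C * weight z ^ n"
  using kernel_growth[OF assms] unfolding growth_def by (metis fst_conv snd_conv)

section \<open>Mean value and Taylor estimates for kernels\<close>

lemma kernel_has_vector_derivative:
  assumes k: "k \<in> kernels" and a: "fst (p + t0 *\<^sub>R h) \<in> shearlet_group"
  shows "((\<lambda>t. k (p + t *\<^sub>R h)) has_vector_derivative kd k h (p + t0 *\<^sub>R h)) (at t0)"
proof -
  have a': "pr_a (p + t0 *\<^sub>R h) \<noteq> 0"
    using a by (simp add: mem_shearlet_group)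
  have d: "((\<lambda>t. p + t *\<^sub>R h) has_derivative (\<lambda>t. t *\<^sub>R h)) (at t0)"
    by (auto intro!: derivative_eq_intros)
  note D = kernel_has_derivative[OF k a']
  have "((\<lambda>t. k (p + t *\<^sub>R h)) has_derivative (\<lambda>t. kd k (t *\<^sub>R h) (p + t0 *\<^sub>R h))) (at t0)"
    by (rule has_derivative_compose[OF d D])
  moreover have "kd k (t *\<^sub>R h) (p + t0 *\<^sub>R h) = t *\<^sub>R kd k h (p + t0 *\<^sub>R h)" for t
    using linear_cmul[OF has_derivative_linear[OF D]] by simp
  ultimately show ?thesis
    by (simp add: has_vector_derivative_def)
qed

text \<open>Over the group the derivative is linear in h, so expansion in the finite basis makes the
  constants uniform in the direction; the sums of constants and of exponents dominate all basis
  directions at once.\<close>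

lemma kd_bound:
  assumes k: "k \<in> kernels"
  obtains C n where "0 \<le> C" "\<And>z x h. z \<in> shearlet_group \<Longrightarrow>
    jbracket x ^ N * norm (kd k h (z, x)) \<le> C * weight z ^ n * norm h"
proof -
  let ?B = "Basis :: (shear_point \<times> (real^2)) set"
  have "\<exists>C n. 0 \<le> C \<and> (\<forall>z x. z \<in> shearlet_group \<longrightarrow> jbracket x ^ N * norm (kd k i (z, x)) \<le> C * weight z ^ n)" for i
    using kernel_bound[OF kd_kernel[OF k], of N i] by metis
  then obtain C n where C: "\<And>i. 0 \<le> C i"
    "\<And>i z x. z \<in> shearlet_group \<Longrightarrow> jbracket x ^ N * norm (kd k i (z, x)) \<le> C i * weight z ^ n i"
    by metis
  have "jbracket x ^ N * norm (kd k h (z, x)) \<le> (\<Sum>i\<in>?B. C i) * weight z ^ (\<Sum>i\<in>?B. n i) * norm h"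
    if z: "z \<in> shearlet_group" for z x h
  proof -
    have "pr_a (z, x) \<noteq> 0" using z by (simp add: mem_shearlet_group)
    note lin = has_derivative_linear[OF kernel_has_derivative[OF k this]]
    have "kd k h (z, x) = kd k (\<Sum>i\<in>?B. (h \<bullet> i) *\<^sub>R i) (z, x)"
      by (simp add: euclidean_representation)
    also have "\<dots> = (\<Sum>i\<in>?B. (h \<bullet> i) *\<^sub>R kd k i (z, x))"
      by (simp add: linear_sum[OF lin] linear_cmul[OF lin])
    finally have "norm (kd k h (z, x)) \<le> (\<Sum>i\<in>?B. norm ((h \<bullet> i) *\<^sub>R kd k i (z, x)))"
      by (simp only: norm_sum)
    also have "\<dots> \<le> (\<Sum>i\<in>?B. norm h * norm (kd k i (z, x)))"
      by (intro sum_mono) (auto intro!: mult_right_mono Basis_le_norm)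
    finally have "jbracket x ^ N * norm (kd k h (z, x)) \<le> jbracket x ^ N * (\<Sum>i\<in>?B. norm h * norm (kd k i (z, x)))"
      by (intro mult_left_mono) (auto simp: jbracket_pos less_imp_le)
    also have "\<dots> = (\<Sum>i\<in>?B. (jbracket x ^ N * norm (kd k i (z, x)))) * norm h"
      by (simp add: sum_distrib_left sum_distrib_right mult_ac)
    also have "\<dots> \<le> (\<Sum>i\<in>?B. C i * weight z ^ (\<Sum>i\<in>?B. n i)) * norm h"
    proof (intro mult_right_mono sum_mono)
      fix i assume i: "i \<in> ?B"
      have "jbracket x ^ N * norm (kd k i (z, x)) \<le> C i * weight z ^ n i" by (rule C(2)[OF z])
      also have "\<dots> \<le> C i * weight z ^ (\<Sum>i\<in>?B. n i)"
        using C(1) weight_ge_1[OF z] i by (intro mult_left_mono power_increasing member_le_sum) auto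
      finally show "jbracket x ^ N * norm (kd k i (z, x)) \<le> C i * weight z ^ (\<Sum>i\<in>?B. n i)" .
    qed auto
    finally show ?thesis by (simp add: sum_distrib_right)
  qed
  then show thesis
    using C(1) by (intro that[of "\<Sum>i\<in>?B. C i" "\<Sum>i\<in>?B. n i"]) (auto intro: sum_nonneg)
qed

text \<open>The mean value inequality for \<open>\<lambda>u. g u - u *\<^sub>R g' 0\<close>, whose
  derivative is at most B |t| between -|t| and |t|.\<close>

lemma taylor_line:
  fixes g g' :: "real \<Rightarrow> complex"
  assumes d: "\<And>u. \<bar>u\<bar> \<le> \<bar>t\<bar> \<Longrightarrow> (g has_vector_derivative g' u) (at u)"
    and l: "\<And>u. \<bar>u\<bar> \<le> \<bar>t\<bar> \<Longrightarrow> norm (g' u - g' 0) \<le> B * \<bar>u\<bar>" and B: "0 \<le> B"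
  shows "norm (g t - g 0 - t *\<^sub>R g' 0) \<le> B * t\<^sup>2"
proof -
  let ?S = "{-\<bar>t\<bar>..\<bar>t\<bar>}"
  have "norm ((g t - t *\<^sub>R g' 0) - (g 0 - 0 *\<^sub>R g' 0)) \<le> (B * \<bar>t\<bar>) * norm (t - 0)"
  proof (rule differentiable_bound[where S = ?S and f' = "\<lambda>u v. v *\<^sub>R (g' u - g' 0)"])
    fix u assume u: "u \<in> ?S"
    then have "\<bar>u\<bar> \<le> \<bar>t\<bar>" by auto
    from d[OF this] have "((\<lambda>u. g u - u *\<^sub>R g' 0) has_vector_derivative (g' u - g' 0)) (at u)"
      by (intro derivative_intros) (auto intro!: derivative_eq_intros)
    then show "((\<lambda>u. g u - u *\<^sub>R g' 0) has_derivative (\<lambda>v. v *\<^sub>R (g' u - g' 0))) (at u within ?S)"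
      by (auto simp: has_vector_derivative_def intro: has_derivative_at_withinI)
    show "onorm (\<lambda>v. v *\<^sub>R (g' u - g' 0)) \<le> B * \<bar>t\<bar>"
    proof (rule onorm_le)
      fix v :: real
      have "norm (g' u - g' 0) \<le> B * \<bar>t\<bar>"
        using l[of u] \<open>\<bar>u\<bar> \<le> \<bar>t\<bar>\<close> mult_left_mono[OF \<open>\<bar>u\<bar> \<le> \<bar>t\<bar>\<close> B] by linarith
      then show "norm (v *\<^sub>R (g' u - g' 0)) \<le> B * \<bar>t\<bar> * norm v"
        by (simp add: mult.commute mult_left_mono)
    qed
  qed auto
  then show ?thesis by (simp add: power2_eq_square algebra_simps)
qed

lemma kernel_lipschitz_segment:
  assumes k: "k \<in> kernels" and S: "convex S" "\<And>p. p \<in> S \<Longrightarrow> fst p \<in> shearlet_group"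
    and B: "\<And>p. p \<in> S \<Longrightarrow> norm (kd k (q - r) p) \<le> B * norm (q - r)" and qr: "q \<in> S" "r \<in> S"
  shows "norm (k q - k r) \<le> B * norm (q - r)"
proof -
  have "norm (k (r + 1 *\<^sub>R (q - r)) - k (r + 0 *\<^sub>R (q - r))) \<le> (B * norm (q - r)) * norm (1 - 0 :: real)"
  proof (rule differentiable_bound[where S = "{0..1}" and f' = "\<lambda>u v. v *\<^sub>R kd k (q - r) (r + u *\<^sub>R (q - r))"])
    fix u :: real assume u: "u \<in> {0..1}"
    have "(1 - u) *\<^sub>R r + u *\<^sub>R q \<in> S"
      using u qr by (intro convexD[OF S(1)]) auto
    then have p: "r + u *\<^sub>R (q - r) \<in> S" by (simp add: algebra_simps)
    show "((\<lambda>t. k (r + t *\<^sub>R (q - r))) has_derivative (\<lambda>v. v *\<^sub>R kd k (q - r) (r + u *\<^sub>R (q - r)))) (at u within {0..1})"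
      using kernel_has_vector_derivative[OF k S(2)[OF p]]
      by (auto simp: has_vector_derivative_def intro: has_derivative_at_withinI)
    show "onorm (\<lambda>v. v *\<^sub>R kd k (q - r) (r + u *\<^sub>R (q - r))) \<le> B * norm (q - r)"
      using B[OF p] by (intro onorm_le) (simp add: mult.commute mult_left_mono)
  qed auto
  then show ?thesis by simp
qed

lemma continuous_on_weight: "continuous_on shearlet_group weight"
  unfolding weight_def [abs_def] jbracket_def
  by (intro continuous_intros) (auto simp: mem_shearlet_group)

lemma weight_locally_bounded:
  assumes "z0 \<in> shearlet_group"
  obtains r where "r > 0" "\<And>z. z \<in> ball z0 r \<Longrightarrow> z \<in> shearlet_group \<and> weight z \<le> weight z0 + 1"
proof -
  have "isCont weight z0"
    using continuous_on_weight assms open_shearlet_group by (simp add: continuous_on_eq_continuous_at)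
  then obtain d where d: "d > 0" "\<And>z. dist z z0 < d \<Longrightarrow> dist (weight z) (weight z0) < 1"
    unfolding continuous_at_eps_delta by (metis zero_less_one)
  obtain e where e: "e > 0" "ball z0 e \<subseteq> shearlet_group"
    using assms open_shearlet_group open_contains_ball by blast
  have "z \<in> shearlet_group \<and> weight z \<le> weight z0 + 1" if "z \<in> ball z0 (min d e)" for z
  proof -
    have "dist z z0 < d" "z \<in> ball z0 e" using that by (auto simp: dist_commute)
    then show ?thesis using d(2)[of z] e(2) by (auto simp: dist_real_def)
  qed
  then show thesis using d(1) e(1) that[of "min d e"] by auto
qed

text \<open>The weight is bounded near \<open>z0\<close>, which turns the polynomial bound on the
  derivative into one constant valid for all x.\<close>

lemma kernel_lipschitz_z:
  assumes k: "k \<in> kernels" and z0: "z0 \<in> shearlet_group"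
  obtains M r where "M \<ge> 0" "r > 0" "ball z0 r \<subseteq> shearlet_group"
    "\<And>z z' x. z \<in> ball z0 r \<Longrightarrow> z' \<in> ball z0 r \<Longrightarrow> jbracket x ^ N * norm (k (z, x) - k (z', x)) \<le> M * norm (z - z')"
proof -
  obtain C n where C: "0 \<le> C" "\<And>z x h. z \<in> shearlet_group \<Longrightarrow> jbracket x ^ N * norm (kd k h (z, x)) \<le> C * weight z ^ n * norm h"
    using kd_bound[OF k, of N] by blast
  obtain r where r: "r > 0" "\<And>z. z \<in> ball z0 r \<Longrightarrow> z \<in> shearlet_group \<and> weight z \<le> weight z0 + 1"
    using weight_locally_bounded[OF z0] by blast
  let ?M = "C * (weight z0 + 1) ^ n"
  have "jbracket x ^ N * norm (k (z, x) - k (z', x)) \<le> ?M * norm (z - z')" if z: "z \<in> ball z0 r" "z' \<in> ball z0 r" for z z' x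
  proof -
    have J: "jbracket x ^ N > 0" by (simp add: jbracket_pos)
    have "norm (k (z, x) - k (z', x)) \<le> (?M / jbracket x ^ N) * norm ((z, x) - (z', x))"
    \<comment> \<open>The segment keeps x fixed, so the decay factor in x is constant along
      it.\<close>
    proof (rule kernel_lipschitz_segment[OF k, of "ball z0 r \<times> {x}"])
      fix p assume p: "p \<in> ball z0 r \<times> {x}"
      then obtain y where y: "p = (y, x)" "y \<in> ball z0 r" by auto
      let ?h = "(z, x) - (z', x)"
      have "jbracket x ^ N * norm (kd k ?h (y, x)) \<le> C * weight y ^ n * norm ?h"
        using C(2) r(2)[OF y(2)] by blast
      also have "\<dots> \<le> C * (weight z0 + 1) ^ n * norm ?h"
        using r(2)[OF y(2)] C(1) by (intro mult_right_mono mult_left_mono power_mono) (auto simp: weight_nonneg)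
      finally show "norm (kd k ?h p) \<le> (?M / jbracket x ^ N) * norm ?h"
        using J by (simp add: y field_simps)
    qed (use z r in \<open>auto intro: convex_Times\<close>)
    then show ?thesis using J by (simp add: norm_Pair field_simps)
  qed
  moreover have "ball z0 r \<subseteq> shearlet_group" using r(2) by blast
  ultimately show thesis
    using C(1) r(1) weight_nonneg[of z0] by (intro that[of ?M r]) simp_all
qed

lemma kernel_taylor_z:
  assumes k: "k \<in> kernels" and z0: "z0 \<in> shearlet_group"
  obtains M r where "M \<ge> 0" "r > 0"
    "\<And>t x. \<bar>t\<bar> < r \<Longrightarrow> z0 + t *\<^sub>R v \<in> shearlet_group \<and>
      jbracket x ^ N * norm (k (z0 + t *\<^sub>R v, x) - k (z0, x) - t *\<^sub>R kd k (v, 0) (z0, x)) \<le> M * t\<^sup>2"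
proof -
  obtain M r where M: "M \<ge> 0" "r > 0" "ball z0 r \<subseteq> shearlet_group"
    "\<And>z z' x. z \<in> ball z0 r \<Longrightarrow> z' \<in> ball z0 r \<Longrightarrow>
      jbracket x ^ N * norm (kd k (v, 0) (z, x) - kd k (v, 0) (z', x)) \<le> M * norm (z - z')"
    using kernel_lipschitz_z[OF kd_kernel[OF k, of "(v, 0)"] z0, of N] by blast
  \<comment> \<open>The radius keeps \<open>z0 + u *\<^sub>R v\<close> in the ball; the 1 in the
    denominator covers v = 0.\<close>
  define e where "e = r / (norm v + 1)"
  have n: "norm v + 1 > 0" by (smt (verit) norm_ge_zero)
  have e: "e > 0" using M n by (simp add: e_def)
  have ball: "z0 + u *\<^sub>R v \<in> ball z0 r" if "\<bar>u\<bar> < e" for u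
  proof -
    have "\<bar>u\<bar> * norm v \<le> \<bar>u\<bar> * (norm v + 1)" by (intro mult_left_mono) auto
    also have "\<dots> < r" using that n by (simp add: e_def field_simps)
    finally show ?thesis by (simp add: dist_norm)
  qed
  have "z0 + t *\<^sub>R v \<in> shearlet_group \<and>
      jbracket x ^ N * norm (k (z0 + t *\<^sub>R v, x) - k (z0, x) - t *\<^sub>R kd k (v, 0) (z0, x)) \<le> M * norm v * t\<^sup>2"
    if t: "\<bar>t\<bar> < e" for t x
  proof
    show "z0 + t *\<^sub>R v \<in> shearlet_group" using ball[OF t] M by auto
    have J: "jbracket x ^ N > 0" by (simp add: jbracket_pos)
    have "norm (k ((z0, x) + t *\<^sub>R (v, 0)) - k ((z0, x) + 0 *\<^sub>R (v, 0)) -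
        t *\<^sub>R kd k (v, 0) ((z0, x) + 0 *\<^sub>R (v, 0))) \<le> (M * norm v / jbracket x ^ N) * t\<^sup>2"
    proof (rule taylor_line[where g = "\<lambda>u. k ((z0, x) + u *\<^sub>R (v, 0))" and g' = "\<lambda>u. kd k (v, 0) ((z0, x) + u *\<^sub>R (v, 0))"])
      fix u assume "\<bar>u\<bar> \<le> \<bar>t\<bar>"
      then have u: "\<bar>u\<bar> < e" using t by simp
      show "((\<lambda>u. k ((z0, x) + u *\<^sub>R (v, 0))) has_vector_derivative kd k (v, 0) ((z0, x) + u *\<^sub>R (v, 0))) (at u)"
        using ball[OF u] M by (intro kernel_has_vector_derivative k) auto
      show "norm (kd k (v, 0) ((z0, x) + u *\<^sub>R (v, 0)) - kd k (v, 0) ((z0, x) + 0 *\<^sub>R (v, 0))) \<le>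
          M * norm v / jbracket x ^ N * \<bar>u\<bar>"
        using M(4)[OF ball[OF u], of z0 x] M(2) J by (simp add: field_simps)
    qed (use M J in auto)
    then show "jbracket x ^ N * norm (k (z0 + t *\<^sub>R v, x) - k (z0, x) - t *\<^sub>R kd k (v, 0) (z0, x)) \<le> M * norm v * t\<^sup>2"
      using J by (simp add: field_simps)
  qed
  then show thesis using that[of "M * norm v" e] M(1) e by auto
qed

text \<open>The segments move in x alone, where the group imposes no restriction; the estimate is
  therefore global, with a constant polynomial in the weight.\<close>

lemma kernel_lipschitz_x:
  assumes k: "k \<in> kernels"
  obtains C n where "0 \<le> C" "\<And>z x y. z \<in> shearlet_group \<Longrightarrow> norm (k (z, x) - k (z, y)) \<le> C * weight z ^ n * norm (x - y)"
proof -
  obtain C n where C: "0 \<le> C" "\<And>z x h. z \<in> shearlet_group \<Longrightarrow> jbracket x ^ 0 * norm (kd k h (z, x)) \<le> C * weight z ^ n * norm h"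
    using kd_bound[OF k, of 0] by blast
  have "norm (k (z, x) - k (z, y)) \<le> C * weight z ^ n * norm (x - y)" if z: "z \<in> shearlet_group" for z x y
  proof -
    have "norm (k (z, x) - k (z, y)) \<le> C * weight z ^ n * norm ((z, x) - (z, y))"
    proof (rule kernel_lipschitz_segment[OF k, of "{z} \<times> UNIV"])
      fix p :: "shear_point \<times> (real^2)" assume "p \<in> {z} \<times> UNIV"
      then obtain u where "p = (z, u)" by blast
      then show "norm (kd k ((z, x) - (z, y)) p) \<le> C * weight z ^ n * norm ((z, x) - (z, y))"
        using C(2)[OF z, of u "(z, x) - (z, y)"] by (simp only: power_0 mult_1_left)
    qed (use z in \<open>auto intro: convex_Times\<close>)
    then show ?thesis by (simp add: norm_Pair)
  qed
  then show thesis using that C(1) by blast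
qed

text \<open>Global counterpart in x of the local expansion in z; the polynomial dependence on the
  weight allows the remainder to be integrated over z.\<close>

lemma kernel_taylor_x:
  assumes k: "k \<in> kernels"
  obtains C n where "0 \<le> C" "\<And>z x t. z \<in> shearlet_group \<Longrightarrow>
    norm (k (z, x + t *\<^sub>R v) - k (z, x) - t *\<^sub>R kd k (0, v) (z, x)) \<le> C * weight z ^ n * t\<^sup>2"
proof -
  obtain C n where C: "0 \<le> C" "\<And>z x y. z \<in> shearlet_group \<Longrightarrow>
      norm (kd k (0, v) (z, x) - kd k (0, v) (z, y)) \<le> C * weight z ^ n * norm (x - y)"
    using kernel_lipschitz_x[OF kd_kernel[OF k, of "(0, v)"]] by blast
  have "norm (k (z, x + t *\<^sub>R v) - k (z, x) - t *\<^sub>R kd k (0, v) (z, x)) \<le> (C * norm v) * weight z ^ n * t\<^sup>2"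
    if z: "z \<in> shearlet_group" for z x t
  proof -
    have "norm (k ((z, x) + t *\<^sub>R (0, v)) - k ((z, x) + 0 *\<^sub>R (0, v)) -
        t *\<^sub>R kd k (0, v) ((z, x) + 0 *\<^sub>R (0, v))) \<le> (C * norm v * weight z ^ n) * t\<^sup>2"
    proof (rule taylor_line[where g = "\<lambda>u. k ((z, x) + u *\<^sub>R (0, v))" and g' = "\<lambda>u. kd k (0, v) ((z, x) + u *\<^sub>R (0, v))"])
      fix u
      show "((\<lambda>u. k ((z, x) + u *\<^sub>R (0, v))) has_vector_derivative kd k (0, v) ((z, x) + u *\<^sub>R (0, v))) (at u)"
        using z by (intro kernel_has_vector_derivative k) auto
      show "norm (kd k (0, v) ((z, x) + u *\<^sub>R (0, v)) - kd k (0, v) ((z, x) + 0 *\<^sub>R (0, v))) \<le>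
          C * norm v * weight z ^ n * \<bar>u\<bar>"
        using C(2)[OF z, of "x + u *\<^sub>R v" x] by (simp add: mult_ac)
    qed (use C weight_nonneg[of z] in auto)
    then show ?thesis by simp
  qed
  then show thesis using that[of "C * norm v" n] C(1) by auto
qed

section \<open>Sections of kernels at a fixed point of the group\<close>

lemma kernel_section_has_vector_derivative:
  assumes "k \<in> kernels" "z \<in> shearlet_group"
  shows "((\<lambda>t. k (z, x + t *\<^sub>R v)) has_vector_derivative kd k (0, v) (z, x)) (at 0)"
  using kernel_has_vector_derivative[OF assms(1), of "(z, x)" 0 "(0, v)"] assms(2) by simp

lemma kernel_section_schwartz:
  assumes k: "k \<in> kernels" and z: "z \<in> shearlet_group"
  shows "(\<lambda>x. k (z, x)) \<in> schwartz_space"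
proof (rule schwartz_coinduct[where P = "\<lambda>g. \<exists>k\<in>kernels. g = (\<lambda>x. k (z, x))"])
  fix g assume "\<exists>k\<in>kernels. g = (\<lambda>x. k (z, x))"
  then obtain k where k: "k \<in> kernels" "g = (\<lambda>x. k (z, x))" by auto
  show "continuous_on UNIV g"
  proof -
    have "isCont (\<lambda>x. k (z, x)) x" for x
    proof (rule continuous_within_compose3[where g = k and f = "\<lambda>x. (z, x)"])
      show "isCont k (z, x)"
        using kernel_has_derivative[OF k(1), of "(z, x)"] z
        by (auto simp: mem_shearlet_group intro: has_derivative_continuous)
    qed (auto intro!: continuous_intros)
    then show ?thesis
      by (simp add: k continuous_at_imp_continuous_on)
  qed
  show "\<exists>g'. (\<exists>k\<in>kernels. g' = (\<lambda>x. k (z, x))) \<and> (\<forall>x. line_deriv g x v (g' x))" for v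
    unfolding k(2) using kernel_section_has_vector_derivative[OF k(1) z] kd_kernel[OF k(1)] by blast
  show "\<exists>C. \<forall>x. jbracket x ^ N * norm (g x) \<le> C" for N
    unfolding k(2) using kernel_bound[OF k(1), of N] z by metis
qed (use k in auto)

text \<open>For fixed z all rules but the base one are additions or multiplications by constants. In
  the base case the moments vanish by the affine substitution, and integrability against monomials
  comes from the Schwartz property of the section.\<close>

lemma kernel_section_lizorkin:
  assumes "k \<in> kernels" and z: "z \<in> shearlet_group"
  shows "(\<lambda>x. k (z, x)) \<in> lizorkin_space"
  using assms(1)
proof (induction rule: kernels.induct)
  case (base \<eta>)
  let ?a = "snd (snd z)" and ?s = "fst (snd z)" and ?b = "fst z"
  have a: "?a \<noteq> 0" using z by (simp add: mem_shearlet_group)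
  note S = kernel_section_schwartz[OF kernels.base[OF base] z]
  show ?case
  proof (rule lizorkin_spaceI)
    show "(\<lambda>x. \<eta> (shear_arg (z, x))) \<in> schwartz_space" by (rule S)
    fix m1 m2
    show "(LINT x|lborel. of_real (x $ 1 ^ m1 * x $ 2 ^ m2) * \<eta> (shear_arg (z, x))) = 0"
      using lizorkin_affine_moment[OF base a, of "sgn ?a * \<bar>?a\<bar> powr (-1/2)" m1 m2 "?b $ 1" ?s "?b $ 2"]
        schwartz_integrable[OF schwartz_monomial[OF S, of m1 m2]] a
      by (simp add: shear_arg_def sgn_zero_iff)
  qed
next
  case (add k l)
  then show ?case by (intro lizorkin_add) auto
qed (auto intro: lizorkin_cmult)

text \<open>Plane derivatives carried out inside \<open>kernels\<close>, in the same order as in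
  \<open>pd\<close>, so that all estimates for kernels apply to them.\<close>

definition kpd :: "nat \<Rightarrow> nat \<Rightarrow> (shear_point \<times> (real^2) \<Rightarrow> complex) \<Rightarrow> shear_point \<times> (real^2) \<Rightarrow> complex" where
  "kpd m1 m2 k = ((\<lambda>k. kd k (0, e2)) ^^ m2) (((\<lambda>k. kd k (0, e1)) ^^ m1) k)"

lemma kd_pow_kernel: "k \<in> kernels \<Longrightarrow> ((\<lambda>k. kd k h) ^^ m) k \<in> kernels"
  by (induction m) (auto intro: kd_kernel)

lemma kpd_kernel: "k \<in> kernels \<Longrightarrow> kpd m1 m2 k \<in> kernels"
  unfolding kpd_def by (intro kd_pow_kernel)

lemma partial_pow_kernel:
  assumes "k \<in> kernels" "z \<in> shearlet_group"
  shows "(partial v ^^ m) (\<lambda>x. k (z, x)) = (\<lambda>x. ((\<lambda>k. kd k (0, v)) ^^ m) k (z, x))"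
proof (induction m)
  case (Suc m)
  then show ?case
    using kernel_section_has_vector_derivative[OF kd_pow_kernel[OF assms(1)] assms(2)]
    by (simp add: partial_def vector_derivative_at fun_eq_iff)
qed simp

lemma pd_kernel:
  assumes "k \<in> kernels" "z \<in> shearlet_group"
  shows "pd m1 m2 (\<lambda>x. k (z, x)) = (\<lambda>x. kpd m1 m2 k (z, x))"
  unfolding pd_def kpd_def
  using assms by (simp add: partial_pow_kernel kd_pow_kernel)

section \<open>Superpositions of kernels\<close>

text \<open>Measurability in place of continuity makes the class stable under cutting off to Borel
  sets, as the covering argument requires; vanishing off the group hides the values of kernel
  derivatives at a = 0.\<close>

definition rapid :: "(shear_point \<Rightarrow> complex) set" where
  "rapid = {G. G \<in> borel_measurable borel \<and> (\<forall>z. z \<notin> shearlet_group \<longrightarrow> G z = 0) \<and>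
     (\<forall>n. \<exists>C. \<forall>z. weight z ^ n * norm (G z) \<le> C)}"

definition synth :: "(shear_point \<times> (real^2) \<Rightarrow> complex) \<Rightarrow> (shear_point \<Rightarrow> complex) \<Rightarrow> real^2 \<Rightarrow> complex" where
  "synth k G x = (LINT z|lborel. G z * k (z, x))"

definition mass :: "nat \<Rightarrow> (shear_point \<Rightarrow> complex) \<Rightarrow> real" where
  "mass n G = (LINT z|lborel. weight z ^ n * norm (G z))"

lemma Basis_shear_point: "(Basis :: shear_point set) = {(e1, 0, 0), (e2, 0, 0), (0, 1, 0), (0, 0, 1)}"
  by (simp add: Basis_prod_def Basis_plane zero_prod_def image_Un insert_commute)

text \<open>Two powers of the weight buy integrability: the squared brackets are factors of the
  product, and (|a| + 1/|a|)^2 = a^2 + 2 + 1/a^2 exceeds 1 + a^2.\<close>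

lemma weight_decay:
  assumes z: "z \<in> shearlet_group"
  shows "inverse (weight z ^ 2) \<le> (\<Prod>b\<in>Basis. inverse (1 + (z \<bullet> b)\<^sup>2))"
proof -
  let ?a = "snd (snd z)"
  have a: "?a \<noteq> 0" using z by (simp add: mem_shearlet_group)
  have "1 + ?a\<^sup>2 \<le> ?a\<^sup>2 + 2 + (1 / ?a)\<^sup>2" by simp
  also have "\<dots> = (\<bar>?a\<bar> + 1 / \<bar>?a\<bar>)^2" using a by (simp add: power2_eq_square field_simps)
  finally have le: "1 + ?a\<^sup>2 \<le> (\<bar>?a\<bar> + 1 / \<bar>?a\<bar>)^2" .
  have sq: "jbracket t ^ 2 = 1 + t^2" for t :: real by (simp add: jbracket_def)
  define P where "P = (1 + (fst z $ 1)\<^sup>2) * (1 + (fst z $ 2)\<^sup>2) * (1 + (fst (snd z))\<^sup>2) * (1 + ?a\<^sup>2)"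
  have "P \<le> (1 + (fst z $ 1)\<^sup>2) * (1 + (fst z $ 2)\<^sup>2) * (1 + (fst (snd z))\<^sup>2) * (\<bar>?a\<bar> + 1 / \<bar>?a\<bar>)^2"
    unfolding P_def using le by (intro mult_left_mono) auto
  also have "\<dots> = weight z ^ 2"
    by (simp add: weight_def power_mult_distrib sq)
  finally have "P \<le> weight z ^ 2" .
  moreover have "P > 0"
    unfolding P_def by (intro mult_pos_pos) (auto simp: add_pos_nonneg)
  ultimately have "inverse (weight z ^ 2) \<le> inverse P"
    by (intro le_imp_inverse_le)
  also have "\<dots> = (\<Prod>b\<in>Basis. inverse (1 + (z \<bullet> b)\<^sup>2))"
    by (simp add: P_def Basis_shear_point e1_neq_e2 inner_prod_def inner_axis mult_ac)
  finally show ?thesis .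
qed

lemma weight_measurable [measurable]: "weight \<in> borel_measurable borel"
proof -
  have [measurable]: "(\<lambda>z :: shear_point. fst z $ i) \<in> borel_measurable borel" for i
    by (intro borel_measurable_continuous_onI continuous_intros)
  have [measurable]: "(\<lambda>z :: shear_point. fst (snd z)) \<in> borel_measurable borel"
    "(\<lambda>z :: shear_point. snd (snd z)) \<in> borel_measurable borel"
    by (intro borel_measurable_continuous_onI continuous_intros)+
  show ?thesis
    unfolding weight_def [abs_def] jbracket_def by measurable
qed

lemma rapid_measurable: "G \<in> rapid \<Longrightarrow> G \<in> borel_measurable borel"
  by (simp add: rapid_def)

lemma rapid_outside: "G \<in> rapid \<Longrightarrow> z \<notin> shearlet_group \<Longrightarrow> G z = 0"
  unfolding rapid_def by blast

lemma integrable_weight_rapid_aux: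
  assumes G: "G \<in> borel_measurable borel" "\<And>z. z \<notin> shearlet_group \<Longrightarrow> G z = 0"
    and C: "\<And>z. z \<in> shearlet_group \<Longrightarrow> weight z ^ (n + 2) * norm (G z) \<le> C"
  shows "integrable lborel (\<lambda>z. weight z ^ n * norm (G z))"
    and "mass n G \<le> C * (LINT z|(lborel :: shear_point measure). (\<Prod>b\<in>Basis. inverse (1 + (z \<bullet> b)\<^sup>2)))"
proof -
  let ?P = "\<lambda>z :: shear_point. \<Prod>b\<in>Basis. inverse (1 + (z \<bullet> b)\<^sup>2)"
  \<comment> \<open>Evaluating the bound at some point of the group shows that C is
    nonnegative.\<close>
  have "(0, 0, 1) \<in> shearlet_group" by (simp add: mem_shearlet_group)
  from C[OF this] have C0: "0 \<le> C"
    by (meson mult_nonneg_nonneg norm_ge_zero order_trans weight_nonneg zero_le_power)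
  have P: "0 \<le> ?P z" for z by (intro prod_nonneg) auto
  have le: "weight z ^ n * norm (G z) \<le> C * ?P z" for z
  proof (cases "z \<in> shearlet_group")
    case True
    have w: "weight z > 0" using weight_ge_1[OF True] by linarith
    have "weight z ^ n * norm (G z) = (weight z ^ (n + 2) * norm (G z)) * inverse (weight z ^ 2)"
      using w by (simp add: power_add field_simps power2_eq_square)
    also have "\<dots> \<le> C * ?P z"
      using C[OF True] weight_decay[OF True] C0 by (intro mult_mono) auto
    finally show ?thesis .
  next
    case False
    then show ?thesis using G(2) C0 P by simp
  qed
  have PI: "integrable lborel (\<lambda>z. C * ?P z)"
    by (intro integrable_mult_right integrable_prod_inverse_square)
  show int: "integrable lborel (\<lambda>z. weight z ^ n * norm (G z))"
  proof (rule Bochner_Integration.integrable_bound[OF PI])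
    show "(\<lambda>z. weight z ^ n * norm (G z)) \<in> borel_measurable lborel"
      using G(1) by simp
    show "AE z in lborel. norm (weight z ^ n * norm (G z)) \<le> norm (C * ?P z)"
      using le by (intro AE_I2) (smt (verit) mult_nonneg_nonneg norm_ge_zero real_norm_def weight_nonneg zero_le_power)
  qed
  have "mass n G \<le> (LINT z|lborel. C * ?P z)"
    unfolding mass_def by (rule integral_mono[OF int PI le])
  then show "mass n G \<le> C * integral\<^sup>L lborel ?P" by simp
qed

lemma integrable_weight_rapid:
  assumes "G \<in> rapid"
  shows "integrable lborel (\<lambda>z. weight z ^ n * norm (G z))"
proof -
  obtain C where C: "\<And>z. weight z ^ (n + 2) * norm (G z) \<le> C"
    using assms unfolding rapid_def by blast
  show ?thesis
    by (rule integrable_weight_rapid_aux(1)[OF rapid_measurable[OF assms] rapid_outside[OF assms] C])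
qed

lemma mass_nonneg: "0 \<le> mass n G"
  unfolding mass_def by (intro integral_nonneg_AE AE_I2) (simp add: weight_nonneg)

lemma
  fixes h :: "shear_point \<Rightarrow> complex"
  assumes G: "G \<in> rapid" and m: "(\<lambda>z. G z * h z) \<in> borel_measurable borel"
    and h: "\<And>z. z \<in> shearlet_group \<Longrightarrow> norm (h z) \<le> C * weight z ^ n"
  shows integrable_rapid_mult: "integrable lborel (\<lambda>z. G z * h z)"
    and norm_integral_rapid_mult: "norm (LINT z|lborel. G z * h z) \<le> C * mass n G"
proof -
  have le: "norm (G z * h z) \<le> C * (weight z ^ n * norm (G z))" for z
  proof (cases "z \<in> shearlet_group")
    case True
    have "norm (G z * h z) \<le> norm (G z) * (C * weight z ^ n)"
      unfolding norm_mult by (intro mult_left_mono h True) auto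
    then show ?thesis by (simp add: mult_ac)
  next
    case False
    then show ?thesis using rapid_outside[OF G] by simp
  qed
  have I: "integrable lborel (\<lambda>z. C * (weight z ^ n * norm (G z)))"
    by (intro integrable_mult_right integrable_weight_rapid G)
  show int: "integrable lborel (\<lambda>z. G z * h z)"
  proof (rule Bochner_Integration.integrable_bound[OF I])
    show "(\<lambda>z. G z * h z) \<in> borel_measurable lborel" using m by simp
    show "AE z in lborel. norm (G z * h z) \<le> norm (C * (weight z ^ n * norm (G z)))"
      using le by (intro AE_I2) (metis abs_ge_self order_trans real_norm_def)
  qed
  have "norm (LINT z|lborel. G z * h z) \<le> (LINT z|lborel. norm (G z * h z))"
    by (rule integral_norm_bound)
  also have "\<dots> \<le> (LINT z|lborel. C * (weight z ^ n * norm (G z)))"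
    by (rule integral_mono[OF integrable_norm[OF int] I le])
  finally show "norm (LINT z|lborel. G z * h z) \<le> C * mass n G"
    by (simp add: mass_def)
qed

text \<open>Continuity of \<open>k\<close> is known only over the group; the factor G, zero
  elsewhere, replaces \<open>k\<close> by its restriction to an open set.\<close>

lemma kernel_measurable:
  assumes G: "G \<in> rapid" and k: "k \<in> kernels"
  shows "(\<lambda>p. G (fst p) * k p) \<in> borel_measurable borel"
proof -
  let ?U = "shearlet_group \<times> (UNIV :: (real^2) set)"
  have "isCont k p" if "p \<in> ?U" for p
    using kernel_has_derivative[OF k, of p] that
    by (auto simp: mem_shearlet_group intro: has_derivative_continuous)
  then have "continuous_on ?U k"
    by (simp add: continuous_at_imp_continuous_on)
  moreover have "?U \<in> sets borel"
    by (intro borel_open open_Times open_shearlet_group open_UNIV)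
  ultimately have m: "(\<lambda>p. indicator ?U p *\<^sub>R k p) \<in> borel_measurable borel"
    by (intro borel_measurable_continuous_on_indicator)
  have "(\<lambda>p. G (fst p) * k p) = (\<lambda>p. G (fst p) * (indicator ?U p *\<^sub>R k p))"
    using rapid_outside[OF G] by (force simp: fun_eq_iff indicator_def)
  moreover have "(\<lambda>p. G (fst p)) \<in> borel_measurable (borel :: (shear_point \<times> (real^2)) measure)"
    by (rule measurable_compose[OF _ rapid_measurable[OF G]]) (intro borel_measurable_continuous_onI continuous_intros)
  ultimately show ?thesis
    using borel_measurable_times[OF _ m, of "\<lambda>p. G (fst p)"] by simp
qed

lemma kernel_section_measurable:
  assumes "G \<in> rapid" "k \<in> kernels"
  shows "(\<lambda>z. G z * k (z, x)) \<in> borel_measurable borel"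
proof -
  have "(\<lambda>z. (z, x)) \<in> borel \<rightarrow>\<^sub>M borel"
    by (intro borel_measurable_continuous_onI continuous_intros)
  from measurable_compose[OF this kernel_measurable[OF assms]] show ?thesis by simp
qed

lemma synth_integrable:
  assumes G: "G \<in> rapid" and k: "k \<in> kernels"
  shows "integrable lborel (\<lambda>z. G z * k (z, x))"
proof -
  obtain C n where "\<And>z x. z \<in> shearlet_group \<Longrightarrow> jbracket x ^ 0 * norm (k (z, x)) \<le> C * weight z ^ n"
    using kernel_bound[OF k, of 0] by metis
  then show ?thesis
    using G k by (intro integrable_rapid_mult kernel_section_measurable) auto
qed

text \<open>The form in which Taylor remainders are consumed, for superpositions and for pairings
  alike.\<close>

lemma has_vector_derivative_quadratic:
  fixes g :: "real \<Rightarrow> complex"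
  assumes r: "0 < r" and b: "\<And>t. \<bar>t\<bar> < r \<Longrightarrow> norm (g t - g 0 - t *\<^sub>R d) \<le> M * t\<^sup>2"
  shows "(g has_vector_derivative d) (at 0)"
proof -
  have "((\<lambda>t. norm (g t - g 0 - t *\<^sub>R d) / norm t) \<longlongrightarrow> 0) (at 0)"
  proof (rule Lim_null_comparison)
    have "eventually (\<lambda>t::real. t \<noteq> 0 \<and> dist t 0 < r) (at 0)"
      using r by (auto simp: eventually_at)
    then show "eventually (\<lambda>t. norm (norm (g t - g 0 - t *\<^sub>R d) / norm t) \<le> M * \<bar>t\<bar>) (at 0)"
    proof eventually_elim
      case (elim t)
      have "norm (g t - g 0 - t *\<^sub>R d) \<le> M * \<bar>t\<bar> * \<bar>t\<bar>"
        using b[of t] elim by (simp add: power2_eq_square mult.assoc)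
      then show ?case using elim by (simp add: divide_le_eq)
    qed
    show "((\<lambda>t::real. M * \<bar>t\<bar>) \<longlongrightarrow> 0) (at 0)"
      by (auto intro!: tendsto_eq_intros)
  qed
  then show ?thesis
    by (simp add: has_vector_derivative_def has_derivative_at bounded_linear_scaleR_left)
qed

text \<open>Differentiation under the integral: the Taylor remainder of the kernel is quadratic in t
  with a constant polynomial in the weight, so its integral against G is at most
  \<open>C * mass n G * t\<^sup>2\<close>.\<close>

lemma synth_has_vector_derivative:
  assumes G: "G \<in> rapid" and k: "k \<in> kernels"
  shows "line_deriv (synth k G) x v (synth (kd k (0, v)) G x)"
proof -
  obtain C n where C: "\<And>z x t. z \<in> shearlet_group \<Longrightarrow>
      norm (k (z, x + t *\<^sub>R v) - k (z, x) - t *\<^sub>R kd k (0, v) (z, x)) \<le> C * weight z ^ n * t\<^sup>2"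
    using kernel_taylor_x[OF k, of v] by metis
  note i = synth_integrable[OF G k] synth_integrable[OF G kd_kernel[OF k]]
  note m = kernel_section_measurable[OF G k] kernel_section_measurable[OF G kd_kernel[OF k]]
  have "norm (synth k G (x + t *\<^sub>R v) - synth k G x - t *\<^sub>R synth (kd k (0, v)) G x) \<le> (C * mass n G) * t\<^sup>2" for t
  proof -
    let ?h = "\<lambda>z. k (z, x + t *\<^sub>R v) - k (z, x) - t *\<^sub>R kd k (0, v) (z, x)"
    have eq: "(\<lambda>z. G z * ?h z) = (\<lambda>z. G z * k (z, x + t *\<^sub>R v) - G z * k (z, x) - t *\<^sub>R (G z * kd k (0, v) (z, x)))"
      by (simp add: fun_eq_iff algebra_simps)
    have "synth k G (x + t *\<^sub>R v) - synth k G x - t *\<^sub>R synth (kd k (0, v)) G x = (LINT z|lborel. G z * ?h z)"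
      unfolding eq synth_def using i by simp
    moreover have "norm (LINT z|lborel. G z * ?h z) \<le> (C * t\<^sup>2) * mass n G"
    proof (rule norm_integral_rapid_mult[OF G])
      show "(\<lambda>z. G z * ?h z) \<in> borel_measurable borel"
        unfolding eq using m by (intro borel_measurable_diff borel_measurable_scaleR) auto
      show "norm (?h z) \<le> (C * t\<^sup>2) * weight z ^ n" if "z \<in> shearlet_group" for z
        using C[OF that, of x t] by (simp add: mult_ac)
    qed
    ultimately show ?thesis by (simp add: mult_ac)
  qed
  then show ?thesis
    by (intro has_vector_derivative_quadratic[of 1]) auto
qed

lemma synth_bound:
  assumes k: "k \<in> kernels"
  obtains C n where "0 \<le> C" "\<And>G x. G \<in> rapid \<Longrightarrow> jbracket x ^ N * norm (synth k G x) \<le> C * mass n G"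
proof -
  obtain C n where C: "0 \<le> C" "\<And>z x. z \<in> shearlet_group \<Longrightarrow> jbracket x ^ N * norm (k (z, x)) \<le> C * weight z ^ n"
    using kernel_bound[OF k, of N] by metis
  have "jbracket x ^ N * norm (synth k G x) \<le> C * mass n G" if G: "G \<in> rapid" for G x
  proof -
    have "norm (synth k G x) \<le> C * inverse (jbracket x ^ N) * mass n G"
      unfolding synth_def
      using le_inverse_jbracketI[OF C(2)]
      by (intro norm_integral_rapid_mult[OF G] kernel_section_measurable G k) (simp add: mult_ac)
    then show ?thesis
      using jbracket_pos[of x] by (simp add: field_simps)
  qed
  then show thesis using that C(1) by blast
qed

lemma synth_schwartz:
  assumes G: "G \<in> rapid" and k: "k \<in> kernels"
  shows "synth k G \<in> schwartz_space"
proof (rule schwartz_coinduct[where P = "\<lambda>g. \<exists>k\<in>kernels. g = synth k G"])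
  fix g assume "\<exists>k\<in>kernels. g = synth k G"
  then obtain k where k: "k \<in> kernels" "g = synth k G" by auto
  show "continuous_on UNIV g"
  proof -
    obtain C n where C: "0 \<le> C" "\<And>z x y. z \<in> shearlet_group \<Longrightarrow> norm (k (z, x) - k (z, y)) \<le> C * weight z ^ n * norm (x - y)"
      using kernel_lipschitz_x[OF k(1)] by metis
    have "dist (g x) (g y) \<le> (C * mass n G) * dist x y" for x y
    proof -
      have eq: "(\<lambda>z. G z * (k (z, x) - k (z, y))) = (\<lambda>z. G z * k (z, x) - G z * k (z, y))"
        by (simp add: fun_eq_iff algebra_simps)
      have "g x - g y = (LINT z|lborel. G z * (k (z, x) - k (z, y)))"
        unfolding k(2) synth_def eq using synth_integrable[OF G k(1)] by simp
      moreover have "norm (LINT z|lborel. G z * (k (z, x) - k (z, y))) \<le> (C * norm (x - y)) * mass n G"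
      proof (rule norm_integral_rapid_mult[OF G])
        show "(\<lambda>z. G z * (k (z, x) - k (z, y))) \<in> borel_measurable borel"
          unfolding eq by (intro borel_measurable_diff kernel_section_measurable G k)
        show "norm (k (z, x) - k (z, y)) \<le> (C * norm (x - y)) * weight z ^ n" if "z \<in> shearlet_group" for z
          using C(2)[OF that, of x y] by (simp add: mult_ac)
      qed
      ultimately show ?thesis by (simp add: dist_norm mult_ac)
    qed
    then have "(C * mass n G)-lipschitz_on UNIV g"
      using C(1) mass_nonneg by (intro lipschitz_onI) auto
    then show ?thesis by (rule lipschitz_on_continuous_on)
  qed
  show "\<exists>g'. (\<exists>k\<in>kernels. g' = synth k G) \<and> (\<forall>x. line_deriv g x v (g' x))" for v
    unfolding k(2) using synth_has_vector_derivative[OF G k(1)] kd_kernel[OF k(1)] by blast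
  show "\<exists>C. \<forall>x. jbracket x ^ N * norm (g x) \<le> C" for N
    unfolding k(2) using synth_bound[OF k(1), of N] G by metis
qed (use k in auto)

lemma integrable_product:
  fixes u :: "shear_point \<Rightarrow> real" and v :: "real^2 \<Rightarrow> real"
  assumes u: "integrable lborel u" and v: "integrable lborel v"
  shows "integrable (lborel \<Otimes>\<^sub>M lborel) (\<lambda>p. u (fst p) * v (snd p))"
proof (rule lborel_pair.Fubini_integrable)
  show "(\<lambda>p. u (fst p) * v (snd p)) \<in> borel_measurable (lborel \<Otimes>\<^sub>M lborel)"
    using u v by simp
  show "integrable lborel (\<lambda>z. LINT x|lborel. norm (u (fst (z, x)) * v (snd (z, x))))"
    using u v by (simp add: abs_mult)
qed (use v in simp)

text \<open>By Fubini the moments pass to the sections of the kernel, where they vanish.\<close>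

lemma synth_lizorkin:
  assumes G: "G \<in> rapid" and k: "k \<in> kernels"
  shows "synth k G \<in> lizorkin_space"
proof (rule lizorkin_spaceI[OF synth_schwartz[OF G k]])
  fix m1 m2
  let ?M = "\<lambda>x :: real^2. complex_of_real (x $ 1 ^ m1 * x $ 2 ^ m2)"
  \<comment> \<open>The first m1 + m2 brackets pay for the monomial, the remaining 4 for
    integrability over the plane.\<close>
  obtain C n where C: "0 \<le> C" "\<And>z x. z \<in> shearlet_group \<Longrightarrow> jbracket x ^ (m1 + m2 + 4) * norm (k (z, x)) \<le> C * weight z ^ n"
    using kernel_bound[OF k, of "m1 + m2 + 4"] by metis
  have bound: "norm (?M x * (G z * k (z, x))) \<le> (C * (weight z ^ n * norm (G z))) * inverse (jbracket x ^ 4)" for z x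
  proof (cases "z \<in> shearlet_group")
    case True
    have "norm (?M x) = \<bar>x $ 1\<bar> ^ m1 * \<bar>x $ 2\<bar> ^ m2"
      by (simp add: norm_mult norm_power)
    also have "\<dots> \<le> jbracket x ^ m1 * jbracket x ^ m2"
      by (intro mult_mono power_mono component_le_jbracket) (auto simp: jbracket_pos less_imp_le)
    finally have "norm (?M x) \<le> jbracket x ^ (m1 + m2)" by (simp add: power_add)
    then have "norm (?M x) * norm (k (z, x)) \<le> jbracket x ^ (m1 + m2) * norm (k (z, x))"
      by (rule mult_right_mono) simp
    then have "jbracket x ^ 4 * (norm (?M x) * norm (k (z, x))) \<le> jbracket x ^ 4 * (jbracket x ^ (m1 + m2) * norm (k (z, x)))"
      by (rule mult_left_mono) (simp add: jbracket_pos less_imp_le)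
    also have "\<dots> \<le> C * weight z ^ n"
      using C(2)[OF True, of x] by (simp add: power_add mult_ac)
    finally have "norm (?M x) * norm (k (z, x)) \<le> C * weight z ^ n * inverse (jbracket x ^ 4)"
      by (rule le_inverse_jbracketI)
    from mult_left_mono[OF this norm_ge_zero[of "G z"]] show ?thesis
      by (simp add: norm_mult mult_ac)
  next
    case False
    then show ?thesis using rapid_outside[OF G] by simp
  qed
  have int: "integrable (lborel \<Otimes>\<^sub>M lborel) (\<lambda>(z, x). ?M x * (G z * k (z, x)))"
  proof (rule Bochner_Integration.integrable_bound)
    show "integrable (lborel \<Otimes>\<^sub>M lborel) (\<lambda>p :: shear_point \<times> (real^2). (C * (weight (fst p) ^ n * norm (G (fst p)))) * inverse (jbracket (snd p) ^ 4))"
      by (rule integrable_product[where u = "\<lambda>z. C * (weight z ^ n * norm (G z))" and v = "\<lambda>x. inverse (jbracket x ^ 4)"])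
        (intro integrable_mult_right integrable_weight_rapid G integrable_jbracket)+
    show "(\<lambda>(z, x). ?M x * (G z * k (z, x))) \<in> borel_measurable (lborel \<Otimes>\<^sub>M lborel)"
    proof -
      have "(\<lambda>p. ?M (snd p) * (G (fst p) * k p)) \<in> borel_measurable (borel :: (shear_point \<times> (real^2)) measure)"
        by (intro borel_measurable_times kernel_measurable G k borel_measurable_continuous_onI continuous_intros)
      then show ?thesis by (simp add: lborel_prod case_prod_unfold)
    qed
    show "AE p in lborel \<Otimes>\<^sub>M lborel. norm ((\<lambda>(z, x). ?M x * (G z * k (z, x))) p) \<le>
        norm ((C * (weight (fst p) ^ n * norm (G (fst p)))) * inverse (jbracket (snd p) ^ 4))"
      using bound by (intro AE_I2) (auto intro: order_trans[OF _ abs_ge_self])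
  qed
  have "(LINT x|lborel. ?M x * synth k G x) = (LINT x|lborel. LINT z|lborel. ?M x * (G z * k (z, x)))"
    unfolding synth_def by simp
  also have "\<dots> = (LINT z|lborel. LINT x|lborel. ?M x * (G z * k (z, x)))"
    by (rule lborel_pair.Fubini_integral[OF int])
  also have "\<dots> = (LINT z|(lborel :: shear_point measure). 0)"
  proof (rule Bochner_Integration.integral_cong[OF refl])
    fix z
    have "(LINT x|lborel. ?M x * (G z * k (z, x))) = G z * (LINT x|lborel. ?M x * k (z, x))"
      by (simp add: mult.left_commute)
    also have "\<dots> = 0"
      using lizorkin_moment[OF kernel_section_lizorkin[OF k], of z m1 m2] rapid_outside[OF G, of z]
      by (cases "z \<in> shearlet_group") auto
    finally show "(LINT x|lborel. ?M x * (G z * k (z, x))) = 0" .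
  qed
  finally show "(LINT x|lborel. ?M x * synth k G x) = 0" by simp
qed

lemma partial_pow_synth:
  assumes "G \<in> rapid" "k \<in> kernels"
  shows "(partial v ^^ m) (synth k G) = synth (((\<lambda>k. kd k (0, v)) ^^ m) k) G"
proof (induction m)
  case (Suc m)
  then show ?case
    using synth_has_vector_derivative[OF assms(1) kd_pow_kernel[OF assms(2)]]
    by (simp add: partial_def vector_derivative_at fun_eq_iff)
qed simp

lemma pd_synth:
  assumes "G \<in> rapid" "k \<in> kernels"
  shows "pd m1 m2 (synth k G) = synth (kpd m1 m2 k) G"
  unfolding pd_def kpd_def
  using assms by (simp add: partial_pow_synth kd_pow_kernel)

section \<open>The synthesis operator as a superposition\<close>

text \<open>What the integral representations draw from a test function: continuity for
  measurability, rapid decrease for convergence.\<close>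

definition decaying :: "(shear_point \<Rightarrow> complex) set" where
  "decaying = {\<Phi>. continuous_on shearlet_group \<Phi> \<and>
     (\<forall>n. \<exists>C. \<forall>z\<in>shearlet_group. weight z ^ n * norm (\<Phi> z) \<le> C)}"

text \<open>The density \<open>|a|\<^sup>-\<^sup>3\<close> of the measure on the group is absorbed into the function.\<close>

definition haar_lift :: "(shear_point \<Rightarrow> complex) \<Rightarrow> shear_point \<Rightarrow> complex" where
  "haar_lift \<Phi> z = indicator shearlet_group z *\<^sub>R (\<Phi> z * of_real (\<bar>snd (snd z)\<bar> powi (-3)))"

lemma norm_haar_lift:
  assumes "z \<in> shearlet_group"
  shows "norm (haar_lift \<Phi> z) \<le> weight z ^ 3 * norm (\<Phi> z)"
proof -
  let ?a = "\<bar>snd (snd z)\<bar>"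
  have a: "?a > 0" using assms by (simp add: mem_shearlet_group)
  have "?a powi (-3) = (1 / ?a) ^ 3"
    by (simp add: power_int_minus power_one_over inverse_eq_divide)
  also have "\<dots> \<le> weight z ^ 3"
    using abs_a_le_weight[OF assms] a by (intro power_mono) (smt (verit), simp)
  finally have "?a powi (-3) \<le> weight z ^ 3" .
  then have "norm (\<Phi> z) * (?a powi (-3)) \<le> norm (\<Phi> z) * weight z ^ 3"
    by (rule mult_left_mono) simp
  moreover have "norm (haar_lift \<Phi> z) = norm (\<Phi> z) * (?a powi (-3))"
  proof -
    have "norm (haar_lift \<Phi> z) = norm (\<Phi> z) * norm (complex_of_real (?a powi (-3)))"
      using assms by (simp add: haar_lift_def norm_mult del: of_real_power_int)
    then show ?thesis
      unfolding norm_of_real by simp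
  qed
  ultimately show ?thesis
    by (simp add: mult.commute)
qed

lemma haar_lift_rapid:
  assumes "\<Phi> \<in> decaying"
  shows "haar_lift \<Phi> \<in> rapid"
  unfolding rapid_def
proof (intro CollectI conjI allI impI)
  show "haar_lift \<Phi> \<in> borel_measurable borel"
    unfolding haar_lift_def [abs_def] power_int_minus
    using assms open_shearlet_group
    by (intro borel_measurable_continuous_on_indicator borel_open continuous_intros)
      (auto simp: decaying_def mem_shearlet_group intro!: continuous_intros)
  show "haar_lift \<Phi> z = 0" if "z \<notin> shearlet_group" for z
    using that by (simp add: haar_lift_def)
  fix n
  obtain C where C: "\<And>z. z \<in> shearlet_group \<Longrightarrow> weight z ^ (n + 3) * norm (\<Phi> z) \<le> C"
    using assms unfolding decaying_def by blast
  have "weight z ^ n * norm (haar_lift \<Phi> z) \<le> max C 0" for z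
  proof (cases "z \<in> shearlet_group")
    case True
    have "weight z ^ n * norm (haar_lift \<Phi> z) \<le> weight z ^ n * (weight z ^ 3 * norm (\<Phi> z))"
      by (intro mult_left_mono norm_haar_lift True) (simp add: weight_nonneg)
    also have "\<dots> \<le> C" using C[OF True] by (simp add: power_add mult_ac)
    finally show ?thesis by simp
  qed (simp add: haar_lift_def)
  then show "\<exists>C. \<forall>z. weight z ^ n * norm (haar_lift \<Phi> z) \<le> C" by blast
qed

text \<open>Of the five extra powers three pay for the density |a|^(-3) and two for integrability.
  The constant is independent of \<open>\<Phi>\<close>, as continuity in \<open>\<Phi>\<close>
  requires.\<close>

lemma mass_haar_lift:
  obtains c where "0 \<le> c"
    "\<And>\<Phi> B. \<Phi> \<in> decaying \<Longrightarrow> (\<And>z. z \<in> shearlet_group \<Longrightarrow> weight z ^ (n + 5) * norm (\<Phi> z) \<le> B) \<Longrightarrow> mass n (haar_lift \<Phi>) \<le> c * B"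
proof -
  let ?c = "LINT z|(lborel :: shear_point measure). (\<Prod>b\<in>Basis. inverse (1 + (z \<bullet> b)\<^sup>2))"
  have "mass n (haar_lift \<Phi>) \<le> ?c * B"
    if \<Phi>: "\<Phi> \<in> decaying" and B: "\<And>z. z \<in> shearlet_group \<Longrightarrow> weight z ^ (n + 5) * norm (\<Phi> z) \<le> B" for \<Phi> B
  proof -
    have "mass n (haar_lift \<Phi>) \<le> B * ?c"
    proof (rule integrable_weight_rapid_aux(2))
      fix z assume z: "z \<in> shearlet_group"
      have "weight z ^ (n + 2) * norm (haar_lift \<Phi> z) \<le> weight z ^ (n + 2) * (weight z ^ 3 * norm (\<Phi> z))"
        by (intro mult_left_mono norm_haar_lift z) (simp add: weight_nonneg)
      also have "\<dots> = weight z ^ (n + 2 + 3) * norm (\<Phi> z)" by (simp only: power_add mult.assoc)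
      also have "\<dots> \<le> B" using B[OF z] by (simp add: numeral_eq_Suc)
      finally show "weight z ^ (n + 2) * norm (haar_lift \<Phi> z) \<le> B" .
    qed (use haar_lift_rapid[OF \<Phi>] in \<open>auto simp: rapid_def\<close>)
    then show ?thesis by (simp add: mult.commute)
  qed
  moreover have "0 \<le> ?c" by (intro integral_nonneg_AE AE_I2 prod_nonneg) auto
  ultimately show thesis using that by blast
qed

lemma iterated_integral:
  fixes H :: "shear_point \<Rightarrow> complex"
  assumes "integrable lborel H"
  shows "(LINT a|lborel. LINT s|lborel. LINT b|lborel. H (b, s, a)) = integral\<^sup>L lborel H"
proof -
  have i: "integrable (lborel \<Otimes>\<^sub>M lborel) (case_prod (\<lambda>b y. H (b, y)))"
    using assms by (simp add: lborel_prod case_prod_unfold)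
  then have "integrable lborel (\<lambda>y. LINT b|lborel. H (b, y))"
    by (rule lborel_pair.integrable_snd)
  then have i2: "integrable (lborel \<Otimes>\<^sub>M lborel) (case_prod (\<lambda>s a. LINT b|lborel. H (b, s, a)))"
    by (simp add: lborel_prod case_prod_unfold)
  have "(LINT a|lborel. LINT s|lborel. LINT b|lborel. H (b, s, a)) =
      integral\<^sup>L (lborel \<Otimes>\<^sub>M lborel) (case_prod (\<lambda>s a. LINT b|lborel. H (b, s, a)))"
    by (rule lborel_pair.integral_snd[OF i2])
  also have "\<dots> = (LINT y|lborel. LINT b|lborel. H (b, y))"
    by (simp add: lborel_prod case_prod_unfold)
  also have "\<dots> = integral\<^sup>L (lborel \<Otimes>\<^sub>M lborel) (case_prod (\<lambda>b y. H (b, y)))"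
    by (rule lborel_pair.integral_snd[OF i])
  finally show ?thesis by (simp add: lborel_prod case_prod_unfold)
qed

text \<open>The lift vanishes at a = 0 and so absorbs both the density and the restriction of the
  outer integral; Fubini then applies on the ambient vector space.\<close>

lemma iterated_integral_haar:
  assumes int: "integrable lborel (\<lambda>z. haar_lift \<Phi> z * h z)"
    and g: "\<And>b s a. a \<noteq> 0 \<Longrightarrow> g b s a = \<Phi> (b, s, a) * h (b, s, a) * of_real (\<bar>a\<bar> powi (-3))"
  shows "(LINT a:-{0}|lborel. LINT s|lborel. LINT b|lborel. g b s a) = (LINT z|lborel. haar_lift \<Phi> z * h z)"
proof -
  have "(LINT a:-{0}|lborel. LINT s|lborel. LINT b|lborel. g b s a) =
      (LINT a|lborel. LINT s|lborel. LINT b|lborel. haar_lift \<Phi> (b, s, a) * h (b, s, a))"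
    unfolding set_lebesgue_integral_def
  proof (rule Bochner_Integration.integral_cong[OF refl])
    fix a :: real
    show "indicator (-{0}) a *\<^sub>R (LINT s|lborel. LINT b|lborel. g b s a) =
        (LINT s|lborel. LINT b|lborel. haar_lift \<Phi> (b, s, a) * h (b, s, a))"
    proof (cases "a = 0")
      case True
      then show ?thesis by (simp add: haar_lift_def mem_shearlet_group)
    next
      case False
      then have "g b s a = haar_lift \<Phi> (b, s, a) * h (b, s, a)" for b s
        by (simp add: g haar_lift_def mem_shearlet_group)
      then show ?thesis using False by simp
    qed
  qed
  also have "\<dots> = (LINT z|lborel. haar_lift \<Phi> z * h z)"
    by (rule iterated_integral[OF int])
  finally show ?thesis .
qed

section \<open>Inverse matrices and the shearlet as a kernel\<close>

lemma matrix_inv_eqI: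
  fixes A B :: "real^'n^'n"
  assumes "A ** B = mat 1" "B ** A = mat 1"
  shows "matrix_inv A = B"
proof -
  have "A ** matrix_inv A = mat 1 \<and> matrix_inv A ** A = mat 1"
    unfolding matrix_inv_def by (rule someI[of _ B]) (use assms in auto)
  then have "matrix_inv A = matrix_inv A ** (A ** B)" "matrix_inv A ** A = mat 1"
    using assms by simp_all
  then show ?thesis
    by (metis matrix_mul_assoc matrix_mul_lid)
qed

lemma matrix_inv_shear_matrix: "matrix_inv (shear_matrix s) = vector [vector [1, s], vector [0, 1]]"
  by (rule matrix_inv_eqI)
    (simp_all add: shear_matrix_def vec_eq_iff forall_2 matrix_matrix_mult_def sum_2 mat_def)

lemma matrix_inv_dilation_matrix:
  assumes "a \<noteq> 0"
  shows "matrix_inv (dilation_matrix a) = vector [vector [1 / a, 0], vector [0, sgn a * \<bar>a\<bar> powr (-1/2)]]"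
proof -
  have "\<bar>a\<bar> powr (-1/2) * \<bar>a\<bar> powr (-1/2) = inverse \<bar>a\<bar>"
    using assms by (subst powr_add[symmetric]) (simp add: powr_minus)
  moreover have "a * \<bar>a\<bar> powr (-1/2) * (sgn a * \<bar>a\<bar> powr (-1/2)) =
      (a * sgn a) * (\<bar>a\<bar> powr (-1/2) * \<bar>a\<bar> powr (-1/2))"
    by (simp only: mult_ac)
  ultimately have *: "a * \<bar>a\<bar> powr (-1/2) * (sgn a * \<bar>a\<bar> powr (-1/2)) = 1"
    using assms by (simp add: abs_sgn[symmetric])
  then show ?thesis
    using assms by (intro matrix_inv_eqI)
      (simp_all add: dilation_matrix_def vec_eq_iff forall_2 matrix_matrix_mult_def sum_2 mat_def mult_ac)
qed

definition shearlet_kernel :: "(real^2 \<Rightarrow> complex) \<Rightarrow> shear_point \<times> (real^2) \<Rightarrow> complex" where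
  "shearlet_kernel \<eta> p = of_real (\<bar>pr_a p\<bar> powr (-3/4)) * \<eta> (shear_arg p)"

lemma shearlet_kernel_kernels: "\<eta> \<in> lizorkin_space \<Longrightarrow> shearlet_kernel \<eta> \<in> kernels"
  unfolding shearlet_kernel_def [abs_def] by (intro kernels.power kernels.base)

lemma shearlet_eq_kernel:
  assumes "a \<noteq> 0"
  shows "shearlet b s a \<eta> x = shearlet_kernel \<eta> ((b, s, a), x)"
proof -
  have "matrix_inv (dilation_matrix a) *v (matrix_inv (shear_matrix s) *v (x - b)) = shear_arg ((b, s, a), x)"
    unfolding matrix_inv_shear_matrix matrix_inv_dilation_matrix[OF assms]
    by (simp add: vec_eq_iff forall_2 matrix_vector_mult_def sum_2 shear_arg_nth)
  then show ?thesis
    by (simp add: shearlet_def shearlet_kernel_def)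
qed

lemma shearlet_synthesis_eq_synth:
  assumes \<eta>: "\<eta> \<in> lizorkin_space" and \<Phi>: "\<Phi> \<in> decaying"
  shows "shearlet_synthesis \<eta> \<Phi> = synth (shearlet_kernel \<eta>) (haar_lift \<Phi>)"
proof
  fix x
  show "shearlet_synthesis \<eta> \<Phi> x = synth (shearlet_kernel \<eta>) (haar_lift \<Phi>) x"
    unfolding shearlet_synthesis_def synth_def
    by (rule iterated_integral_haar)
      (auto intro: synth_integrable haar_lift_rapid \<Phi> shearlet_kernel_kernels \<eta> simp: shearlet_eq_kernel)
qed

section \<open>Commuting derivatives of kernels\<close>

lemma kernel_domain: "open (shearlet_group \<times> (UNIV :: (real^2) set))"
  by (intro open_Times open_shearlet_group open_UNIV)

lemma continuous_on_kernel:
  assumes "k \<in> kernels"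
  shows "continuous_on (shearlet_group \<times> UNIV) k"
proof (rule continuous_at_imp_continuous_on, rule ballI)
  fix p assume "p \<in> shearlet_group \<times> (UNIV :: (real^2) set)"
  then have "pr_a p \<noteq> 0" by (auto simp: mem_shearlet_group)
  from kernel_has_derivative[OF assms this] show "isCont k p"
    by (rule has_derivative_continuous)
qed

lemma kernel_has_vector_derivative_0:
  assumes "k \<in> kernels" "fst p \<in> shearlet_group"
  shows "line_deriv k p h (kd k h p)"
  using kernel_has_vector_derivative[OF assms(1), of p 0 h] assms(2) by simp

text \<open>Although \<open>kd\<close> is obtained by choice, over the open group a derivative along
  a line is determined by the values of the function there.\<close>

lemma kd_cong:
  assumes kl: "k \<in> kernels" "l \<in> kernels" and eq: "\<And>q. fst q \<in> shearlet_group \<Longrightarrow> k q = l q"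
    and p: "fst p \<in> shearlet_group"
  shows "kd k h p = kd l h p"
proof (rule vector_derivative_unique_at)
  show "line_deriv k p h (kd k h p)"
    by (rule kernel_has_vector_derivative_0[OF kl(1) p])
  have mem: "q \<in> shearlet_group \<times> (UNIV :: (real^2) set) \<longleftrightarrow> fst q \<in> shearlet_group" for q
    by (simp add: mem_Times_iff)
  show "line_deriv k p h (kd l h p)"
    by (rule has_vector_derivative_line_cong[OF kernel_domain _ _ kernel_has_vector_derivative_0[OF kl(2) p]])
      (simp_all only: mem p eq)
qed

text \<open>The domain is invariant under translations in plane directions but in general not in
  group directions; this decides which of the two plays the part of \<open>e\<close> in
  \<open>symmetric_partial\<close>.\<close>

lemma kd_commute:
  assumes k: "k \<in> kernels" and p: "fst p \<in> shearlet_group"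
  shows "kd (kd k (v, 0)) (0, e) p = kd (kd k (0, e)) (v, 0) p"
proof (rule vector_derivative_unique_at)
  show "((\<lambda>t. kd k (v, 0) (p + t *\<^sub>R (0, e))) has_vector_derivative kd (kd k (v, 0)) (0, e) p) (at 0)"
    by (rule kernel_has_vector_derivative_0[OF kd_kernel[OF k] p])
  have mem: "q \<in> shearlet_group \<times> (UNIV :: (real^2) set) \<longleftrightarrow> fst q \<in> shearlet_group" for q
    by (simp add: mem_Times_iff)
  show "((\<lambda>t. kd k (v, 0) (p + t *\<^sub>R (0, e))) has_vector_derivative kd (kd k (0, e)) (v, 0) p) (at 0)"
  proof (rule symmetric_partial[where \<phi> = k and U = "shearlet_group \<times> UNIV" and \<phi>e = "kd k (0, e)" and d = "(v, 0)"])
    show "p \<in> shearlet_group \<times> UNIV" using p by (simp only: mem)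
    show "q + t *\<^sub>R (0, e) \<in> shearlet_group \<times> UNIV" if "q \<in> shearlet_group \<times> UNIV" for q t
      using that by (simp add: mem_Times_iff)
  qed (simp_all only: mem kernel_domain kernel_has_vector_derivative_0 k kd_kernel continuous_on_kernel)
qed

lemma kd_pow_commute:
  assumes k: "k \<in> kernels"
  shows "fst p \<in> shearlet_group \<Longrightarrow>
    ((\<lambda>k. kd k (0, e)) ^^ m) (kd k (v, 0)) p = kd (((\<lambda>k. kd k (0, e)) ^^ m) k) (v, 0) p"
proof (induction m arbitrary: p)
  case (Suc m)
  let ?A = "((\<lambda>k. kd k (0, e)) ^^ m) (kd k (v, 0))" and ?B = "((\<lambda>k. kd k (0, e)) ^^ m) k"
  have "kd ?A (0, e) p = kd (kd ?B (v, 0)) (0, e) p"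
    by (rule kd_cong[OF _ _ Suc.IH Suc.prems]) (intro kd_pow_kernel kd_kernel k)+
  also have "\<dots> = kd (kd ?B (0, e)) (v, 0) p"
    by (intro kd_commute kd_pow_kernel k Suc.prems)
  finally show ?case by simp
qed simp

lemma kd_pow_cong:
  assumes "k \<in> kernels" "l \<in> kernels" "\<And>q. fst q \<in> shearlet_group \<Longrightarrow> k q = l q"
  shows "fst p \<in> shearlet_group \<Longrightarrow> ((\<lambda>k. kd k h) ^^ m) k p = ((\<lambda>k. kd k h) ^^ m) l p"
proof (induction m arbitrary: p)
  case (Suc m)
  then show ?case
    using kd_cong[OF kd_pow_kernel[OF assms(1)] kd_pow_kernel[OF assms(2)]] by simp
qed (simp add: assms)

text \<open>Lets the linear Taylor term of \<open>kpd m1 m2 k\<close> in z be read as a plane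
  derivative of the kernel \<open>kd k (v, 0)\<close>, so that a functional controlled by plane
  derivatives can be applied to the remainder.\<close>

lemma kpd_kd:
  assumes k: "k \<in> kernels" and p: "fst p \<in> shearlet_group"
  shows "kpd m1 m2 (kd k (v, 0)) p = kd (kpd m1 m2 k) (v, 0) p"
proof -
  let ?B = "((\<lambda>k. kd k (0, e1)) ^^ m1) k"
  have "((\<lambda>k. kd k (0, e2)) ^^ m2) (((\<lambda>k. kd k (0, e1)) ^^ m1) (kd k (v, 0))) p =
      ((\<lambda>k. kd k (0, e2)) ^^ m2) (kd ?B (v, 0)) p"
    by (rule kd_pow_cong[OF _ _ kd_pow_commute[OF k] p]) (intro kd_pow_kernel kd_kernel k)+
  also have "\<dots> = kd (((\<lambda>k. kd k (0, e2)) ^^ m2) ?B) (v, 0) p"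
    by (intro kd_pow_commute kd_pow_kernel k p)
  finally show ?thesis by (simp only: kpd_def)
qed

section \<open>Continuous functionals on the Lizorkin space\<close>

lemma partial_pow_lincomb:
  assumes "smooth_on UNIV \<phi>" "smooth_on UNIV \<psi>" "v \<in> Basis"
  shows "(partial v ^^ m) (\<lambda>x :: 'a::euclidean_space. c * \<phi> x + d * \<psi> x :: complex) =
    (\<lambda>x. c * (partial v ^^ m) \<phi> x + d * (partial v ^^ m) \<psi> x)"
proof (induction m)
  case (Suc m)
  have "((\<lambda>t. c * (partial v ^^ m) \<phi> (x + t *\<^sub>R v) + d * (partial v ^^ m) \<psi> (x + t *\<^sub>R v)) has_vector_derivative
      c * partial v ((partial v ^^ m) \<phi>) x + d * partial v ((partial v ^^ m) \<psi>) x) (at 0)" for x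
    by (intro partial_comb smooth_on_has_vector_derivative[of UNIV] smooth_on_partial_pow assms UNIV_I)
  then have "partial v (\<lambda>x. c * (partial v ^^ m) \<phi> x + d * (partial v ^^ m) \<psi> x) =
      (\<lambda>x. c * partial v ((partial v ^^ m) \<phi>) x + d * partial v ((partial v ^^ m) \<psi>) x)"
    by (simp add: partial_def vector_derivative_at fun_eq_iff)
  then show ?case using Suc by simp
qed simp

lemma pd_lincomb:
  assumes "\<phi> \<in> schwartz_space" "\<psi> \<in> schwartz_space"
  shows "pd m1 m2 (\<lambda>x. c * \<phi> x + d * \<psi> x) = (\<lambda>x. c * pd m1 m2 \<phi> x + d * pd m1 m2 \<psi> x)"
proof -
  have B: "e1 \<in> Basis" "e2 \<in> Basis" by (auto simp: Basis_plane)
  note S = schwartz_smooth[OF assms(1)] schwartz_smooth[OF assms(2)]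
  show ?thesis
    unfolding pd_def partial_pow_lincomb[OF S B(1)]
    by (rule partial_pow_lincomb[OF smooth_on_partial_pow[OF S(1) B(1)] smooth_on_partial_pow[OF S(2) B(1)] B(2)])
qed

lemma pd_cmult: "\<phi> \<in> schwartz_space \<Longrightarrow> pd m1 m2 (\<lambda>x. c * \<phi> x) = (\<lambda>x. c * pd m1 m2 \<phi> x)"
  using pd_lincomb[of \<phi> \<phi> m1 m2 c 0] by simp

lemma pd_add: "\<phi> \<in> schwartz_space \<Longrightarrow> \<psi> \<in> schwartz_space \<Longrightarrow>
    pd m1 m2 (\<lambda>x. \<phi> x + \<psi> x) = (\<lambda>x. pd m1 m2 \<phi> x + pd m1 m2 \<psi> x)"
  using pd_lincomb[of \<phi> \<psi> m1 m2 1 1] by simp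

lemma pd_diff: "\<phi> \<in> schwartz_space \<Longrightarrow> \<psi> \<in> schwartz_space \<Longrightarrow>
    pd m1 m2 (\<lambda>x. \<phi> x - \<psi> x) = (\<lambda>x. pd m1 m2 \<phi> x - pd m1 m2 \<psi> x)"
  using pd_lincomb[of \<phi> \<psi> m1 m2 1 "-1"] by simp

lemma schwartz_norm_triangle:
  assumes "\<phi> \<in> schwartz_space" "\<psi> \<in> schwartz_space"
  shows "schwartz_norm k m1 m2 (\<lambda>x. \<phi> x + \<psi> x) \<le> schwartz_norm k m1 m2 \<phi> + schwartz_norm k m1 m2 \<psi>"
  unfolding schwartz_norm_eq pd_add[OF assms]
proof (rule SUP_least)
  fix x :: "real^2"
  have J: "0 \<le> jbracket x ^ k" by (simp add: jbracket_pos less_imp_le)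
  have "ennreal (jbracket x ^ k * norm (pd m1 m2 \<phi> x + pd m1 m2 \<psi> x)) \<le>
      ennreal (jbracket x ^ k * norm (pd m1 m2 \<phi> x) + jbracket x ^ k * norm (pd m1 m2 \<psi> x))"
    unfolding distrib_left[symmetric] by (intro ennreal_leI mult_left_mono norm_triangle_ineq J)
  also have "\<dots> = ennreal (jbracket x ^ k * norm (pd m1 m2 \<phi> x)) + ennreal (jbracket x ^ k * norm (pd m1 m2 \<psi> x))"
    using J by (intro ennreal_plus) auto
  also have "\<dots> \<le> (SUP x. ennreal (jbracket x ^ k * norm (pd m1 m2 \<phi> x))) + (SUP x. ennreal (jbracket x ^ k * norm (pd m1 m2 \<psi> x)))"
    by (intro add_mono SUP_upper UNIV_I)
  finally show "ennreal (jbracket x ^ k * norm (pd m1 m2 \<phi> x + pd m1 m2 \<psi> x)) \<le> \<dots>" .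
qed

text \<open>Subbasic sets are balls of a single seminorm around arbitrary centres. The triangle
  inequality recentres them at \<open>\<phi>\<close>; the maximum of the orders and the minimum of
  the radii handle intersections.\<close>

lemma schwartz_nbhd:
  assumes "openin schwartz_topology U" "\<phi> \<in> U"
  shows "\<exists>N. \<exists>e>0. {g \<in> schwartz_space. \<forall>k\<le>N. \<forall>m1\<le>N. \<forall>m2\<le>N. schwartz_norm k m1 m2 (\<lambda>z. g z - \<phi> z) < ennreal e} \<subseteq> U"
proof -
  define V where "V \<phi> N e = {g \<in> schwartz_space. \<forall>k\<le>N. \<forall>m1\<le>N. \<forall>m2\<le>N. schwartz_norm k m1 m2 (\<lambda>z. g z - \<phi> z) < ennreal e}"
    for \<phi> N e
  have mono: "V \<phi> N' e' \<subseteq> V \<phi> N e" if "N \<le> N'" "e' \<le> e" for \<phi> N N' and e e' :: real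
    unfolding V_def using order_trans[OF _ that(1)] less_le_trans[OF _ ennreal_leI[OF that(2)]] by blast
  have "generate_topology_on {{g \<in> schwartz_space. p (\<lambda>z. g z - f z) < ennreal e} | p f e.
      p \<in> {schwartz_norm k m1 m2 | k m1 m2. True} \<and> f \<in> schwartz_space \<and> e > 0} U"
    using assms(1) unfolding schwartz_topology_def seminorm_topology_def
    by (rule openin_topology_generated_by)
  then have "\<forall>\<phi>\<in>U. \<exists>N. \<exists>e>0. V \<phi> N e \<subseteq> U"
  proof induction
    case (Int a b)
    show ?case
    proof
      fix \<phi> assume "\<phi> \<in> a \<inter> b"
      then have "\<phi> \<in> a" "\<phi> \<in> b" by auto
      then obtain N e N' e' where *: "e > 0" "V \<phi> N e \<subseteq> a" "e' > 0" "V \<phi> N' e' \<subseteq> b"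
        using Int.IH by metis
      have "V \<phi> (max N N') (min e e') \<subseteq> a \<inter> b"
        using order_trans[OF mono *(2), of "max N N'" "min e e'"] order_trans[OF mono *(4), of "max N N'" "min e e'"]
        by simp
      then show "\<exists>N. \<exists>e>0. V \<phi> N e \<subseteq> a \<inter> b"
        using * by (intro exI[of _ "max N N'"] exI[of _ "min e e'"]) simp
    qed
  next
    case (UN K)
    show ?case
    proof
      fix \<phi> assume "\<phi> \<in> \<Union> K"
      then obtain k where k: "k \<in> K" "\<phi> \<in> k" by blast
      then obtain N e where "e > 0" "V \<phi> N e \<subseteq> k" using UN.IH by blast
      then show "\<exists>N. \<exists>e>0. V \<phi> N e \<subseteq> \<Union> K" using k(1) by blast
    qed
  next
    case (Basis s)
    then obtain k m1 m2 f e where s: "s = {g \<in> schwartz_space. schwartz_norm k m1 m2 (\<lambda>z. g z - f z) < ennreal e}"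
      "f \<in> schwartz_space" "e > 0" by blast
    show ?case
    proof
      fix \<phi> assume "\<phi> \<in> s"
      then have \<phi>: "\<phi> \<in> schwartz_space" "schwartz_norm k m1 m2 (\<lambda>z. \<phi> z - f z) < ennreal e" by (auto simp: s)
      then obtain r where r: "schwartz_norm k m1 m2 (\<lambda>z. \<phi> z - f z) = ennreal r" "0 \<le> r"
        by (cases "schwartz_norm k m1 m2 (\<lambda>z. \<phi> z - f z)") auto
      \<comment> \<open>Recentring leaves the positive radius e - r.\<close>
      then have re: "r < e" using \<phi>(2) by (simp add: ennreal_less_iff)
      let ?N = "max k (max m1 m2)"
      have "V \<phi> ?N (e - r) \<subseteq> s"
      proof
        fix g assume "g \<in> V \<phi> ?N (e - r)"
        then have g: "g \<in> schwartz_space" "schwartz_norm k m1 m2 (\<lambda>z. g z - \<phi> z) < ennreal (e - r)" by (auto simp: V_def)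
        have "schwartz_norm k m1 m2 (\<lambda>z. g z - f z) = schwartz_norm k m1 m2 (\<lambda>z. (\<phi> z - f z) + (g z - \<phi> z))"
          by (simp add: algebra_simps)
        also have "\<dots> \<le> schwartz_norm k m1 m2 (\<lambda>z. \<phi> z - f z) + schwartz_norm k m1 m2 (\<lambda>z. g z - \<phi> z)"
          by (intro schwartz_norm_triangle schwartz_diff \<phi> g s)
        also have "\<dots> < ennreal r + ennreal (e - r)"
          unfolding r(1) using g(2) by (simp add: ennreal_add_left_cancel_less)
        also have "\<dots> = ennreal e" using r(2) re by (simp flip: ennreal_plus)
        finally show "g \<in> s" using g(1) by (simp add: s)
      qed
      then show "\<exists>N. \<exists>e>0. V \<phi> N e \<subseteq> s"
        using re by (intro exI[of _ ?N] exI[of _ "e - r"]) simp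
    qed
  qed simp
  then show ?thesis using assms(2) unfolding V_def by blast
qed

definition pairing :: "((real^2 \<Rightarrow> complex) \<Rightarrow> complex) \<Rightarrow> (shear_point \<times> (real^2) \<Rightarrow> complex) \<Rightarrow> shear_point \<Rightarrow> complex" where
  "pairing f k z = f (\<lambda>x. k (z, x))"

definition restr :: "shear_point set \<Rightarrow> (shear_point \<Rightarrow> complex) \<Rightarrow> shear_point \<Rightarrow> complex" where
  "restr Q G z = indicator Q z *\<^sub>R G z"

definition defect :: "((real^2 \<Rightarrow> complex) \<Rightarrow> complex) \<Rightarrow> (shear_point \<times> (real^2) \<Rightarrow> complex) \<Rightarrow>
    (shear_point \<Rightarrow> complex) \<Rightarrow> complex" where
  "defect f k G = f (synth k G) - (LINT z|lborel. G z * pairing f k z)"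

context
  fixes f :: "(real^2 \<Rightarrow> complex) \<Rightarrow> complex"
  assumes f: "f \<in> topological_dual lizorkin_topology"
begin

section \<open>Linearity of a Lizorkin functional and its bound by seminorms\<close>

lemma lizorkin_dual_lincomb:
  assumes \<phi>: "\<phi> \<in> lizorkin_space" "\<psi> \<in> lizorkin_space"
  shows "f (\<lambda>x. c * \<phi> x + d * \<psi> x) = c * f \<phi> + d * f \<psi>"
proof -
  have "f (\<lambda>x. c * \<phi> x + d * \<psi> x) = f (\<lambda>x. c * \<phi> x) + f (\<lambda>x. d * \<psi> x)"
    using f lizorkin_cmult[OF \<phi>(1), of c] lizorkin_cmult[OF \<phi>(2), of d]
    unfolding topological_dual_def topspace_lizorkin by simp
  then show ?thesis
    using f \<phi> unfolding topological_dual_def topspace_lizorkin by simp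
qed

lemma lizorkin_dual_cmult:
  assumes "\<phi> \<in> lizorkin_space"
  shows "f (\<lambda>x. c * \<phi> x) = c * f \<phi>"
  using f assms unfolding topological_dual_def topspace_lizorkin by blast

lemma lizorkin_dual_diff:
  assumes \<phi>: "\<phi> \<in> lizorkin_space" "\<psi> \<in> lizorkin_space"
  shows "f (\<lambda>x. \<phi> x - \<psi> x) = f \<phi> - f \<psi>"
  using lizorkin_dual_lincomb[OF assms, of 1 "-1"] by simp

lemma lizorkin_dual_add:
  assumes \<phi>: "\<phi> \<in> lizorkin_space" "\<psi> \<in> lizorkin_space"
  shows "f (\<lambda>x. \<phi> x + \<psi> x) = f \<phi> + f \<psi>"
  using lizorkin_dual_lincomb[OF assms, of 1 1] by simp

text \<open>Continuity at 0 gives a basic neighbourhood on which \<open>f\<close> has norm below 1,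
  and scaling turns this into a bound by finitely many seminorms. A real majorant B of the weighted
  derivatives is the shape in which the kernel estimates arrive.\<close>

lemma lizorkin_dual_bound:
  obtains N C where "C > 0" "\<And>\<phi> B. \<phi> \<in> lizorkin_space \<Longrightarrow> 0 \<le> B \<Longrightarrow>
    (\<And>m1 m2 x. m1 \<le> N \<Longrightarrow> m2 \<le> N \<Longrightarrow> jbracket x ^ N * norm (pd m1 m2 \<phi> x) \<le> B) \<Longrightarrow> norm (f \<phi>) \<le> C * B"
proof -
  have zero: "(\<lambda>x. 0) \<in> lizorkin_space"
    by (rule lizorkin_spaceI[OF zero_schwartz]) simp
  have f0: "f (\<lambda>x. 0) = 0"
    using lizorkin_dual_cmult[OF zero, of 0] by simp
  have "openin lizorkin_topology {\<phi> \<in> topspace lizorkin_topology. f \<phi> \<in> ball 0 1}"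
    using f open_ball[of "0 :: complex" 1] unfolding topological_dual_def continuous_map_def open_openin[symmetric] by blast
  then obtain T where T: "openin schwartz_topology T" "{\<phi> \<in> lizorkin_space. f \<phi> \<in> ball 0 1} = T \<inter> lizorkin_space"
    unfolding topspace_lizorkin unfolding lizorkin_topology_def openin_subtopology by blast
  have "(\<lambda>x. 0) \<in> T" using T(2) zero f0 by (metis (mono_tags, lifting) Int_iff centre_in_ball mem_Collect_eq zero_less_one)
  from schwartz_nbhd[OF T(1) this] obtain N e where e: "e > 0"
    "{g \<in> schwartz_space. \<forall>k\<le>N. \<forall>m1\<le>N. \<forall>m2\<le>N. schwartz_norm k m1 m2 (\<lambda>z. g z - 0) < ennreal e} \<subseteq> T" by blast
  have pos: "norm (f \<phi>) \<le> 2 / e * B" if \<phi>: "\<phi> \<in> lizorkin_space" and B: "0 < B"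
    and b: "\<And>m1 m2 x. m1 \<le> N \<Longrightarrow> m2 \<le> N \<Longrightarrow> jbracket x ^ N * norm (pd m1 m2 \<phi> x) \<le> B" for \<phi> B
  proof -
    \<comment> \<open>At this scale all norms involved are at most e / 2, strictly below the radius
      e.\<close>
    define c where "c = e / (2 * B)"
    have c: "c > 0" using e B by (simp add: c_def)
    have "schwartz_norm k m1 m2 (\<lambda>z. of_real c * \<phi> z - 0) < ennreal e" if m: "k \<le> N" "m1 \<le> N" "m2 \<le> N" for k m1 m2
    proof -
      have "jbracket x ^ k * norm (pd m1 m2 (\<lambda>z. of_real c * \<phi> z - 0) x) \<le> e / 2" for x
      proof -
        have "jbracket x ^ k * norm (pd m1 m2 \<phi> x) \<le> jbracket x ^ N * norm (pd m1 m2 \<phi> x)"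
          using m jbracket_ge_1[of x] by (intro mult_right_mono power_increasing) auto
        also have "\<dots> \<le> B" by (rule b[OF m(2,3)])
        finally have "c * (jbracket x ^ k * norm (pd m1 m2 \<phi> x)) \<le> c * B"
          using c by (intro mult_left_mono) auto
        also have "c * B = e / 2" using B by (simp add: c_def)
        finally show ?thesis
          using c by (simp add: pd_cmult[OF lizorkin_schwartz[OF \<phi>]] norm_mult mult.left_commute)
      qed
      then have "schwartz_norm k m1 m2 (\<lambda>z. of_real c * \<phi> z - 0) \<le> ennreal (e / 2)"
        by (rule schwartz_norm_le)
      also have "\<dots> < ennreal e" using e by (simp add: ennreal_less_iff)
      finally show ?thesis .
    qed
    moreover have c\<phi>: "(\<lambda>z. of_real c * \<phi> z) \<in> lizorkin_space" by (rule lizorkin_cmult[OF \<phi>])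
    ultimately have "(\<lambda>z. of_real c * \<phi> z) \<in> T"
      using e(2) lizorkin_schwartz[OF c\<phi>] by blast
    then have "f (\<lambda>z. of_real c * \<phi> z) \<in> ball 0 1"
      using T(2) c\<phi> by blast
    then have "c * norm (f \<phi>) < 1"
      using lizorkin_dual_cmult[OF \<phi>, of "of_real c"] c by (simp add: norm_mult)
    then show ?thesis
      using e B by (simp add: c_def field_simps)
  qed
  \<comment> \<open>The case B = 0 is reached by applying the previous bound to slightly larger
    majorants.\<close>
  have "norm (f \<phi>) \<le> 2 / e * B" if \<phi>: "\<phi> \<in> lizorkin_space" and B: "0 \<le> B"
    and b: "\<And>m1 m2 x. m1 \<le> N \<Longrightarrow> m2 \<le> N \<Longrightarrow> jbracket x ^ N * norm (pd m1 m2 \<phi> x) \<le> B" for \<phi> B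
  proof (rule field_le_epsilon)
    fix \<epsilon> :: real assume \<epsilon>: "\<epsilon> > 0"
    have "norm (f \<phi>) \<le> 2 / e * (B + \<epsilon> * e / 2)"
      using \<epsilon> e B by (intro pos[OF \<phi>] order_trans[OF b]) (auto intro: add_nonneg_pos)
    then show "norm (f \<phi>) \<le> 2 / e * B + \<epsilon>"
      using e by (simp add: algebra_simps)
  qed
  then show thesis using that[of "2 / e" N] e(1) by auto
qed

section \<open>Pairing a functional with a kernel\<close>

text \<open>Finitely many eventual estimates are merged by adding their constants; \<open>c\<close>
  is the common rate, \<open>norm (z - z0)\<close> or \<open>t\<^sup>2\<close> in the
  applications.\<close>

lemma eventually_bound_finite:
  fixes E :: "nat \<Rightarrow> nat \<Rightarrow> 'a \<Rightarrow> 'b \<Rightarrow> real"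
  assumes "\<And>m1 m2. \<exists>M\<ge>0. \<forall>\<^sub>F z in F. \<forall>x. E m1 m2 z x \<le> M * c z" and c: "\<And>z. 0 \<le> c z"
  shows "\<exists>M\<ge>0. \<forall>\<^sub>F z in F. \<forall>m1\<le>N. \<forall>m2\<le>N. \<forall>x. E m1 m2 z x \<le> M * c z"
proof -
  define P where "P m1 m2 M \<longleftrightarrow> (\<forall>\<^sub>F z in F. \<forall>x. E m1 m2 z x \<le> M * c z)" for m1 m2 M
  have "\<exists>M\<ge>0. P m1 m2 M" for m1 m2
    unfolding P_def by (rule assms(1))
  then obtain M where M: "\<And>m1 m2. 0 \<le> M m1 m2" "\<And>m1 m2. P m1 m2 (M m1 m2)"
    by metis
  define S where "S = (\<Sum>m1\<le>N. \<Sum>m2\<le>N. M m1 m2)"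
  have S: "M m1 m2 \<le> S" if "m1 \<le> N" "m2 \<le> N" for m1 m2
  proof -
    have "M m1 m2 \<le> (\<Sum>m2\<le>N. M m1 m2)" using that M(1) by (intro member_le_sum) auto
    also have "\<dots> \<le> S" unfolding S_def using that M(1)
      by (intro member_le_sum[of m1 "{..N}" "\<lambda>m1. \<Sum>m2\<le>N. M m1 m2"] sum_nonneg) auto
    finally show ?thesis .
  qed
  have "\<forall>\<^sub>F z in F. \<forall>m1\<in>{..N}. \<forall>m2\<in>{..N}. \<forall>x. E m1 m2 z x \<le> M m1 m2 * c z"
    by (intro eventually_ball_finite ballI M(2)[unfolded P_def]) auto
  then have "\<forall>\<^sub>F z in F. \<forall>m1\<le>N. \<forall>m2\<le>N. \<forall>x. E m1 m2 z x \<le> S * c z"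
  proof eventually_elim
    case (elim z)
    have "E m1 m2 z x \<le> S * c z" if "m1 \<le> N" "m2 \<le> N" for m1 m2 x
    proof -
      have "E m1 m2 z x \<le> M m1 m2 * c z" using elim that by simp
      also have "\<dots> \<le> S * c z" by (rule mult_right_mono[OF S[OF that] c])
      finally show ?thesis .
    qed
    then show ?case by blast
  qed
  moreover have "0 \<le> S" unfolding S_def using M(1) by (intro sum_nonneg) auto
  ultimately show ?thesis by blast
qed

lemma kernel_close:
  assumes k: "k \<in> kernels" and z0: "z0 \<in> shearlet_group"
  shows "\<exists>M\<ge>0. \<forall>\<^sub>F z in nhds z0. z \<in> shearlet_group \<and> (\<forall>m1\<le>N. \<forall>m2\<le>N. \<forall>x.
    jbracket x ^ N * norm (kpd m1 m2 k (z, x) - kpd m1 m2 k (z0, x)) \<le> M * norm (z - z0))"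
proof -
  have "\<exists>M\<ge>0. \<forall>\<^sub>F z in nhds z0. \<forall>x.
      jbracket x ^ N * norm (kpd m1 m2 k (z, x) - kpd m1 m2 k (z0, x)) \<le> M * norm (z - z0)" for m1 m2
  proof -
    obtain M r where M: "M \<ge> 0" "r > 0" "ball z0 r \<subseteq> shearlet_group"
      "\<And>z z' x. z \<in> ball z0 r \<Longrightarrow> z' \<in> ball z0 r \<Longrightarrow>
        jbracket x ^ N * norm (kpd m1 m2 k (z, x) - kpd m1 m2 k (z', x)) \<le> M * norm (z - z')"
      by (rule kernel_lipschitz_z[OF kpd_kernel[OF k, of m1 m2] z0, of N]) blast
    have z0b: "z0 \<in> ball z0 r" using M(2) by simp
    from eventually_nhds_in_open[OF open_ball this]
    have "\<forall>\<^sub>F z in nhds z0. z \<in> ball z0 r" .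
    then have "\<forall>\<^sub>F z in nhds z0. \<forall>x.
        jbracket x ^ N * norm (kpd m1 m2 k (z, x) - kpd m1 m2 k (z0, x)) \<le> M * norm (z - z0)"
      by (rule eventually_mono) (intro allI M(4) z0b)
    then show ?thesis using M(1) by blast
  qed
  then obtain M where M: "M \<ge> 0" "\<forall>\<^sub>F z in nhds z0. \<forall>m1\<le>N. \<forall>m2\<le>N. \<forall>x.
      jbracket x ^ N * norm (kpd m1 m2 k (z, x) - kpd m1 m2 k (z0, x)) \<le> M * norm (z - z0)"
    using eventually_bound_finite[where c = "\<lambda>z. norm (z - z0)" and F = "nhds z0" and N = N and
      E = "\<lambda>m1 m2 z x. jbracket x ^ N * norm (kpd m1 m2 k (z, x) - kpd m1 m2 k (z0, x))"] norm_ge_zero by blast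
  have "\<forall>\<^sub>F z in nhds z0. z \<in> shearlet_group"
    by (rule eventually_nhds_in_open[OF open_shearlet_group z0])
  from eventually_conj[OF this M(2)] show ?thesis
    using M(1) by blast
qed

lemma kernel_taylor_all:
  assumes k: "k \<in> kernels" and z0: "z0 \<in> shearlet_group"
  shows "\<exists>M\<ge>0. \<forall>\<^sub>F t in nhds 0. z0 + t *\<^sub>R v \<in> shearlet_group \<and> (\<forall>m1\<le>N. \<forall>m2\<le>N. \<forall>x.
    jbracket x ^ N * norm (kpd m1 m2 k (z0 + t *\<^sub>R v, x) - kpd m1 m2 k (z0, x) -
      t *\<^sub>R kpd m1 m2 (kd k (v, 0)) (z0, x)) \<le> M * t\<^sup>2)"
proof -
  let ?E = "\<lambda>m1 m2 t x. jbracket x ^ N * norm (kpd m1 m2 k (z0 + t *\<^sub>R v, x) - kpd m1 m2 k (z0, x) -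
      t *\<^sub>R kpd m1 m2 (kd k (v, 0)) (z0, x))"
  have "\<exists>M\<ge>0. \<forall>\<^sub>F t in nhds 0. \<forall>x. ?E m1 m2 t x \<le> M * t\<^sup>2" for m1 m2
  proof -
    obtain M r where M: "M \<ge> 0" "r > 0"
      "\<And>t x. \<bar>t\<bar> < r \<Longrightarrow> z0 + t *\<^sub>R v \<in> shearlet_group \<and>
        jbracket x ^ N * norm (kpd m1 m2 k (z0 + t *\<^sub>R v, x) - kpd m1 m2 k (z0, x) -
          t *\<^sub>R kd (kpd m1 m2 k) (v, 0) (z0, x)) \<le> M * t\<^sup>2"
      by (rule kernel_taylor_z[OF kpd_kernel[OF k, of m1 m2] z0, of v N]) blast
    have eq: "kpd m1 m2 (kd k (v, 0)) (z0, x) = kd (kpd m1 m2 k) (v, 0) (z0, x)" for x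
      using kpd_kd[OF k, of "(z0, x)"] z0 by simp
    have "\<forall>\<^sub>F t in nhds (0::real). \<bar>t\<bar> < r"
      unfolding eventually_nhds_metric using M(2) by (intro exI[of _ r]) (auto simp: dist_real_def)
    then have "\<forall>\<^sub>F t in nhds 0. \<forall>x. ?E m1 m2 t x \<le> M * t\<^sup>2"
      by (rule eventually_mono) (use M(3) in \<open>simp add: eq\<close>)
    then show ?thesis using M(1) by blast
  qed
  then obtain M where M: "M \<ge> 0" "\<forall>\<^sub>F t in nhds 0. \<forall>m1\<le>N. \<forall>m2\<le>N. \<forall>x. ?E m1 m2 t x \<le> M * t\<^sup>2"
    using eventually_bound_finite[where c = "\<lambda>t. t\<^sup>2" and F = "nhds 0" and N = N and E = ?E] zero_le_power2 by blast
  from eventually_conj[OF eventually_line_in_open[OF open_shearlet_group z0, of v] M(2)] show ?thesis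
    using M(1) by blast
qed

text \<open>The whole Taylor remainder in z is a Lizorkin function and is quadratically small in all
  derivatives that the bound for \<open>f\<close> asks for.\<close>

lemma pairing_has_vector_derivative:
  assumes k: "k \<in> kernels" and z: "z \<in> shearlet_group"
  shows "line_deriv (pairing f k) z v (pairing f (kd k (v, 0)) z)"
proof -
  obtain N C where C: "C > 0" "\<And>\<phi> B. \<phi> \<in> lizorkin_space \<Longrightarrow> 0 \<le> B \<Longrightarrow>
    (\<And>m1 m2 x. m1 \<le> N \<Longrightarrow> m2 \<le> N \<Longrightarrow> jbracket x ^ N * norm (pd m1 m2 \<phi> x) \<le> B) \<Longrightarrow> norm (f \<phi>) \<le> C * B"
    by (rule lizorkin_dual_bound) blast
  obtain M where M: "M \<ge> 0" "\<forall>\<^sub>F t in nhds 0. z + t *\<^sub>R v \<in> shearlet_group \<and> (\<forall>m1\<le>N. \<forall>m2\<le>N. \<forall>x.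
    jbracket x ^ N * norm (kpd m1 m2 k (z + t *\<^sub>R v, x) - kpd m1 m2 k (z, x) -
      t *\<^sub>R kpd m1 m2 (kd k (v, 0)) (z, x)) \<le> M * t\<^sup>2)"
    using kernel_taylor_all[OF k z, of v N] by blast
  then obtain r where r: "r > 0" "\<And>t. \<bar>t\<bar> < r \<Longrightarrow> z + t *\<^sub>R v \<in> shearlet_group"
    "\<And>t m1 m2 x. \<bar>t\<bar> < r \<Longrightarrow> m1 \<le> N \<Longrightarrow> m2 \<le> N \<Longrightarrow> jbracket x ^ N * norm (kpd m1 m2 k (z + t *\<^sub>R v, x) - kpd m1 m2 k (z, x) -
      t *\<^sub>R kpd m1 m2 (kd k (v, 0)) (z, x)) \<le> M * t\<^sup>2"
    unfolding eventually_nhds_metric by (metis dist_0_norm dist_commute real_norm_def)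
  show ?thesis
  proof (rule has_vector_derivative_quadratic[OF r(1)])
    fix t :: real assume t: "\<bar>t\<bar> < r"
    note L1 = kernel_section_lizorkin[OF k r(2)[OF t]] and L2 = kernel_section_lizorkin[OF k z]
      and L3 = kernel_section_lizorkin[OF kd_kernel[OF k] z, of "(v, 0)"]
    let ?\<phi> = "\<lambda>x. (k (z + t *\<^sub>R v, x) - k (z, x)) - of_real t * kd k (v, 0) (z, x)"
    have \<phi>: "?\<phi> \<in> lizorkin_space"
      by (intro lizorkin_diff lizorkin_cmult L1 L2 L3)
    have "f ?\<phi> = f (\<lambda>x. k (z + t *\<^sub>R v, x)) - f (\<lambda>x. k (z, x)) - of_real t * f (\<lambda>x. kd k (v, 0) (z, x))"
      by (simp add: lizorkin_dual_diff lizorkin_diff lizorkin_cmult lizorkin_dual_cmult L1 L2 L3)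
    moreover have "norm (f ?\<phi>) \<le> C * (M * t\<^sup>2)"
    proof (rule C(2)[OF \<phi>])
      fix m1 m2 x assume m: "m1 \<le> N" "m2 \<le> N"
      have "pd m1 m2 ?\<phi> x = kpd m1 m2 k (z + t *\<^sub>R v, x) - kpd m1 m2 k (z, x) - t *\<^sub>R kpd m1 m2 (kd k (v, 0)) (z, x)"
        using L1 L2 L3 by (simp add: pd_diff pd_cmult schwartz_diff schwartz_cmult lizorkin_schwartz
            pd_kernel k kd_kernel z r(2)[OF t] scaleR_conv_of_real)
      then show "jbracket x ^ N * norm (pd m1 m2 ?\<phi> x) \<le> M * t\<^sup>2"
        using r(3)[OF t m] by simp
    qed (use M(1) in simp)
    ultimately show "norm (pairing f k (z + t *\<^sub>R v) - pairing f k (z + 0 *\<^sub>R v) - t *\<^sub>R pairing f (kd k (v, 0)) z) \<le> (C * M) * t\<^sup>2"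
      by (simp add: pairing_def scaleR_conv_of_real)
  qed
qed

text \<open>Directional derivatives do not imply the joint continuity in z that
  \<open>smooth_on\<close> demands, hence an estimate in all directions at once.\<close>

lemma pairing_local_lipschitz:
  assumes k: "k \<in> kernels" and z0: "z0 \<in> shearlet_group"
  shows "\<exists>M. \<forall>\<^sub>F z in nhds z0. norm (pairing f k z - pairing f k z0) \<le> M * norm (z - z0)"
proof -
  obtain N C where C: "C > 0" "\<And>\<phi> B. \<phi> \<in> lizorkin_space \<Longrightarrow> 0 \<le> B \<Longrightarrow>
    (\<And>m1 m2 x. m1 \<le> N \<Longrightarrow> m2 \<le> N \<Longrightarrow> jbracket x ^ N * norm (pd m1 m2 \<phi> x) \<le> B) \<Longrightarrow> norm (f \<phi>) \<le> C * B"
    by (rule lizorkin_dual_bound) blast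
  obtain M where M: "M \<ge> 0" "\<forall>\<^sub>F z in nhds z0. z \<in> shearlet_group \<and> (\<forall>m1\<le>N. \<forall>m2\<le>N. \<forall>x.
    jbracket x ^ N * norm (kpd m1 m2 k (z, x) - kpd m1 m2 k (z0, x)) \<le> M * norm (z - z0))"
    using kernel_close[OF k z0, of N] by blast
  have "\<forall>\<^sub>F z in nhds z0. norm (pairing f k z - pairing f k z0) \<le> (C * M) * norm (z - z0)"
    using M(2)
  proof eventually_elim
    case (elim z)
    then have z: "z \<in> shearlet_group" by blast
    note L = kernel_section_lizorkin[OF k z] kernel_section_lizorkin[OF k z0]
    have "norm (f (\<lambda>x. k (z, x) - k (z0, x))) \<le> C * (M * norm (z - z0))"
    proof (rule C(2))
      show "(\<lambda>x. k (z, x) - k (z0, x)) \<in> lizorkin_space" by (intro lizorkin_diff L)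
      fix m1 m2 x assume m: "m1 \<le> N" "m2 \<le> N"
      show "jbracket x ^ N * norm (pd m1 m2 (\<lambda>x. k (z, x) - k (z0, x)) x) \<le> M * norm (z - z0)"
        using elim m by (simp add: pd_diff lizorkin_schwartz L pd_kernel k z z0)
    qed (use M(1) in simp)
    then show ?case
      by (simp add: pairing_def lizorkin_dual_diff[OF L])
  qed
  then show ?thesis by blast
qed

lemma pairing_continuous:
  assumes k: "k \<in> kernels"
  shows "continuous_on shearlet_group (pairing f k)"
proof (rule continuous_at_imp_continuous_on, rule ballI)
  fix z0 assume "z0 \<in> shearlet_group"
  then obtain M where M: "\<forall>\<^sub>F z in nhds z0. norm (pairing f k z - pairing f k z0) \<le> M * norm (z - z0)"
    using pairing_local_lipschitz[OF k] by blast
  have "((\<lambda>z. pairing f k z - pairing f k z0) \<longlongrightarrow> 0) (at z0)"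
  proof (rule Lim_null_comparison)
    show "\<forall>\<^sub>F z in at z0. norm (pairing f k z - pairing f k z0) \<le> M * norm (z - z0)"
      using M by (simp add: eventually_at_filter eventually_mono)
    have "((\<lambda>z. M * norm (z - z0)) \<longlongrightarrow> M * norm (z0 - z0)) (at z0)"
      by (intro tendsto_intros)
    then show "((\<lambda>z. M * norm (z - z0)) \<longlongrightarrow> 0) (at z0)" by simp
  qed
  then show "isCont (pairing f k) z0"
    by (simp add: isCont_def LIM_zero_iff)
qed

text \<open>Differentiation in z falls on the kernel, so the pairings with kernels form a class
  closed under derivatives.\<close>

lemma pairing_smooth:
  assumes k: "k \<in> kernels"
    and h: "\<And>z. z \<in> shearlet_group \<Longrightarrow> h z = pairing f k z"
  shows "smooth_on shearlet_group h"
proof (rule smooth_on_coinduct[where P = "\<lambda>g. \<exists>k\<in>kernels. g = pairing f k", OF open_shearlet_group])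
  fix g assume "\<exists>k\<in>kernels. g = pairing f k"
  then obtain k where k: "k \<in> kernels" "g = pairing f k" by auto
  show "continuous_on shearlet_group g"
    unfolding k(2) by (rule pairing_continuous[OF k(1)])
  show "\<exists>g'. (\<exists>k\<in>kernels. g' = pairing f k) \<and>
      (\<forall>z\<in>shearlet_group. line_deriv g z v (g' z))" for v
    unfolding k(2) using pairing_has_vector_derivative[OF k(1)] kd_kernel[OF k(1)] by blast
qed (use k h in auto)

lemma kernel_bound_all:
  assumes k: "k \<in> kernels"
  shows "\<exists>A n. 0 \<le> A \<and> (\<forall>z\<in>shearlet_group. \<forall>m1\<le>N. \<forall>m2\<le>N. \<forall>x. jbracket x ^ N * norm (kpd m1 m2 k (z, x)) \<le> A * weight z ^ n)"
proof -
  have "\<exists>A n. 0 \<le> A \<and> (\<forall>z\<in>shearlet_group. \<forall>x. jbracket x ^ N * norm (kpd m1 m2 k (z, x)) \<le> A * weight z ^ n)" for m1 m2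
    using kernel_bound[OF kpd_kernel[OF k, of m1 m2], of N] by metis
  then obtain A n where A: "\<And>m1 m2. 0 \<le> A m1 m2"
    "\<And>m1 m2 z x. z \<in> shearlet_group \<Longrightarrow> jbracket x ^ N * norm (kpd m1 m2 k (z, x)) \<le> A m1 m2 * weight z ^ n m1 m2"
    by metis
  let ?A = "\<Sum>m1\<le>N. \<Sum>m2\<le>N. A m1 m2" and ?n = "\<Sum>m1\<le>N. \<Sum>m2\<le>N. n m1 m2"
  have "jbracket x ^ N * norm (kpd m1 m2 k (z, x)) \<le> ?A * weight z ^ ?n"
    if z: "z \<in> shearlet_group" and m: "m1 \<le> N" "m2 \<le> N" for z m1 m2 x
  proof -
    have "A m1 m2 \<le> (\<Sum>m2\<le>N. A m1 m2)" using m A(1) by (intro member_le_sum) auto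
    also have "\<dots> \<le> ?A" using m A(1) by (intro member_le_sum[of m1 "{..N}" "\<lambda>m1. \<Sum>m2\<le>N. A m1 m2"] sum_nonneg) auto
    finally have a: "A m1 m2 \<le> ?A" .
    have "n m1 m2 \<le> (\<Sum>m2\<le>N. n m1 m2)" using m by (intro member_le_sum) auto
    also have "\<dots> \<le> ?n" using m by (intro member_le_sum[of m1 "{..N}" "\<lambda>m1. \<Sum>m2\<le>N. n m1 m2"]) auto
    finally have n: "n m1 m2 \<le> ?n" .
    have "jbracket x ^ N * norm (kpd m1 m2 k (z, x)) \<le> A m1 m2 * weight z ^ n m1 m2" by (rule A(2)[OF z])
    also have "\<dots> \<le> ?A * weight z ^ ?n"
      using a n A(1)[of m1 m2] weight_ge_1[OF z] by (intro mult_mono power_increasing) auto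
    finally show ?thesis .
  qed
  moreover have "0 \<le> ?A" using A(1) by (intro sum_nonneg) auto
  ultimately show ?thesis by blast
qed

lemma pairing_growth:
  assumes k: "k \<in> kernels"
  obtains A n where "0 \<le> A" "\<And>z. z \<in> shearlet_group \<Longrightarrow> norm (pairing f k z) \<le> A * weight z ^ n"
proof -
  obtain N C where C: "C > 0" "\<And>\<phi> B. \<phi> \<in> lizorkin_space \<Longrightarrow> 0 \<le> B \<Longrightarrow>
    (\<And>m1 m2 x. m1 \<le> N \<Longrightarrow> m2 \<le> N \<Longrightarrow> jbracket x ^ N * norm (pd m1 m2 \<phi> x) \<le> B) \<Longrightarrow> norm (f \<phi>) \<le> C * B"
    by (rule lizorkin_dual_bound) blast
  obtain A n where A: "0 \<le> A" "\<And>z m1 m2 x. z \<in> shearlet_group \<Longrightarrow> m1 \<le> N \<Longrightarrow> m2 \<le> N \<Longrightarrow>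
      jbracket x ^ N * norm (kpd m1 m2 k (z, x)) \<le> A * weight z ^ n"
    using kernel_bound_all[OF k, of N] by blast
  have "norm (pairing f k z) \<le> (C * A) * weight z ^ n" if z: "z \<in> shearlet_group" for z
    unfolding pairing_def mult.assoc
    using A(1) A(2)[OF z] weight_nonneg[of z]
    by (intro C(2) kernel_section_lizorkin k z) (simp_all add: pd_kernel k z)
  then show thesis using that[of "C * A" n] C(1) A(1) by simp
qed

lemma mass_mono:
  assumes G: "G \<in> rapid" and "n \<le> m"
  shows "mass n G \<le> mass m G"
  unfolding mass_def
proof (rule integral_mono[OF integrable_weight_rapid[OF G] integrable_weight_rapid[OF G]])
  fix z
  show "weight z ^ n * norm (G z) \<le> weight z ^ m * norm (G z)"
  proof (cases "z \<in> shearlet_group")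
    case True
    then show ?thesis
      using weight_ge_1[OF True] assms(2) by (intro mult_right_mono power_increasing) auto
  qed (simp add: rapid_outside[OF G])
qed

text \<open>Plane derivatives of a superposition are superpositions of differentiated kernels. The
  seminorms of \<open>synth k G\<close> are thus bounded by a mass before \<open>f\<close> and the
  integral are exchanged.\<close>

lemma functional_synth_bound:
  assumes k: "k \<in> kernels"
  obtains A n where "0 \<le> A" "\<And>G. G \<in> rapid \<Longrightarrow> norm (f (synth k G)) \<le> A * mass n G"
proof -
  obtain N C where C: "C > 0" "\<And>\<phi> B. \<phi> \<in> lizorkin_space \<Longrightarrow> 0 \<le> B \<Longrightarrow>
    (\<And>m1 m2 x. m1 \<le> N \<Longrightarrow> m2 \<le> N \<Longrightarrow> jbracket x ^ N * norm (pd m1 m2 \<phi> x) \<le> B) \<Longrightarrow> norm (f \<phi>) \<le> C * B"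
    by (rule lizorkin_dual_bound) blast
  obtain A n where A: "0 \<le> A" "\<And>z m1 m2 x. z \<in> shearlet_group \<Longrightarrow> m1 \<le> N \<Longrightarrow> m2 \<le> N \<Longrightarrow>
      jbracket x ^ N * norm (kpd m1 m2 k (z, x)) \<le> A * weight z ^ n"
    using kernel_bound_all[OF k, of N] by blast
  have "norm (f (synth k G)) \<le> (C * A) * mass n G" if G: "G \<in> rapid" for G
    unfolding mult.assoc
  proof (rule C(2)[OF synth_lizorkin[OF G k]])
    fix m1 m2 x assume m: "m1 \<le> N" "m2 \<le> N"
    have "norm (synth (kpd m1 m2 k) G x) \<le> A * inverse (jbracket x ^ N) * mass n G"
      unfolding synth_def
      using le_inverse_jbracketI[OF A(2)[OF _ m]]
      by (intro norm_integral_rapid_mult[OF G] kernel_section_measurable G kpd_kernel k) (simp add: mult_ac)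
    then show "jbracket x ^ N * norm (pd m1 m2 (synth k G) x) \<le> A * mass n G"
      unfolding pd_synth[OF G k] using jbracket_pos[of x] by (simp add: field_simps)
  qed (use A(1) mass_nonneg[of n G] in simp)
  then show thesis using that[of "C * A" n] C(1) A(1) by simp
qed

lemma rapid_mult_pairing_integrable:
  assumes k: "k \<in> kernels" and G: "G \<in> rapid"
  shows rapid_mult_pairing_measurable: "(\<lambda>z. G z * pairing f k z) \<in> borel_measurable borel"
    and "integrable lborel (\<lambda>z. G z * pairing f k z)"
proof -
  have "(\<lambda>z. indicator shearlet_group z *\<^sub>R pairing f k z) \<in> borel_measurable borel"
    by (intro borel_measurable_continuous_on_indicator borel_open open_shearlet_group pairing_continuous f k)
  from borel_measurable_times[OF rapid_measurable[OF G] this]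
  have "(\<lambda>z. G z * (indicator shearlet_group z *\<^sub>R pairing f k z)) \<in> borel_measurable borel" .
  moreover have "(\<lambda>z. G z * (indicator shearlet_group z *\<^sub>R pairing f k z)) = (\<lambda>z. G z * pairing f k z)"
    using rapid_outside[OF G] by (force simp: fun_eq_iff indicator_def)
  ultimately show m: "(\<lambda>z. G z * pairing f k z) \<in> borel_measurable borel" by metis
  obtain A n where "0 \<le> A" "\<And>z. z \<in> shearlet_group \<Longrightarrow> norm (pairing f k z) \<le> A * weight z ^ n"
    by (rule pairing_growth[OF k]) blast
  then show "integrable lborel (\<lambda>z. G z * pairing f k z)"
    by (intro integrable_rapid_mult[OF G m])
qed

section \<open>Interchanging functional and superposition\<close>

lemma restr_rapid:
  assumes G: "G \<in> rapid" and Q: "Q \<in> sets borel"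
  shows "restr Q G \<in> rapid"
  unfolding rapid_def
proof (intro CollectI conjI allI impI)
  show "restr Q G \<in> borel_measurable borel"
    unfolding restr_def [abs_def] using rapid_measurable[OF G] Q by simp
  show "restr Q G z = 0" if "z \<notin> shearlet_group" for z
    using rapid_outside[OF G that] by (simp add: restr_def)
  fix n
  obtain C where C: "\<And>z. weight z ^ n * norm (G z) \<le> C"
    using G unfolding rapid_def by blast
  have "weight z ^ n * norm (restr Q G z) \<le> max C 0" for z
    using C[of z] by (simp add: restr_def indicator_def le_max_iff_disj)
  then show "\<exists>C. \<forall>z. weight z ^ n * norm (restr Q G z) \<le> C" by blast
qed

lemma defect_add:
  assumes k: "k \<in> kernels" and G: "G \<in> rapid" "H \<in> rapid"
  shows "defect f k (\<lambda>z. G z + H z) = defect f k G + defect f k H"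
proof -
  have "synth k (\<lambda>z. G z + H z) = (\<lambda>x. synth k G x + synth k H x)"
    using synth_integrable[OF G(1) k] synth_integrable[OF G(2) k]
    by (simp add: synth_def fun_eq_iff distrib_right)
  then have "f (synth k (\<lambda>z. G z + H z)) = f (synth k G) + f (synth k H)"
    using lizorkin_dual_add[OF synth_lizorkin[OF G(1) k] synth_lizorkin[OF G(2) k]] by simp
  moreover have "(LINT z|lborel. (G z + H z) * pairing f k z) =
      (LINT z|lborel. G z * pairing f k z) + (LINT z|lborel. H z * pairing f k z)"
    using rapid_mult_pairing_integrable(2)[OF k G(1)] rapid_mult_pairing_integrable(2)[OF k G(2)]
    by (simp add: distrib_right)
  ultimately show ?thesis by (simp add: defect_def)
qed

text \<open>A coarse bound that estimates the two halves of the defect separately; it serves for the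
  part of G that is not yet covered.\<close>

lemma defect_bound:
  assumes k: "k \<in> kernels"
  obtains A n where "0 \<le> A" "\<And>G. G \<in> rapid \<Longrightarrow> norm (defect f k G) \<le> A * mass n G"
proof -
  obtain A n where A: "0 \<le> A" "\<And>G. G \<in> rapid \<Longrightarrow> norm (f (synth k G)) \<le> A * mass n G"
    by (rule functional_synth_bound[OF k]) blast
  obtain B m where B: "0 \<le> B" "\<And>z. z \<in> shearlet_group \<Longrightarrow> norm (pairing f k z) \<le> B * weight z ^ m"
    by (rule pairing_growth[OF k]) blast
  have "norm (defect f k G) \<le> (A + B) * mass (n + m) G" if G: "G \<in> rapid" for G
  proof -
    have "norm (defect f k G) \<le> norm (f (synth k G)) + norm (LINT z|lborel. G z * pairing f k z)"
      unfolding defect_def by (rule norm_triangle_ineq4)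
    also have "\<dots> \<le> A * mass n G + B * mass m G"
      by (intro add_mono A(2)[OF G] norm_integral_rapid_mult[OF G rapid_mult_pairing_measurable[OF k G] B(2)])
    also have "\<dots> \<le> A * mass (n + m) G + B * mass (n + m) G"
      by (intro add_mono mult_left_mono mass_mono[OF G] A(1) B(1)) auto
    finally show ?thesis by (simp add: distrib_right)
  qed
  then show thesis using that[of "A + B" "n + m"] A(1) B(1) by simp
qed

lemma norm_integral_restr:
  assumes G: "G \<in> rapid" and int: "integrable lborel (\<lambda>z. G z * h z)"
    and h: "\<And>z. G z \<noteq> 0 \<Longrightarrow> norm (h z) \<le> \<delta>"
  shows "norm (LINT z|lborel. G z * h z) \<le> \<delta> * mass 0 G"
proof -
  have "norm (LINT z|lborel. G z * h z) \<le> (LINT z|lborel. norm (G z * h z))"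
    by (rule integral_norm_bound)
  also have "\<dots> \<le> (LINT z|lborel. \<delta> * (weight z ^ 0 * norm (G z)))"
  proof (rule integral_mono[OF integrable_norm[OF int]])
    show "integrable lborel (\<lambda>z. \<delta> * (weight z ^ 0 * norm (G z)))"
      by (intro integrable_mult_right integrable_weight_rapid G)
    show "norm (G z * h z) \<le> \<delta> * (weight z ^ 0 * norm (G z))" for z
      using mult_right_mono[OF h[of z] norm_ge_zero[of "G z"]]
      by (cases "G z = 0") (simp_all add: norm_mult mult.commute)
  qed
  finally show ?thesis by (simp add: mass_def)
qed

text \<open>On a small set the kernel is nearly constant in the group variable, and for a constant kernel the
  defect vanishes by linearity.\<close>

lemma defect_small:
  assumes k: "k \<in> kernels"
    and z0: "z0 \<in> shearlet_group" and \<epsilon>: "\<epsilon> > 0"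
  obtains U where "open U" "z0 \<in> U" "\<And>G. G \<in> rapid \<Longrightarrow> (\<And>z. z \<notin> U \<Longrightarrow> G z = 0) \<Longrightarrow> norm (defect f k G) \<le> \<epsilon> * mass 0 G"
proof -
  obtain N C where C: "C > 0" "\<And>\<phi> B. \<phi> \<in> lizorkin_space \<Longrightarrow> 0 \<le> B \<Longrightarrow>
    (\<And>m1 m2 x. m1 \<le> N \<Longrightarrow> m2 \<le> N \<Longrightarrow> jbracket x ^ N * norm (pd m1 m2 \<phi> x) \<le> B) \<Longrightarrow> norm (f \<phi>) \<le> C * B"
    by (rule lizorkin_dual_bound) blast
  obtain M where M: "M \<ge> 0" "\<forall>\<^sub>F z in nhds z0. z \<in> shearlet_group \<and> (\<forall>m1\<le>N. \<forall>m2\<le>N. \<forall>x.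
    jbracket x ^ N * norm (kpd m1 m2 k (z, x) - kpd m1 m2 k (z0, x)) \<le> M * norm (z - z0))"
    using kernel_close[OF k z0, of N] by blast
  \<comment> \<open>The error of \<open>f (synth k G)\<close> and that of the integral of the
    pairing get half of \<open>\<epsilon>\<close> each.\<close>
  define \<delta> where "\<delta> = \<epsilon> / (2 * C)"
  have \<delta>: "\<delta> > 0" "C * \<delta> = \<epsilon> / 2" using C(1) \<epsilon> by (auto simp: \<delta>_def)
  have "((\<lambda>z. M * norm (z - z0)) \<longlongrightarrow> M * norm (z0 - z0)) (nhds z0)"
    by (intro tendsto_intros filterlim_ident)
  then have "((\<lambda>z. M * norm (z - z0)) \<longlongrightarrow> 0) (nhds z0)" by simp
  then have "\<forall>\<^sub>F z in nhds z0. M * norm (z - z0) < \<delta>"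
    by (rule order_tendstoD(2)[OF _ \<delta>(1)])
  with M(2) have "\<forall>\<^sub>F z in nhds z0. z \<in> shearlet_group \<and> (\<forall>m1\<le>N. \<forall>m2\<le>N. \<forall>x.
    jbracket x ^ N * norm (kpd m1 m2 k (z, x) - kpd m1 m2 k (z0, x)) \<le> \<delta>)"
    by eventually_elim (meson less_imp_le order_trans)
  then obtain U where U: "open U" "z0 \<in> U" "\<And>z. z \<in> U \<Longrightarrow> z \<in> shearlet_group"
    "\<And>z m1 m2 x. z \<in> U \<Longrightarrow> m1 \<le> N \<Longrightarrow> m2 \<le> N \<Longrightarrow> jbracket x ^ N * norm (kpd m1 m2 k (z, x) - kpd m1 m2 k (z0, x)) \<le> \<delta>"
    unfolding eventually_nhds by metis
  have "norm (defect f k G) \<le> \<epsilon> * mass 0 G" if G: "G \<in> rapid" and out: "\<And>z. z \<notin> U \<Longrightarrow> G z = 0" for G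
  proof -
    \<comment> \<open>With the kernel frozen at \<open>z0\<close>, the superposition is c times the
      section at \<open>z0\<close> and the integral of the pairing is c times its value there; under
      \<open>f\<close> the two cancel in the defect.\<close>
    define c where "c = (LINT z|lborel. G z)"
    have Gi: "integrable lborel G"
    proof (rule integrable_norm_cancel)
      show "integrable lborel (\<lambda>z. norm (G z))" using integrable_weight_rapid[OF G, of 0] by simp
      show "G \<in> borel_measurable lborel" using rapid_measurable[OF G] by simp
    qed
    note L = synth_lizorkin[OF G k] kernel_section_lizorkin[OF k z0]
    let ?\<phi> = "\<lambda>x. synth k G x - c * k (z0, x)"
    have "norm (f ?\<phi>) \<le> C * (\<delta> * mass 0 G)"
    proof (rule C(2))
      show "?\<phi> \<in> lizorkin_space" by (intro lizorkin_diff lizorkin_cmult L)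
      show "0 \<le> \<delta> * mass 0 G" using \<delta>(1) mass_nonneg[of 0 G] by simp
      fix m1 m2 x assume m: "m1 \<le> N" "m2 \<le> N"
      let ?l = "kpd m1 m2 k"
      have eq: "(\<lambda>z. G z * (?l (z, x) - ?l (z0, x))) = (\<lambda>z. G z * ?l (z, x) - G z * ?l (z0, x))"
        by (simp add: fun_eq_iff algebra_simps)
      have int: "integrable lborel (\<lambda>z. G z * (?l (z, x) - ?l (z0, x)))"
        unfolding eq using synth_integrable[OF G kpd_kernel[OF k]] Gi by simp
      have "pd m1 m2 ?\<phi> x = synth ?l G x - c * ?l (z0, x)"
        using L by (simp add: pd_diff pd_cmult schwartz_cmult lizorkin_schwartz pd_synth[OF G k] pd_kernel[OF k z0])
      also have "\<dots> = (LINT z|lborel. G z * (?l (z, x) - ?l (z0, x)))"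
        unfolding eq synth_def c_def using synth_integrable[OF G kpd_kernel[OF k]] Gi by simp
      finally have "norm (pd m1 m2 ?\<phi> x) = norm (LINT z|lborel. G z * (?l (z, x) - ?l (z0, x)))" by simp
      also have "\<dots> \<le> (\<delta> * inverse (jbracket x ^ N)) * mass 0 G"
      proof (rule norm_integral_restr[OF G int])
        fix z assume "G z \<noteq> 0"
        then have "z \<in> U" using out by blast
        from U(4)[OF this m] show "norm (?l (z, x) - ?l (z0, x)) \<le> \<delta> * inverse (jbracket x ^ N)"
          by (rule le_inverse_jbracketI)
      qed
      finally show "jbracket x ^ N * norm (pd m1 m2 ?\<phi> x) \<le> \<delta> * mass 0 G"
        using jbracket_pos[of x] by (simp add: field_simps)
    qed
    moreover have "f ?\<phi> = f (synth k G) - c * pairing f k z0"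
      using L by (simp add: lizorkin_dual_diff lizorkin_cmult lizorkin_dual_cmult pairing_def)
    ultimately have 1: "norm (f (synth k G) - c * pairing f k z0) \<le> \<epsilon> / 2 * mass 0 G"
      by (simp only: mult.assoc[symmetric] \<delta>(2))
    have eq: "(\<lambda>z. G z * (pairing f k z - pairing f k z0)) = (\<lambda>z. G z * pairing f k z - G z * pairing f k z0)"
      by (simp add: fun_eq_iff algebra_simps)
    have int: "integrable lborel (\<lambda>z. G z * (pairing f k z - pairing f k z0))"
      unfolding eq using rapid_mult_pairing_integrable(2)[OF k G] Gi by simp
    have "norm (LINT z|lborel. G z * (pairing f k z - pairing f k z0)) \<le> (\<epsilon> / 2) * mass 0 G"
    proof (rule norm_integral_restr[OF G int])
      fix z assume "G z \<noteq> 0"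
      then have zU: "z \<in> U" using out by blast
      note z = U(3)[OF zU]
      note L = kernel_section_lizorkin[OF k z] kernel_section_lizorkin[OF k z0]
      have "norm (f (\<lambda>x. k (z, x) - k (z0, x))) \<le> C * \<delta>"
      proof (rule C(2))
        show "(\<lambda>x. k (z, x) - k (z0, x)) \<in> lizorkin_space" by (intro lizorkin_diff L)
        fix m1 m2 x assume m: "m1 \<le> N" "m2 \<le> N"
        show "jbracket x ^ N * norm (pd m1 m2 (\<lambda>x. k (z, x) - k (z0, x)) x) \<le> \<delta>"
          using U(4)[OF zU m, of x] by (simp add: pd_diff lizorkin_schwartz L pd_kernel k z z0)
      qed (use \<delta>(1) in simp)
      then show "norm (pairing f k z - pairing f k z0) \<le> \<epsilon> / 2"
        unfolding \<delta>(2) by (simp add: pairing_def lizorkin_dual_diff[OF L])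
    qed
    moreover have "(LINT z|lborel. G z * (pairing f k z - pairing f k z0)) =
        (LINT z|lborel. G z * pairing f k z) - c * pairing f k z0"
      unfolding eq c_def using rapid_mult_pairing_integrable(2)[OF k G] Gi by simp
    ultimately have 2: "norm ((LINT z|lborel. G z * pairing f k z) - c * pairing f k z0) \<le> \<epsilon> / 2 * mass 0 G"
      by simp
    have "defect f k G = (f (synth k G) - c * pairing f k z0) - ((LINT z|lborel. G z * pairing f k z) - c * pairing f k z0)"
      by (simp add: defect_def)
    then have "norm (defect f k G) \<le> \<epsilon> / 2 * mass 0 G + \<epsilon> / 2 * mass 0 G"
      by (simp only:) (rule order_trans[OF norm_triangle_ineq4 add_mono[OF 1 2]])
    then show ?thesis by (simp add: field_simps)
  qed
  then show thesis using that[OF U(1,2)] by blast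
qed

lemma mass_restr_disjoint:
  assumes G: "G \<in> rapid" and Q: "P \<in> sets borel" "Q \<in> sets borel" "P \<inter> Q = {}"
  shows "mass n (restr P G) + mass n (restr Q G) = mass n (restr (P \<union> Q) G)"
proof -
  have "mass n (restr P G) + mass n (restr Q G) =
      (LINT z|lborel. weight z ^ n * norm (restr P G z) + weight z ^ n * norm (restr Q G z))"
    unfolding mass_def
    using integrable_weight_rapid[OF restr_rapid[OF G Q(1)]] integrable_weight_rapid[OF restr_rapid[OF G Q(2)]] by simp
  also have "\<dots> = mass n (restr (P \<union> Q) G)"
    unfolding mass_def using Q(3)
    by (intro Bochner_Integration.integral_cong refl) (auto simp: restr_def indicator_def)
  finally show ?thesis .
qed

lemma restr_Un:
  assumes "P \<inter> Q = {}"
  shows "restr (P \<union> Q) G = (\<lambda>z. restr P G z + restr Q G z)"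
  using assms by (auto simp: restr_def indicator_def fun_eq_iff)

text \<open>Exact additivity of \<open>mass 0\<close> over disjoint pieces keeps the accumulated
  error below \<open>\<epsilon> * mass 0 G\<close>, however many pieces are used.\<close>

lemma functional_synth:
  assumes k: "k \<in> kernels" and G: "G \<in> rapid"
  shows "f (synth k G) = (LINT z|lborel. G z * pairing f k z)"
proof -
  obtain A n where A: "0 \<le> A" "\<And>G. G \<in> rapid \<Longrightarrow> norm (defect f k G) \<le> A * mass n G"
    by (rule defect_bound[OF k]) blast
  have main: "norm (defect f k G) \<le> \<epsilon> * mass 0 G" if \<epsilon>: "\<epsilon> > 0" for \<epsilon>
  proof -
    \<comment> \<open>Quantifying over all Borel subsets makes the property hereditary, so that
      overlapping sets can be split into disjoint pieces.\<close>
    define good where "good U \<longleftrightarrow> (\<forall>Q\<in>sets borel. Q \<subseteq> U \<longrightarrow> norm (defect f k (restr Q G)) \<le> \<epsilon> * mass 0 (restr Q G))" for U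
    define \<F> where "\<F> = {U. open U \<and> good U}"
    have Un: "good (U \<union> V)" if U: "good U" "U \<in> sets borel" and V: "good V" for U V
      unfolding good_def
    proof (intro ballI impI)
      fix Q assume Q: "Q \<in> sets borel" "Q \<subseteq> U \<union> V"
      let ?P = "Q \<inter> U" and ?R = "Q - U"
      have m: "?P \<in> sets borel" "?R \<in> sets borel" "?P \<inter> ?R = {}" "?P \<union> ?R = Q" using Q U by auto
      have "defect f k (restr Q G) = defect f k (restr ?P G) + defect f k (restr ?R G)"
        using defect_add[OF k restr_rapid[OF G m(1)] restr_rapid[OF G m(2)]] restr_Un[OF m(3), of G] m(4) by simp
      then have "norm (defect f k (restr Q G)) \<le> norm (defect f k (restr ?P G)) + norm (defect f k (restr ?R G))"
        by (simp add: norm_triangle_ineq)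
      also have "\<dots> \<le> \<epsilon> * mass 0 (restr ?P G) + \<epsilon> * mass 0 (restr ?R G)"
        using U(1) V m Q(2) unfolding good_def by (intro add_mono) auto
      also have "\<dots> = \<epsilon> * mass 0 (restr Q G)"
        using mass_restr_disjoint[OF G m(1-3), of 0] m(4) by (simp add: distrib_left[symmetric])
      finally show "norm (defect f k (restr Q G)) \<le> \<epsilon> * mass 0 (restr Q G)" .
    qed
    have cover: "shearlet_group \<subseteq> \<Union>\<F>"
    proof
      fix z0 assume z0: "z0 \<in> shearlet_group"
      obtain U where U: "open U" "z0 \<in> U" "\<And>G. G \<in> rapid \<Longrightarrow> (\<And>z. z \<notin> U \<Longrightarrow> G z = 0) \<Longrightarrow> norm (defect f k G) \<le> \<epsilon> * mass 0 G"
        using defect_small[OF k z0 \<epsilon>] by metis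
      have "good U"
        unfolding good_def
      proof (intro ballI impI U(3) restr_rapid G)
        fix Q z assume "Q \<subseteq> U" "z \<notin> U"
        then show "restr Q G z = 0" by (auto simp: restr_def indicator_def)
      qed
      then show "z0 \<in> \<Union>\<F>" using U by (auto simp: \<F>_def)
    qed
    \<comment> \<open>Lindelof property: countably many of these open sets already have the same
      union.\<close>
    obtain \<F>' where F': "\<F>' \<subseteq> \<F>" "countable \<F>'" "\<Union>\<F>' = \<Union>\<F>"
      using Lindelof[of \<F>] by (auto simp: \<F>_def)
    have "\<F>' \<noteq> {}"
    proof
      assume "\<F>' = {}"
      then have "(0, 0, 1) \<notin> shearlet_group" using cover F'(3) by auto
      then show False by (simp add: mem_shearlet_group)
    qed
    define U where "U i = from_nat_into \<F>' i" for i
    have Ui: "open (U i) \<and> good (U i)" for i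
      using from_nat_into[OF \<open>\<F>' \<noteq> {}\<close>, of i] F'(1) by (auto simp: U_def \<F>_def)
    have UU: "shearlet_group \<subseteq> (\<Union>i. U i)"
      using cover F' range_from_nat_into[OF \<open>\<F>' \<noteq> {}\<close> F'(2)] by (auto simp: U_def)
    define V where "V j = (\<Union>i<j. U i)" for j
    have Vb: "V j \<in> sets borel" for j
      using Ui by (auto simp: V_def intro!: borel_open open_UN)
    have Vg: "good (V j)" for j
    proof (induction j)
      case 0
      have "restr {} G = (\<lambda>z. 0)" by (simp add: restr_def fun_eq_iff)
      moreover have "norm (defect f k (\<lambda>z. 0)) \<le> \<epsilon> * mass 0 (\<lambda>z. 0)"
      proof -
        have r: "(\<lambda>z. 0) \<in> rapid" by (auto simp: rapid_def)
        show ?thesis using A(2)[OF r] by (simp add: mass_def)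
      qed
      ultimately show ?case by (simp add: good_def V_def)
    next
      case (Suc j)
      have "V (Suc j) = V j \<union> U j" by (auto simp: V_def less_Suc_eq)
      then show ?case using Un[OF Suc Vb] Ui by simp
    qed
    have bound: "norm (defect f k G) \<le> \<epsilon> * mass 0 G + A * mass n (restr (- V j) G)" for j
    proof -
      have m: "- V j \<in> sets borel" using Vb[of j] by (simp add: sets.compl_sets Compl_eq_Diff_UNIV)
      have U: "V j \<union> - V j = UNIV" "V j \<inter> - V j = {}" by auto
      have G': "restr (V j \<union> - V j) G = G" by (simp add: U(1) restr_def fun_eq_iff)
      have "defect f k G = defect f k (restr (V j) G) + defect f k (restr (- V j) G)"
        using defect_add[OF k restr_rapid[OF G Vb] restr_rapid[OF G m], of j] restr_Un[OF U(2), of G] G' by simp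
      then have "norm (defect f k G) \<le> norm (defect f k (restr (V j) G)) + norm (defect f k (restr (- V j) G))"
        by (simp add: norm_triangle_ineq)
      also have "\<dots> \<le> \<epsilon> * mass 0 (restr (V j) G) + A * mass n (restr (- V j) G)"
        using Vg[of j] Vb[of j] A(2)[OF restr_rapid[OF G m]] unfolding good_def by (intro add_mono) auto
      also have "\<dots> \<le> \<epsilon> * mass 0 G + A * mass n (restr (- V j) G)"
      proof -
        have "mass 0 (restr (V j) G) \<le> mass 0 G"
          using mass_restr_disjoint[OF G Vb m U(2), of 0] mass_nonneg[of 0 "restr (- V j) G"] G' by simp
        then show ?thesis using \<epsilon> by simp
      qed
      finally show ?thesis .
    qed
    \<comment> \<open>Each point of the group lies in \<open>V j\<close> from some j on, and G
      vanishes off the group; the full weighted norm of G is the integrable majorant.\<close>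
    have "(\<lambda>j. mass n (restr (- V j) G)) \<longlonglongrightarrow> (LINT z|(lborel :: shear_point measure). 0)"
      unfolding mass_def
    proof (rule integral_dominated_convergence[where w = "\<lambda>z. weight z ^ n * norm (G z)"])
      show "integrable lborel (\<lambda>z. weight z ^ n * norm (G z))" by (rule integrable_weight_rapid[OF G])
      show "(\<lambda>z. weight z ^ n * norm (restr (- V j) G z)) \<in> borel_measurable lborel" for j
        using integrable_weight_rapid[OF restr_rapid[OF G, of "- V j"], of n] Vb[of j]
        by (intro borel_measurable_integrable) (simp add: sets.compl_sets Compl_eq_Diff_UNIV)
      show "AE z in lborel. (\<lambda>j. weight z ^ n * norm (restr (- V j) G z)) \<longlonglongrightarrow> 0"
      proof (rule AE_I2)
        fix z
        show "(\<lambda>j. weight z ^ n * norm (restr (- V j) G z)) \<longlonglongrightarrow> 0"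
        proof (cases "z \<in> shearlet_group")
          case True
          then obtain i where i: "z \<in> U i" using UU by blast
          have "\<forall>\<^sub>F j in sequentially. weight z ^ n * norm (restr (- V j) G z) = 0"
            using eventually_gt_at_top[of i]
          proof eventually_elim
            case (elim j)
            then have "z \<in> V j" using i by (auto simp: V_def)
            then show ?case by (simp add: restr_def)
          qed
          then show ?thesis by (rule tendsto_eventually)
        next
          case False
          then show ?thesis by (simp add: restr_def rapid_outside[OF G])
        qed
      qed
      show "AE z in lborel. norm (weight z ^ n * norm (restr (- V j) G z)) \<le> weight z ^ n * norm (G z)" for j
        by (intro AE_I2) (auto simp: restr_def indicator_def weight_nonneg)
    qed simp
    then have "(\<lambda>j. \<epsilon> * mass 0 G + A * mass n (restr (- V j) G)) \<longlonglongrightarrow> \<epsilon> * mass 0 G + A * 0"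
      by (intro tendsto_intros) simp
    then show ?thesis
      using bound by (intro LIMSEQ_le_const[of _ "\<epsilon> * mass 0 G"]) auto
  qed
  have "norm (defect f k G) \<le> 0"
  proof (rule field_le_epsilon)
    fix e :: real assume e: "e > 0"
    \<comment> \<open>The 1 in the denominator covers the case of zero mass.\<close>
    have "norm (defect f k G) \<le> e / (mass 0 G + 1) * mass 0 G"
      using e mass_nonneg[of 0 G] by (intro main) (simp add: add_nonneg_pos)
    also have "\<dots> \<le> e"
      using e mass_nonneg[of 0 G] by (simp add: field_simps)
    finally show "norm (defect f k G) \<le> 0 + e" by simp
  qed
  then show ?thesis by (simp add: defect_def)
qed

end

section \<open>Continuity on the group side\<close>

text \<open>Converts the factor (|a| + 1/|a|)^n in a power of the weight into the sum |a|^n +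
  1/|a|^n found in the group norms and in \<open>polynomial_growth\<close>.\<close>

lemma sum_power_le:
  fixes x y :: real
  assumes "0 \<le> x" "0 \<le> y"
  shows "(x + y) ^ n \<le> 2 ^ n * (x ^ n + y ^ n)"
proof -
  have "(x + y) ^ n \<le> (2 * max x y) ^ n"
    using assms by (intro power_mono) auto
  also have "\<dots> = 2 ^ n * max x y ^ n" by (simp add: power_mult_distrib)
  also have "max x y ^ n \<le> x ^ n + y ^ n"
    using assms by (auto simp: max_def)
  finally show ?thesis by simp
qed

text \<open>A single group norm, without derivatives and with all four exponents equal to n,
  controls n powers of the weight.\<close>

lemma weight_le_group_norm:
  assumes z: "z \<in> shearlet_group" and le: "group_norm n n n n 0 0 0 0 \<Phi> \<le> ennreal c" and c: "0 \<le> c"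
  shows "weight z ^ n * norm (\<Phi> z) \<le> 2 ^ n * c"
proof -
  obtain b s a where bsa: "z = (b, s, a)" by (cases z)
  have a: "a \<noteq> 0" using z by (simp add: bsa mem_shearlet_group)
  let ?J = "jbracket (b $ 1) ^ n * jbracket (b $ 2) ^ n * jbracket s ^ n"
  have J: "0 \<le> ?J" by (simp add: jbracket_pos less_imp_le)
  have "ennreal (?J * (\<bar>a\<bar> ^ n + 1 / \<bar>a\<bar> ^ n) * norm (\<Phi> z)) \<le> group_norm n n n n 0 0 0 0 \<Phi>"
    unfolding group_norm_def by (rule SUP_upper2[OF z]) (simp add: bsa)
  then have "?J * (\<bar>a\<bar> ^ n + 1 / \<bar>a\<bar> ^ n) * norm (\<Phi> z) \<le> c"
    using ennreal_le_iff[OF c] order_trans[OF _ le] by blast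
  moreover have "weight z ^ n \<le> 2 ^ n * (?J * (\<bar>a\<bar> ^ n + 1 / \<bar>a\<bar> ^ n))"
  proof -
    have "weight z ^ n = ?J * (\<bar>a\<bar> + 1 / \<bar>a\<bar>) ^ n"
      by (simp add: weight_def bsa power_mult_distrib)
    also have "\<dots> \<le> ?J * (2 ^ n * (\<bar>a\<bar> ^ n + (1 / \<bar>a\<bar>) ^ n))"
      by (intro mult_left_mono sum_power_le J) auto
    finally show ?thesis by (simp add: power_one_over mult_ac)
  qed
  ultimately have "weight z ^ n * norm (\<Phi> z) \<le> 2 ^ n * (?J * (\<bar>a\<bar> ^ n + 1 / \<bar>a\<bar> ^ n)) * norm (\<Phi> z)"
    and le_c: "?J * (\<bar>a\<bar> ^ n + 1 / \<bar>a\<bar> ^ n) * norm (\<Phi> z) \<le> c"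
    by (auto intro: mult_right_mono)
  then have "weight z ^ n * norm (\<Phi> z) \<le> 2 ^ n * (?J * (\<bar>a\<bar> ^ n + 1 / \<bar>a\<bar> ^ n) * norm (\<Phi> z))"
    by (simp only: mult.assoc)
  also have "\<dots> \<le> 2 ^ n * c" by (rule mult_left_mono[OF le_c]) simp
  finally show ?thesis .
qed

lemma group_schwartz_decaying:
  assumes "\<Phi> \<in> group_schwartz_space"
  shows "\<Phi> \<in> decaying"
  unfolding decaying_def
proof (intro CollectI conjI allI)
  show "continuous_on shearlet_group \<Phi>"
    using assms by (intro smooth_on_continuous) (simp add: group_schwartz_space_def)
  fix n
  have "group_norm n n n n 0 0 0 0 \<Phi> < \<infinity>"
    using assms by (simp add: group_schwartz_space_def)
  then obtain c where "group_norm n n n n 0 0 0 0 \<Phi> = ennreal c" "0 \<le> c"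
    by (cases "group_norm n n n n 0 0 0 0 \<Phi>") auto
  then show "\<exists>C. \<forall>z\<in>shearlet_group. weight z ^ n * norm (\<Phi> z) \<le> C"
    using weight_le_group_norm[of _ n \<Phi> c] by (metis order_refl)
qed

lemma decaying_lincomb:
  assumes "\<Phi> \<in> decaying" "\<Psi> \<in> decaying"
  shows "(\<lambda>z. c * \<Phi> z + d * \<Psi> z) \<in> decaying"
  unfolding decaying_def
proof (intro CollectI conjI allI)
  show "continuous_on shearlet_group (\<lambda>z. c * \<Phi> z + d * \<Psi> z)"
    using assms by (intro continuous_intros) (simp_all add: decaying_def)
  fix n
  obtain A B where AB: "\<And>z. z \<in> shearlet_group \<Longrightarrow> weight z ^ n * norm (\<Phi> z) \<le> A"
    "\<And>z. z \<in> shearlet_group \<Longrightarrow> weight z ^ n * norm (\<Psi> z) \<le> B"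
    using assms unfolding decaying_def by blast
  have "weight z ^ n * norm (c * \<Phi> z + d * \<Psi> z) \<le> norm c * A + norm d * B" if z: "z \<in> shearlet_group" for z
  proof -
    have "weight z ^ n * norm (c * \<Phi> z + d * \<Psi> z) \<le> weight z ^ n * (norm (c * \<Phi> z) + norm (d * \<Psi> z))"
      by (intro mult_left_mono norm_triangle_ineq) (simp add: weight_nonneg)
    also have "\<dots> = norm c * (weight z ^ n * norm (\<Phi> z)) + norm d * (weight z ^ n * norm (\<Psi> z))"
      by (simp add: norm_mult algebra_simps)
    also have "\<dots> \<le> norm c * A + norm d * B"
      by (intro add_mono mult_left_mono AB z) auto
    finally show ?thesis .
  qed
  then show "\<exists>C. \<forall>z\<in>shearlet_group. weight z ^ n * norm (c * \<Phi> z + d * \<Psi> z) \<le> C" by blast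
qed

text \<open>A criterion shared by both functionals of the theorem, as both turn out to be the same
  integral against one function g. By linearity, bounding the values by a single group norm gives
  continuity at every point.\<close>

lemma group_dualI:
  assumes g: "\<And>G. G \<in> rapid \<Longrightarrow> integrable lborel (\<lambda>z. G z * g z)"
    and bound: "\<And>G. G \<in> rapid \<Longrightarrow> norm (LINT z|lborel. G z * g z) \<le> A * mass n G" "0 \<le> A"
    and u: "\<And>\<Phi>. \<Phi> \<in> decaying \<Longrightarrow> u \<Phi> = (LINT z|lborel. haar_lift \<Phi> z * g z)"
  shows "u \<in> topological_dual group_schwartz_topology"
proof -
  have lin: "u (\<lambda>z. c * \<Phi> z + d * \<Psi> z) = c * u \<Phi> + d * u \<Psi>" if \<Phi>: "\<Phi> \<in> decaying" "\<Psi> \<in> decaying" for c d \<Phi> \<Psi>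
  proof -
    have eq: "haar_lift (\<lambda>z. c * \<Phi> z + d * \<Psi> z) z * g z = c * (haar_lift \<Phi> z * g z) + d * (haar_lift \<Psi> z * g z)" for z
      by (simp add: haar_lift_def algebra_simps scaleR_conv_of_real)
    show ?thesis
      unfolding u[OF decaying_lincomb[OF \<Phi>]] u[OF \<Phi>(1)] u[OF \<Phi>(2)] eq
      using g[OF haar_lift_rapid[OF \<Phi>(1)]] g[OF haar_lift_rapid[OF \<Phi>(2)]] by simp
  qed
  obtain c0 where c0: "0 \<le> c0" "\<And>\<Phi> B. \<Phi> \<in> decaying \<Longrightarrow>
      (\<And>z. z \<in> shearlet_group \<Longrightarrow> weight z ^ (n + 5) * norm (\<Phi> z) \<le> B) \<Longrightarrow> mass n (haar_lift \<Phi>) \<le> c0 * B"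
    by (rule mass_haar_lift[of n]) blast
  \<comment> \<open>The exponent n + 5 is the one asked for by \<open>mass_haar_lift\<close>; the
    factor 2 ^ (n + 5) in K below comes from comparing the weight with the group norm.\<close>
  define p where "p = group_norm (n + 5) (n + 5) (n + 5) (n + 5) 0 0 0 0"
  define K where "K = A * (c0 * 2 ^ (n + 5))"
  have K: "0 \<le> K" using c0(1) bound(2) by (simp add: K_def)
  have cont: "norm (u \<Psi> - u \<Phi>) \<le> K * e"
    if \<Phi>: "\<Phi> \<in> decaying" "\<Psi> \<in> decaying" and e: "0 \<le> e" "p (\<lambda>z. \<Psi> z - \<Phi> z) \<le> ennreal e" for \<Phi> \<Psi> e
  proof -
    have D: "(\<lambda>z. \<Psi> z - \<Phi> z) \<in> decaying"
      using decaying_lincomb[OF \<Phi>(2,1), of 1 "-1"] by simp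
    have "u \<Psi> - u \<Phi> = u (\<lambda>z. \<Psi> z - \<Phi> z)"
      using lin[OF \<Phi>(2,1), of 1 "-1"] by simp
    then have "norm (u \<Psi> - u \<Phi>) \<le> A * mass n (haar_lift (\<lambda>z. \<Psi> z - \<Phi> z))"
      using bound(1)[OF haar_lift_rapid[OF D]] by (simp add: u[OF D])
    also have "\<dots> \<le> A * (c0 * (2 ^ (n + 5) * e))"
      using e by (intro mult_left_mono bound(2) c0(2) D weight_le_group_norm) (simp_all add: p_def)
    finally show ?thesis by (simp add: K_def mult_ac)
  qed
  have "continuous_map group_schwartz_topology euclidean u"
    unfolding continuous_map_def
  proof (intro conjI allI impI)
    fix V :: "complex set" assume "openin euclidean V"
    then have V: "open V" by simp
    show "openin group_schwartz_topology {\<Phi> \<in> topspace group_schwartz_topology. u \<Phi> \<in> V}"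
    proof (subst openin_subopen, rule ballI)
      fix \<Phi> assume "\<Phi> \<in> {\<Phi> \<in> topspace group_schwartz_topology. u \<Phi> \<in> V}"
      then have \<Phi>: "\<Phi> \<in> group_schwartz_space" "u \<Phi> \<in> V" by auto
      obtain r where r: "r > 0" "\<And>w. dist w (u \<Phi>) < r \<Longrightarrow> w \<in> V"
        using V \<Phi>(2) unfolding open_dist by blast
      \<comment> \<open>The added 1 covers K = 0 and makes K e strictly smaller than r.\<close>
      define e where "e = r / (K + 1)"
      have e: "e > 0" using r(1) K by (simp add: e_def)
      have Ke: "K * e < r" using r(1) K by (simp add: e_def field_simps)
      let ?T = "{\<Psi> \<in> group_schwartz_space. p (\<lambda>z. \<Psi> z - \<Phi> z) < ennreal e}"
      have "openin group_schwartz_topology ?T"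
        unfolding group_schwartz_topology_def seminorm_topology_def
      proof (rule topology_generated_by_Basis, rule CollectI, intro exI[of _ p] exI[of _ \<Phi>] exI[of _ e] conjI)
        show "p \<in> {group_norm k1 k2 l m \<alpha>1 \<alpha>2 \<beta> \<gamma> | k1 k2 l m \<alpha>1 \<alpha>2 \<beta> \<gamma>. True}"
          unfolding p_def by blast
      qed (use \<Phi> e in auto)
      moreover have "\<Phi> \<in> ?T"
      proof -
        have ne: "shearlet_group \<noteq> {}" using mem_shearlet_group[of "(0, 0, 1)"] by auto
        have "p (\<lambda>z. 0) = 0"
          by (simp add: p_def group_norm_def case_prod_unfold ne)
        then show ?thesis using \<Phi>(1) e by simp
      qed
      moreover have "?T \<subseteq> {\<Phi> \<in> topspace group_schwartz_topology. u \<Phi> \<in> V}"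
      proof
        fix \<Psi> assume "\<Psi> \<in> ?T"
        then have \<Psi>: "\<Psi> \<in> group_schwartz_space" "p (\<lambda>z. \<Psi> z - \<Phi> z) \<le> ennreal e" by auto
        have "norm (u \<Psi> - u \<Phi>) \<le> K * e"
          using \<Phi>(1) \<Psi> e by (intro cont group_schwartz_decaying) auto
        then have "dist (u \<Psi>) (u \<Phi>) < r" using Ke by (simp add: dist_norm)
        then show "\<Psi> \<in> {\<Phi> \<in> topspace group_schwartz_topology. u \<Phi> \<in> V}" using r(2) \<Psi>(1) by simp
      qed
      ultimately show "\<exists>T. openin group_schwartz_topology T \<and> \<Phi> \<in> T \<and>
          T \<subseteq> {\<Phi> \<in> topspace group_schwartz_topology. u \<Phi> \<in> V}"
        by blast
    qed
  qed simp
  moreover have "u (\<lambda>z. \<Phi> z + \<Psi> z) = u \<Phi> + u \<Psi>"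
    if "\<Phi> \<in> group_schwartz_space" "\<Psi> \<in> group_schwartz_space" for \<Phi> \<Psi>
    using lin[OF that[THEN group_schwartz_decaying], of 1 1] by simp
  moreover have "u (\<lambda>z. c * \<Phi> z) = c * u \<Phi>" if "\<Phi> \<in> group_schwartz_space" for \<Phi> c
    using lin[OF group_schwartz_decaying[OF that] group_schwartz_decaying[OF that], of c 0] by simp
  ultimately show ?thesis
    unfolding topological_dual_def topspace_group_schwartz by blast
qed

text \<open>Raising the exponent and the constant by 1 provides the strict positivity demanded by
  \<open>polynomial_growth\<close>. Both coordinate brackets are at most the bracket of b, whence
  the exponent 2 m.\<close>

lemma polynomial_growthI:
  assumes g: "\<And>z. z \<in> shearlet_group \<Longrightarrow> norm (g z) \<le> A * weight z ^ n" and A: "0 \<le> A"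
  shows "polynomial_growth g"
proof -
  define m where "m = n + 1"
  let ?C = "(A + 1) * 2 ^ m"
  have "norm (g (b, s, a)) \<le> ?C * jbracket b powr real (2 * m) * jbracket s powr real m *
      (\<bar>a\<bar> powr real m + \<bar>a\<bar> powr (- real m))" if z: "(b, s, a) \<in> shearlet_group" for b s a
  proof -
    have "a \<noteq> 0" using z by (simp add: mem_shearlet_group)
    then have pa: "\<bar>a\<bar> powr real m = \<bar>a\<bar> ^ m" by (intro powr_realpow) simp
    have jb: "jbracket (b $ i) \<le> jbracket b" for i
      unfolding jbracket_def using component_le_norm_cart[of b i] by (simp add: abs_le_square_iff[symmetric])
    have J0: "0 \<le> jbracket t" for t :: "'x::real_normed_vector" using jbracket_pos[of t] by simp
    have "norm (g (b, s, a)) \<le> A * weight (b, s, a) ^ n" by (rule g[OF z])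
    also have "\<dots> \<le> (A + 1) * weight (b, s, a) ^ m"
      using A weight_ge_1[OF z] by (intro mult_mono power_increasing) (auto simp: m_def)
    also have "weight (b, s, a) ^ m = jbracket (b $ 1) ^ m * jbracket (b $ 2) ^ m * jbracket s ^ m * (\<bar>a\<bar> + 1 / \<bar>a\<bar>) ^ m"
      by (simp add: weight_def power_mult_distrib)
    also have "(A + 1) * \<dots> \<le> (A + 1) * (jbracket b ^ m * jbracket b ^ m * jbracket s ^ m * (2 ^ m * (\<bar>a\<bar> ^ m + (1 / \<bar>a\<bar>) ^ m)))"
      using A jb by (intro mult_left_mono mult_mono sum_power_le power_mono) (auto simp: J0)
    also have "\<dots> = ?C * jbracket b ^ (2 * m) * jbracket s ^ m * (\<bar>a\<bar> ^ m + (1 / \<bar>a\<bar>) ^ m)"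
      unfolding mult_2 power_add by (simp only: mult_ac)
    also have "\<dots> = ?C * jbracket b powr real (2 * m) * jbracket s powr real m * (\<bar>a\<bar> powr real m + \<bar>a\<bar> powr (- real m))"
      by (simp only: powr_realpow[OF jbracket_pos] powr_minus pa power_one_over inverse_eq_divide)
    finally show ?thesis .
  qed
  moreover have "0 < real (2 * m)" "0 < real m" "0 < ?C" using A by (auto simp: m_def)
  ultimately show ?thesis
    unfolding polynomial_growth_def by blast
qed

theorem theorem12:
  fixes \<psi> :: "real^2 \<Rightarrow> complex" and f :: "(real^2 \<Rightarrow> complex) \<Rightarrow> complex"
  assumes "\<psi> \<in> lizorkin_space"
    and "f \<in> topological_dual lizorkin_topology"
  shows "smooth_on shearlet_group (shearlet_transform_function \<psi> f) \<and>
    polynomial_growth (shearlet_transform_function \<psi> f) \<and>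
    distributional_shearlet_transform \<psi> f \<in> topological_dual group_schwartz_topology \<and>
    regular_functional (shearlet_transform_function \<psi> f) \<in> topological_dual group_schwartz_topology \<and>
    (\<forall>\<Phi>\<in>group_schwartz_space.
       distributional_shearlet_transform \<psi> f \<Phi> =
       regular_functional (shearlet_transform_function \<psi> f) \<Phi>)"
proof -
  note f = assms(2)
  define \<eta> where "\<eta> x = cnj (\<psi> x)" for x
  have \<eta>: "\<eta> \<in> lizorkin_space"
    unfolding \<eta>_def [abs_def] by (rule lizorkin_cnj[OF assms(1)])
  define k where "k = shearlet_kernel \<eta>"
  have k: "k \<in> kernels" unfolding k_def by (rule shearlet_kernel_kernels[OF \<eta>])
  \<comment> \<open>Conjugation commutes with the real normalizing factor, so the conjugated
    shearlet is the shearlet of the conjugate. At a = 0 the inverse dilation is unspecified, hence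
    the restriction to the group.\<close>
  have S: "shearlet_transform_function \<psi> f z = pairing f k z" if z: "z \<in> shearlet_group" for z
  proof -
    obtain b s a where bsa: "z = (b, s, a)" by (cases z)
    have "a \<noteq> 0" using z by (simp add: bsa mem_shearlet_group)
    then have "(\<lambda>x. cnj (shearlet b s a \<psi> x)) = (\<lambda>x. k (z, x))"
      by (simp add: shearlet_eq_kernel k_def shearlet_kernel_def \<eta>_def bsa fun_eq_iff)
    then show ?thesis by (simp add: shearlet_transform_function_def pairing_def bsa)
  qed
  obtain A n where A: "0 \<le> A" "\<And>z. z \<in> shearlet_group \<Longrightarrow> norm (pairing f k z) \<le> A * weight z ^ n"
    by (rule pairing_growth[OF f k]) blast
  note int = rapid_mult_pairing_integrable(2)[OF f k]
  have bound: "norm (LINT z|lborel. G z * pairing f k z) \<le> A * mass n G" if G: "G \<in> rapid" for G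
    by (rule norm_integral_rapid_mult[OF G rapid_mult_pairing_measurable[OF f k G] A(2)])
  \<comment> \<open>This is where functional and superposition are exchanged.\<close>
  have dist: "distributional_shearlet_transform \<psi> f \<Phi> = (LINT z|lborel. haar_lift \<Phi> z * pairing f k z)"
    if \<Phi>: "\<Phi> \<in> decaying" for \<Phi>
  proof -
    have "distributional_shearlet_transform \<psi> f \<Phi> = f (shearlet_synthesis \<eta> \<Phi>)"
      by (simp add: distributional_shearlet_transform_def \<eta>_def [abs_def])
    also have "\<dots> = f (synth k (haar_lift \<Phi>))"
      by (simp add: shearlet_synthesis_eq_synth[OF \<eta> \<Phi>] k_def)
    also have "\<dots> = (LINT z|lborel. haar_lift \<Phi> z * pairing f k z)"
      by (rule functional_synth[OF f k haar_lift_rapid[OF \<Phi>]])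
    finally show ?thesis .
  qed
  \<comment> \<open>The same integral is reached from the other side by Fubini alone.\<close>
  have reg: "regular_functional (shearlet_transform_function \<psi> f) \<Phi> = (LINT z|lborel. haar_lift \<Phi> z * pairing f k z)"
    if \<Phi>: "\<Phi> \<in> decaying" for \<Phi>
    unfolding regular_functional_def
  proof (rule iterated_integral_haar[OF int[OF haar_lift_rapid[OF \<Phi>]]])
    fix b :: "real^2" and s a :: real assume "a \<noteq> 0"
    then have "(b, s, a) \<in> shearlet_group" by (simp add: mem_shearlet_group)
    then show "shearlet_transform_function \<psi> f (b, s, a) * \<Phi> (b, s, a) * of_real (\<bar>a\<bar> powi (-3)) =
        \<Phi> (b, s, a) * pairing f k (b, s, a) * of_real (\<bar>a\<bar> powi (-3))"
      by (simp only: S mult.commute)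
  qed
  show ?thesis
  proof (intro conjI ballI)
    show "smooth_on shearlet_group (shearlet_transform_function \<psi> f)"
      by (rule pairing_smooth[OF f k S])
    show "polynomial_growth (shearlet_transform_function \<psi> f)"
      using A S by (intro polynomial_growthI[of _ A n]) simp_all
    show "distributional_shearlet_transform \<psi> f \<in> topological_dual group_schwartz_topology"
      by (rule group_dualI[OF int bound A(1) dist])
    show "regular_functional (shearlet_transform_function \<psi> f) \<in> topological_dual group_schwartz_topology"
      by (rule group_dualI[OF int bound A(1) reg])
    show "distributional_shearlet_transform \<psi> f \<Phi> = regular_functional (shearlet_transform_function \<psi> f) \<Phi>"
      if "\<Phi> \<in> group_schwartz_space" for \<Phi>
      using dist reg group_schwartz_decaying[OF that] by simp
  qed
qed

end
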